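(* Let $X^0\in L^2(\Omega,H^\gamma(\mathbb{S}^2))$ for some $\gamma\ge0$, let $X^{(\kappa)}$ be the spectral approximation of the stochastic heat equation on the sphere and $X^{(\kappa,h)}$ its forward or backward Euler--Maruyama approximation with step size $h=T/n$ on the grid $t_k=kh$ (both defined in the context), with $\kappa\in\mathbb{N}$ and $h$ coupled by $\kappa(\kappa+1)h\le C_c$. Let $\varphi:L^2(\mathbb{S}^2)\to\mathbb{R}$ be a Fréchet differentiable test function such that for some fixed $\rho\ge0$ there is a constant $K<\infty$ (independent of $\kappa$, $h$ and $k$) with $$\Big\|\int_0^1\varphi'\big(yX^{(\kappa,h)}(t_k)+(1-y)X^{(\kappa)}(t_k)\big)\,\mathrm{d}y\Big\|_{L^2(\Omega,H^\rho(\mathbb{S}^2))}\le K\quad\text{for all grid points }t_k.$$ Let $\mu\in(0,1]$. Assume that one of the following holds: (a) $L\in L^2(\Omega,H^\eta(\mathbb{S}^2))$ for some $\eta\in(-1,\infty)$ with expansion $L(t)=\sum_{\ell,m}L_{\ell,m}(t)Y_{\ell,m}$ converging in $L^2(\Omega,H^\eta(\mathbb{S}^2))$, i.e. $\sum_{\ell=0}^\infty\sum_{m=-\ell}^\ell(1+\ell(\ell+1))^\eta(v_{\ell,m}+\widetilde m_{\ell,m}^2)<\infty$; in this case set $\beta=\eta+1$; (b) for some $\alpha>0$, $L_{\ell,m}=a_\ell\hat L_{\ell,m}$ for all $\ell,m$, where $a_0\ge0$, $|a_\ell|\le C'\ell^{-\alpha/2}$ for all $\ell\in\mathbb{N}$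 and some constant $C'$, and $(\hat L_{\ell,m})_{\ell\in\mathbb{N}_0,m\in\{-\ell,\dots,\ell\}}$ is a sequence of identically distributed real-valued Lévy processes with mean $\mathbb{E}[\hat L_{\ell,m}(t)]=t\hat m$ and variance $\mathbb{E}[(\hat L_{\ell,m}(t)-\mathbb{E}[\hat L_{\ell,m}(t)])^2]=t\hat v$; in this case let $\beta<\alpha/2$ be arbitrary. Then there is a finite constant $C$, independent of $\kappa$, $h$ and $k$, such that for all $k\in\{1,\dots,n\}$ $$\big|\mathbb{E}[\varphi(X^{(\kappa)}(t_k))-\varphi(X^{(\kappa,h)}(t_k))]\big|\le Ch^\mu t_k^{\min\{1,(\gamma+\rho)/2\}-\mu}\|X^0\|_{L^2(\Omega,H^{\min\{2-\rho,\gamma\}}(\mathbb{S}^2))}+Ch^{\min\{(\beta+\rho)/2,1\}}.$$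
   Context: $\mathbb{S}^2$ is the unit sphere in $\mathbb{R}^3$ with surface measure, $\Delta_{\mathbb{S}^2}$ its Laplace--Beltrami operator, and $(Y_{\ell,m})_{\ell\in\mathbb{N}_0,\,m\in\{-\ell,\dots,\ell\}}$ the real-valued spherical harmonics, an orthonormal basis of $L^2(\mathbb{S}^2)$ with $\Delta_{\mathbb{S}^2}Y_{\ell,m}=-\ell(\ell+1)Y_{\ell,m}$. For $\eta\in\mathbb{R}$, $H^\eta(\mathbb{S}^2)=(\mathrm{Id}-\Delta_{\mathbb{S}^2})^{-\eta/2}L^2(\mathbb{S}^2)$ (distributions for $\eta<0$), with norm $\|f\|_{H^\eta(\mathbb{S}^2)}^2=\sum_{\ell,m}(1+\ell(\ell+1))^\eta f_{\ell,m}^2$ for $f=\sum_{\ell,m}f_{\ell,m}Y_{\ell,m}$; $H^0=L^2$. $\|Z\|_{L^p(\Omega,H^\eta(\mathbb{S}^2))}=\mathbb{E}[\|Z\|_{H^\eta(\mathbb{S}^2)}^p]^{1/p}$. The derivative $\varphi'(f)$ is identified with an element of $L^2(\mathbb{S}^2)$ via the Riesz isomorphism. $(\Omega,\mathcal{F},(\mathcal{F}_t)_{t\in[0,T]},\mathbb{P})$ is a complete filtered probability space, $T<\infty$. $L$ is a square-integrable Lévy process (stationary independent increments, stochastically continuous, $L(0)=0$, càdlàg) with values in $H^\eta(\mathbb{S}^2)$ for some $\eta\in(-1,\infty)$, expanded as $L(t)=\sum_{\ell,m}L_{\ell,m}(t)Y_{\ell,m}$ with real-valued càdlàg Lévy processes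 $L_{\ell,m}$ (in general not assumed independent). Set $\widetilde m_{\ell,m}=\mathbb{E}[L_{\ell,m}(1)]$ and $v_{\ell,m}=\mathbb{E}[(L_{\ell,m}(1)-\mathbb{E}[L_{\ell,m}(1)])^2]$. The initial value $X^0\in L^2(\Omega,L^2(\mathbb{S}^2))$ is $\mathcal{F}_0$-measurable and independent of $L$, and $X^0_{\ell,m}=\langle X^0,Y_{\ell,m}\rangle_{L^2(\mathbb{S}^2)}$. The equation is $\mathrm{d}X(t)=\Delta_{\mathbb{S}^2}X(t)\,\mathrm{d}t+\mathrm{d}L(t)$, $X(0)=X^0$. Spectral approximation: $X^{(\kappa)}(t)=\sum_{\ell=0}^\kappa\sum_{m=-\ell}^\ell\big(e^{-\ell(\ell+1)t}X^0_{\ell,m}+\int_0^te^{-\ell(\ell+1)(t-s)}\,\mathrm{d}L_{\ell,m}(s)\big)Y_{\ell,m}$. Euler--Maruyama schemes: for $n\in\mathbb{N}$, $h=T/n$, $t_k=kh$, $k\in\{0,\dots,n\}$, let $\Delta L_{\ell,m}(t_k)=L_{\ell,m}(t_k)-L_{\ell,m}(t_{k-1})$ and $$X^{(\kappa,h)}(t_k)=\sum_{\ell=0}^\kappa\sum_{m=-\ell}^\ell\Big(\xi_\ell(h)^kX^0_{\ell,m}+\sum_{j=1}^k\xi_\ell(h)^{k-j+\delta}\Delta L_{\ell,m}(t_j)\Big)Y_{\ell,m},$$ where $\xi_\ell(h)=1-\ell(\ell+1)h$, $\delta=0$ for the forward scheme and $\xi_\ell(h)=(1+\ell(\ell+1)h)^{-1}$,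 $\delta=1$ for the backward scheme. Standing coupling: $\ell(\ell+1)h\le C_c$ for all $\ell\le\kappa$, with $C_c\le1$ for the forward scheme and $C_c$ a fixed finite constant for the backward scheme. *)

theory Defs
  imports "HOL-Probability.Probability" "HOL-Computational_Algebra.Polynomial"
begin

section \<open>The unit sphere and its surface measure\<close>

definition sph_coord :: "real \<times> real \<Rightarrow> real^3" where
  "sph_coord = (\<lambda>(\<theta>, \<phi>). vector [sin \<theta> * cos \<phi>, sin \<theta> * sin \<phi>, cos \<theta>])"

text \<open>
  Image of the area element \<open>sin \<theta> d\<theta> d\<phi>\<close> on \<open>[0, \<pi>] \<times> [0, 2\<pi>)\<close>; total mass \<open>4\<pi>\<close>.
\<close>

definition sphere_measure :: "(real^3) measure" where
  "sphere_measure =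
     distr (density lborel (\<lambda>x. ennreal (sin (fst x)) * indicator ({0..pi} \<times> {0..<2*pi}) x))
       (restrict_space borel (sphere 0 1)) sph_coord"

lemma sph_coord_in_sphere: "sph_coord x \<in> sphere 0 1"
proof -
  obtain \<theta> \<phi> where x: "x = (\<theta>, \<phi>)" by (cases x)
  have "(sin \<theta> * cos \<phi>)\<^sup>2 + (sin \<theta> * sin \<phi>)\<^sup>2 + (cos \<theta>)\<^sup>2 = (sin \<theta>)\<^sup>2 * ((sin \<phi>)\<^sup>2 + (cos \<phi>)\<^sup>2) + (cos \<theta>)\<^sup>2"
    unfolding power_mult_distrib by (simp only: algebra_simps)
  also have "\<dots> = 1" by simp
  finally show ?thesis
    by (simp add: x sph_coord_def norm_vec_def L2_set_def sum_3 vector_3)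
qed

lemma measurable_sph_coord: "sph_coord \<in> borel \<rightarrow>\<^sub>M restrict_space borel (sphere 0 1)"
proof (rule measurable_restrict_space2)
  have "continuous_on UNIV sph_coord"
    unfolding sph_coord_def case_prod_beta
  proof (subst continuous_on_componentwise, rule ballI)
    fix i :: "real^3" assume "i \<in> Basis"
    then obtain j where i: "i = axis j 1" by (auto simp: Basis_vec_def)
    show "continuous_on UNIV (\<lambda>x::real\<times>real. vector [sin (fst x) * cos (snd x), sin (fst x) * sin (snd x), cos (fst x)] \<bullet> i)"
      using exhaust_3[of j]
      unfolding i inner_axis
      by (elim disjE; simp only: vector_3 real_inner_1_right; intro continuous_intros)
  qed
  then show "sph_coord \<in> borel \<rightarrow>\<^sub>M borel" by (rule borel_measurable_continuous_onI)
qed (use sph_coord_in_sphere in auto)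

lemma space_sphere_measure [simp]: "space sphere_measure = sphere 0 1"
  by (simp add: sphere_measure_def space_restrict_space)

lemma sets_sphere_measure [measurable_cong]:
  "sets sphere_measure = sets (restrict_space borel (sphere 0 1))"
  by (simp add: sphere_measure_def)

lemma finite_measure_sphere_measure: "finite_measure sphere_measure"
proof
  let ?D = "{0..pi} \<times> {0..<2*pi} :: (real \<times> real) set"
  have [measurable]: "sph_coord \<in> borel \<rightarrow>\<^sub>M restrict_space borel (sphere 0 1)"
    by (rule measurable_sph_coord)
  have [measurable]: "?D \<in> sets borel" by (rule borel_Times) auto
  have [measurable]: "(\<lambda>x. ennreal (sin (fst x)) * indicator ?D x) \<in> borel_measurable borel"
    by (intro borel_measurable_times_ennreal borel_measurable_indicator
          measurable_compose[OF _ measurable_ennreal] borel_measurable_continuous_onI)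
       (auto intro!: continuous_intros)
  have "emeasure sphere_measure (space sphere_measure) =
      (\<integral>\<^sup>+x. ennreal (sin (fst x)) * indicator ?D x \<partial>lborel)"
  proof -
    have "sph_coord -` sphere 0 1 = UNIV" using sph_coord_in_sphere by blast
    then show ?thesis
      unfolding space_sphere_measure unfolding sphere_measure_def
      apply (subst emeasure_distr)
        apply simp
       apply (auto simp: sets_restrict_space)[1]
      apply (simp add: space_restrict_space emeasure_density)
      done
  qed
  also have "\<dots> \<le> (\<integral>\<^sup>+x. indicator (cbox (0,0) (pi,2*pi)) x \<partial>lborel)"
  proof (rule nn_integral_mono)
    fix x :: "real \<times> real"
    have "ennreal (sin (fst x)) \<le> 1" by (simp add: ennreal_le_1)
    moreover have "?D \<subseteq> cbox (0,0) (pi,2*pi)" by (auto simp: cbox_Pair_eq)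
    ultimately show "ennreal (sin (fst x)) * indicator ?D x \<le> indicator (cbox (0,0) (pi,2*pi)) x"
      by (auto split: split_indicator)
  qed
  also have "\<dots> < \<infinity>"
    using emeasure_lborel_cbox_finite[of "(0, 0)" "(pi, 2 * pi) :: real \<times> real"]
    by (simp del: cbox_Pair_eq)
  finally show "emeasure sphere_measure (space sphere_measure) \<noteq> \<infinity>" by simp
qed

section \<open>The space of square integrable functions on the sphere\<close>

definition sq_int :: "(real^3 \<Rightarrow> real) \<Rightarrow> bool" where
  "sq_int f \<longleftrightarrow> f \<in> borel_measurable sphere_measure \<and> integrable sphere_measure (\<lambda>x. (f x)\<^sup>2)"

definition l2_eq :: "(real^3 \<Rightarrow> real) \<Rightarrow> (real^3 \<Rightarrow> real) \<Rightarrow> bool" where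
  "l2_eq f g \<longleftrightarrow> sq_int f \<and> sq_int g \<and> (AE x in sphere_measure. f x = g x)"

lemma sq_int_measurable: "sq_int f \<Longrightarrow> f \<in> borel_measurable sphere_measure"
  by (simp add: sq_int_def)

lemma sq_int_zero: "sq_int (\<lambda>_. 0)"
  by (simp add: sq_int_def)

lemma sq_int_mult: 
  assumes "sq_int f" "sq_int g"
  shows "integrable sphere_measure (\<lambda>x. f x * g x)"
proof (rule Bochner_Integration.integrable_bound)
  show "integrable sphere_measure (\<lambda>x. (f x)\<^sup>2 + (g x)\<^sup>2)"
    using assms by (simp add: sq_int_def)
  show "(\<lambda>x. f x * g x) \<in> borel_measurable sphere_measure"
    using assms[THEN sq_int_measurable] by simp
  show "AE x in sphere_measure. norm (f x * g x) \<le> norm ((f x)\<^sup>2 + (g x)\<^sup>2)"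
  proof (rule AE_I2)
    fix x
    have "2 * (\<bar>f x\<bar> * \<bar>g x\<bar>) \<le> (f x)\<^sup>2 + (g x)\<^sup>2"
      using sum_squares_bound[of "\<bar>f x\<bar>" "\<bar>g x\<bar>"] by simp
    moreover have "0 \<le> \<bar>f x\<bar> * \<bar>g x\<bar>" by simp
    ultimately have "\<bar>f x\<bar> * \<bar>g x\<bar> \<le> (f x)\<^sup>2 + (g x)\<^sup>2" by linarith
    then show "norm (f x * g x) \<le> norm ((f x)\<^sup>2 + (g x)\<^sup>2)"
      by (simp add: abs_mult)
  qed
qed

lemma sq_int_add: "sq_int f \<Longrightarrow> sq_int g \<Longrightarrow> sq_int (\<lambda>x. f x + g x)"
  using sq_int_mult[of f g] by (simp add: sq_int_def power2_sum mult.assoc borel_measurable_add)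

lemma sq_int_scale: "sq_int f \<Longrightarrow> sq_int (\<lambda>x. c * f x)"
  by (simp add: sq_int_def power_mult_distrib borel_measurable_times)

quotient_type l2_sphere = "real^3 \<Rightarrow> real" / partial: l2_eq
proof (rule part_equivpI)
  show "\<exists>x. l2_eq x x" using sq_int_zero by (auto simp: l2_eq_def)
  show "symp l2_eq" by (auto simp: symp_def l2_eq_def)
  show "transp l2_eq" unfolding transp_def l2_eq_def by auto
qed

instantiation l2_sphere :: real_inner
begin

lift_definition zero_l2_sphere :: l2_sphere is "\<lambda>_. 0"
  using sq_int_zero by (simp add: l2_eq_def)

lift_definition plus_l2_sphere :: "l2_sphere \<Rightarrow> l2_sphere \<Rightarrow> l2_sphere" is "\<lambda>f g x. f x + g x"
  by (auto simp: l2_eq_def sq_int_add)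

lift_definition scaleR_l2_sphere :: "real \<Rightarrow> l2_sphere \<Rightarrow> l2_sphere" is "\<lambda>c f x. c * f x"
  by (auto simp: l2_eq_def sq_int_scale)

lift_definition uminus_l2_sphere :: "l2_sphere \<Rightarrow> l2_sphere" is "\<lambda>f x. - f x"
  using sq_int_scale[of _ "-1"] by (auto simp: l2_eq_def)

definition minus_l2_sphere :: "l2_sphere \<Rightarrow> l2_sphere \<Rightarrow> l2_sphere" where
  "minus_l2_sphere f g = f + - g"

lift_definition inner_l2_sphere :: "l2_sphere \<Rightarrow> l2_sphere \<Rightarrow> real" is
  "\<lambda>f g. \<integral>x. f x * g x \<partial>sphere_measure"
  by (auto simp: l2_eq_def sq_int_measurable borel_measurable_times intro!: integral_cong_AE)

definition norm_l2_sphere :: "l2_sphere \<Rightarrow> real" where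
  "norm_l2_sphere f = sqrt (f \<bullet> f)"

definition dist_l2_sphere :: "l2_sphere \<Rightarrow> l2_sphere \<Rightarrow> real" where
  "dist_l2_sphere f g = norm (f - g)"

definition sgn_l2_sphere :: "l2_sphere \<Rightarrow> l2_sphere" where
  "sgn_l2_sphere f = inverse (norm f) *\<^sub>R f"

definition uniformity_l2_sphere :: "(l2_sphere \<times> l2_sphere) filter" where
  "uniformity_l2_sphere = (INF e\<in>{0<..}. principal {(f, g). dist f g < e})"

definition open_l2_sphere :: "l2_sphere set \<Rightarrow> bool" where
  "open_l2_sphere U \<longleftrightarrow> (\<forall>f\<in>U. \<forall>\<^sub>F (f', g) in uniformity. f' = f \<longrightarrow> g \<in> U)"

instance
proof
  fix f g k :: l2_sphere and a b :: real
  show "f + g + k = f + (g + k)"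
    by transfer (auto simp: l2_eq_def sq_int_add add.assoc)
  show "f + g = g + f"
    by transfer (auto simp: l2_eq_def sq_int_add add.commute)
  show "0 + f = f"
    by transfer (auto simp: l2_eq_def)
  show "- f + f = 0"
    by transfer (auto simp: l2_eq_def sq_int_zero)
  show "f - g = f + - g" by (simp add: minus_l2_sphere_def)
  show "a *\<^sub>R (f + g) = a *\<^sub>R f + a *\<^sub>R g"
    by transfer (auto simp: l2_eq_def sq_int_add sq_int_scale distrib_left)
  show "(a + b) *\<^sub>R f = a *\<^sub>R f + b *\<^sub>R f"
    by transfer (auto simp: l2_eq_def sq_int_add sq_int_scale distrib_right)
  show "a *\<^sub>R b *\<^sub>R f = (a * b) *\<^sub>R f"
    by transfer (auto simp: l2_eq_def sq_int_scale mult.assoc)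
  show "1 *\<^sub>R f = f"
    by transfer (auto simp: l2_eq_def)
  show "dist f g = norm (f - g)" by (simp add: dist_l2_sphere_def)
  show "sgn f = inverse (norm f) *\<^sub>R f" by (simp add: sgn_l2_sphere_def)
  show "f \<bullet> g = g \<bullet> f"
    by transfer (simp add: mult.commute)
  show "(f + g) \<bullet> k = f \<bullet> k + g \<bullet> k"
    by transfer (simp add: l2_eq_def distrib_right sq_int_mult)
  show "a *\<^sub>R f \<bullet> g = a * (f \<bullet> g)"
    by transfer (simp add: mult.assoc)
  show "0 \<le> f \<bullet> f" by transfer simp
  show "f \<bullet> f = 0 \<longleftrightarrow> f = 0"
  proof transfer
    fix f assume "l2_eq f f"
    then have f: "sq_int f" by (simp add: l2_eq_def)
    have "(\<integral>x. f x * f x \<partial>sphere_measure) = 0 \<longleftrightarrow> (AE x in sphere_measure. f x * f x = 0)"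
      by (rule integral_nonneg_eq_0_iff_AE) (auto simp: sq_int_mult f)
    then show "(\<integral>x. f x * f x \<partial>sphere_measure) = 0 \<longleftrightarrow> l2_eq f (\<lambda>_. 0)"
      using f sq_int_zero by (simp add: l2_eq_def)
  qed
  show "norm f = sqrt (f \<bullet> f)" by (simp add: norm_l2_sphere_def)
qed (simp_all only: uniformity_l2_sphere_def open_l2_sphere_def)

end

section \<open>Real spherical harmonics and Sobolev norms\<close>

definition legendre_deriv :: "nat \<Rightarrow> nat \<Rightarrow> real poly" where
  "legendre_deriv l k = smult (1 / (2 ^ l * fact l)) ((pderiv ^^ (l + k)) ([:-1, 0, 1:] ^ l))"

text \<open>
  By Rodrigues' formula, \<open>legendre_deriv l k\<close> is the \<open>k\<close>-th derivative of the Legendre polynomial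
  \<open>P\<^sub>l\<close>. In the point with colatitude \<open>\<theta>\<close> and longitude \<open>\<phi>\<close> one has
  \<open>x $ 3 = cos \<theta>\<close> and \<open>(x $ 1 + \<i> x $ 2) ^ k = sin \<theta> ^ k * (cos (k \<phi>) + \<i> sin (k \<phi>))\<close>, so that the product
  below is the associated Legendre function times \<open>cos (k \<phi>)\<close> or \<open>sin (k \<phi>)\<close>
  (without the sign \<open>(-1) ^ k\<close>). It vanishes for \<open>l < \<bar>m\<bar>\<close>.
\<close>

definition sph_harm :: "nat \<Rightarrow> int \<Rightarrow> real^3 \<Rightarrow> real" where
  "sph_harm l m x =
     (let k = nat \<bar>m\<bar>; w = Complex (x $ 1) (x $ 2) ^ k in
      sqrt ((2 * real l + 1) / (4 * pi) * (fact (l - k) / fact (l + k))) *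
      poly (legendre_deriv l k) (x $ 3) *
      (if m = 0 then 1 else if m > 0 then sqrt 2 * Re w else sqrt 2 * Im w))"

lemma continuous_sph_harm: "continuous_on UNIV (sph_harm l m)"
proof -
  define k where "k = nat \<bar>m\<bar>"
  have w: "continuous_on UNIV (\<lambda>x::real^3. Complex (x $ 1) (x $ 2) ^ k)"
    unfolding complex_eq by (intro continuous_intros)
  have "continuous_on UNIV (\<lambda>x::real^3. if m = 0 then 1 else if m > 0
      then sqrt 2 * Re (Complex (x $ 1) (x $ 2) ^ k) else sqrt 2 * Im (Complex (x $ 1) (x $ 2) ^ k))"
  proof (cases "m = 0")
    case False
    then show ?thesis using w
      by (cases "m > 0") (simp_all add: continuous_on_Re continuous_on_Im continuous_on_mult_left)
  qed simp
  then show ?thesis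
    unfolding sph_harm_def Let_def k_def
    by (rule continuous_on_mult[rotated]) (intro continuous_intros)
qed

lemma sq_int_sph_harm: "sq_int (sph_harm l m)"
proof -
  interpret finite_measure sphere_measure by (rule finite_measure_sphere_measure)
  have 1: "sph_harm l m \<in> borel_measurable sphere_measure"
    unfolding measurable_cong_sets[OF sets_sphere_measure refl]
    by (intro measurable_restrict_space1 borel_measurable_continuous_onI continuous_sph_harm)
  have "compact (sph_harm l m ` sphere 0 1)"
    by (intro compact_continuous_image continuous_on_subset[OF continuous_sph_harm]) auto
  then obtain B where B: "\<And>x. x \<in> sphere 0 1 \<Longrightarrow> norm (sph_harm l m x) \<le> B"
    by (meson bounded_iff compact_imp_bounded imageI)
  have "integrable sphere_measure (\<lambda>x. (sph_harm l m x)\<^sup>2)"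
  proof (rule integrable_const_bound)
    show "AE x in sphere_measure. norm ((sph_harm l m x)\<^sup>2) \<le> B\<^sup>2"
      using power_mono[OF B, of _ 2] by (intro AE_I2) (simp add: power_mono)
  qed (use 1 in simp)
  with 1 show ?thesis by (simp add: sq_int_def)
qed

lift_definition Ylm :: "nat \<Rightarrow> int \<Rightarrow> l2_sphere" is sph_harm
  using sq_int_sph_harm by (simp add: l2_eq_def)

definition sph_coeff :: "l2_sphere \<Rightarrow> nat \<Rightarrow> int \<Rightarrow> real" where
  "sph_coeff f l m = f \<bullet> Ylm l m"

definition sph_eig :: "nat \<Rightarrow> real" where
  "sph_eig l = real l * (real l + 1)"

text \<open>
  Since \<open>H\<^sup>\<eta>\<close> contains distributions that are not functions when \<open>\<eta> < 0\<close>, its elements are represented by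
  their families of coefficients with respect to the spherical harmonics, indexed by
  \<open>l\<close> and \<open>\<bar>m\<bar> \<le> l\<close> and extended by \<open>0\<close>. An element \<open>f\<close> of \<open>L\<^sup>2\<close> corresponds to \<open>sph_coeff f\<close>.
\<close>

definition ennsqrt :: "ennreal \<Rightarrow> ennreal" where
  "ennsqrt x = (if x = \<infinity> then \<infinity> else ennreal (sqrt (enn2real x)))"

definition H_norm :: "real \<Rightarrow> (nat \<Rightarrow> int \<Rightarrow> real) \<Rightarrow> ennreal" where
  "H_norm \<eta> c =
     ennsqrt (\<Sum>l. ennreal (\<Sum>m\<in>{- int l..int l}. (1 + sph_eig l) powr \<eta> * (c l m)\<^sup>2))"

definition H_space :: "real \<Rightarrow> (nat \<Rightarrow> int \<Rightarrow> real) set" where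
  "H_space \<eta> = {c. (\<forall>l m. int l < \<bar>m\<bar> \<longrightarrow> c l m = 0) \<and> H_norm \<eta> c < \<infinity>}"

definition L2_H_norm :: "'w measure \<Rightarrow> real \<Rightarrow> ('w \<Rightarrow> nat \<Rightarrow> int \<Rightarrow> real) \<Rightarrow> ennreal" where
  "L2_H_norm M \<eta> Z = ennsqrt (\<integral>\<^sup>+\<omega>. (H_norm \<eta> (Z \<omega>))\<^sup>2 \<partial>M)"

section \<open>Filtered probability spaces and Levy processes\<close>

definition complete_filtered_prob_space :: "'w measure \<Rightarrow> (real \<Rightarrow> 'w measure) \<Rightarrow> real \<Rightarrow> bool" where
  "complete_filtered_prob_space M F T \<longleftrightarrow>
     prob_space M \<and> complete_measure M \<and>
     (\<forall>t\<in>{0..T}. subalgebra M (F t)) \<and>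
     (\<forall>s\<in>{0..T}. \<forall>t\<in>{0..T}. s \<le> t \<longrightarrow> subalgebra (F t) (F s)) \<and>
     null_sets M \<subseteq> sets (F 0)"

text \<open>
  \<open>prob_space.indep_var\<close> needs both random variables to have the same type of values.
\<close>

definition indep_rv ::
  "'w measure \<Rightarrow> 'a measure \<Rightarrow> ('w \<Rightarrow> 'a) \<Rightarrow> 'b measure \<Rightarrow> ('w \<Rightarrow> 'b) \<Rightarrow> bool" where
  "indep_rv M N X N' X' \<longleftrightarrow>
     prob_space.indep_set M (sets (vimage_algebra (space M) X N)) (sets (vimage_algebra (space M) X' N'))"

text \<open>
  A Levy process with values in a normed space that is given by a carrier \<open>H\<close> and a norm \<open>N\<close>. It is
  used for real processes and for \<open>H_space \<eta>\<close>. In the latter case \<open>borel\<close> is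
  the product sigma-algebra on the coefficient families, whose trace on \<open>H_space \<eta>\<close> is the Borel
  sigma-algebra of the norm \<open>H_norm \<eta>\<close> because \<open>H\<^sup>\<eta>\<close> is separable.
\<close>

definition levy_process ::
  "'w measure \<Rightarrow> 'b set \<Rightarrow> ('b \<Rightarrow> ennreal) \<Rightarrow> (real \<Rightarrow> 'w \<Rightarrow> 'b::{topological_space, minus}) \<Rightarrow> bool" where
  "levy_process M H N L \<longleftrightarrow>
     (\<forall>t\<ge>0. L t \<in> M \<rightarrow>\<^sub>M borel) \<and>
     (\<forall>t\<ge>0. \<forall>\<omega>\<in>space M. L t \<omega> \<in> H) \<and>
     (AE \<omega> in M. N (L 0 \<omega>) = 0) \<and>
     (\<forall>n s. 0 \<le> s 0 \<and> (\<forall>i<n. s i \<le> s (Suc i)) \<longrightarrow>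
        prob_space.indep_vars M (\<lambda>_. borel) (\<lambda>i \<omega>. L (s (Suc i)) \<omega> - L (s i) \<omega>) {..<n::nat}) \<and>
     (\<forall>s\<ge>0. \<forall>t\<ge>0. distr M borel (\<lambda>\<omega>. L (s + t) \<omega> - L s \<omega>) = distr M borel (L t)) \<and>
     (\<forall>t\<ge>0. \<forall>\<epsilon>>0.
        ((\<lambda>s. measure M {\<omega> \<in> space M. N (L s \<omega> - L t \<omega>) > ennreal \<epsilon>}) \<longlongrightarrow> 0) (at t within {0..})) \<and>
     (AE \<omega> in M.
        (\<forall>t\<ge>0. ((\<lambda>s. N (L s \<omega> - L t \<omega>)) \<longlongrightarrow> 0) (at_right t)) \<and>
        (\<forall>t>0. \<exists>l\<in>H. ((\<lambda>s. N (L s \<omega> - l)) \<longlongrightarrow> 0) (at_left t)))"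

abbreviation real_levy_process :: "'w measure \<Rightarrow> (real \<Rightarrow> 'w \<Rightarrow> real) \<Rightarrow> bool" where
  "real_levy_process M L \<equiv> levy_process M UNIV (\<lambda>x. ennreal \<bar>x\<bar>) L"

definition sq_int_H_levy_process ::
  "'w measure \<Rightarrow> real \<Rightarrow> (real \<Rightarrow> 'w \<Rightarrow> nat \<Rightarrow> int \<Rightarrow> real) \<Rightarrow> bool" where
  "sq_int_H_levy_process M \<eta> L \<longleftrightarrow>
     levy_process M (H_space \<eta>) (H_norm \<eta>) L \<and> (\<forall>t\<ge>0. L2_H_norm M \<eta> (L t) < \<infinity>)"

definition noise_mean :: "'w measure \<Rightarrow> (real \<Rightarrow> 'w \<Rightarrow> nat \<Rightarrow> int \<Rightarrow> real) \<Rightarrow> nat \<Rightarrow> int \<Rightarrow> real" where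
  "noise_mean M L l m = (\<integral>\<omega>. L 1 \<omega> l m \<partial>M)"

definition noise_var :: "'w measure \<Rightarrow> (real \<Rightarrow> 'w \<Rightarrow> nat \<Rightarrow> int \<Rightarrow> real) \<Rightarrow> nat \<Rightarrow> int \<Rightarrow> real" where
  "noise_var M L l m = (\<integral>\<omega>. (L 1 \<omega> l m - noise_mean M L l m)\<^sup>2 \<partial>M)"

definition noise_expansion_converges ::
  "'w measure \<Rightarrow> (real \<Rightarrow> 'w \<Rightarrow> nat \<Rightarrow> int \<Rightarrow> real) \<Rightarrow> real \<Rightarrow> bool" where
  "noise_expansion_converges M L \<eta> \<longleftrightarrow>
     summable (\<lambda>l. \<Sum>m\<in>{- int l..int l}.
       (1 + sph_eig l) powr \<eta> * (noise_var M L l m + (noise_mean M L l m)\<^sup>2))"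

definition noise_scaled_identical ::
  "'w measure \<Rightarrow> (real \<Rightarrow> 'w \<Rightarrow> nat \<Rightarrow> int \<Rightarrow> real) \<Rightarrow> real \<Rightarrow> bool" where
  "noise_scaled_identical M L \<alpha> \<longleftrightarrow>
     (\<exists>a C' (Lh :: nat \<Rightarrow> int \<Rightarrow> real \<Rightarrow> 'w \<Rightarrow> real) mh vh.
        a 0 \<ge> 0 \<and> (\<forall>l\<ge>1. \<bar>a l\<bar> \<le> C' * real l powr (- \<alpha> / 2)) \<and>
        (\<forall>l. \<forall>m\<in>{- int l..int l}.
           (AE \<omega> in M. \<forall>t\<ge>0. L t \<omega> l m = a l * Lh l m t \<omega>) \<and>
           real_levy_process M (Lh l m) \<and>
           distr M (Pi\<^sub>M {0..} (\<lambda>_. borel)) (\<lambda>\<omega>. \<lambda>t\<in>{0..}. Lh l m t \<omega>) =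
             distr M (Pi\<^sub>M {0..} (\<lambda>_. borel)) (\<lambda>\<omega>. \<lambda>t\<in>{0..}. Lh 0 0 t \<omega>) \<and>
           (\<forall>t\<ge>0. integrable M (\<lambda>\<omega>. (Lh l m t \<omega>)\<^sup>2) \<and>
              (\<integral>\<omega>. Lh l m t \<omega> \<partial>M) = t * mh \<and>
              (\<integral>\<omega>. (Lh l m t \<omega> - (\<integral>\<omega>'. Lh l m t \<omega>' \<partial>M))\<^sup>2 \<partial>M) = t * vh)))"

section \<open>Stochastic integrals of deterministic functions\<close>

text \<open>
  A step function is given by finitely many triples \<open>(c, a, b)\<close>, each contributing \<open>c\<close> on \<open>(a, b]\<close>.
  The integral of \<open>f\<close> over \<open>[0, t]\<close> with respect to a square integrable process \<open>X\<close> with stationary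
  independent increments is the extension by continuity, from \<open>L\<^sup>2(0, t)\<close> to \<open>L\<^sup>2(\<Omega>)\<close>, of the elementary
  integral of step functions. It is determined up to almost sure equality, hence formulated as a
  relation.
\<close>

definition step_fun :: "(real \<times> real \<times> real) list \<Rightarrow> real \<Rightarrow> real" where
  "step_fun p s = (\<Sum>(c, a, b)\<leftarrow>p. c * indicator {a<..b} s)"

definition step_integral :: "(real \<Rightarrow> 'w \<Rightarrow> real) \<Rightarrow> (real \<times> real \<times> real) list \<Rightarrow> 'w \<Rightarrow> real" where
  "step_integral X p \<omega> = (\<Sum>(c, a, b)\<leftarrow>p. c * (X b \<omega> - X a \<omega>))"

definition has_stoch_integral ::
  "'w measure \<Rightarrow> (real \<Rightarrow> 'w \<Rightarrow> real) \<Rightarrow> (real \<Rightarrow> real) \<Rightarrow> real \<Rightarrow> ('w \<Rightarrow> real) \<Rightarrow> bool" where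
  "has_stoch_integral M X f t Z \<longleftrightarrow>
     Z \<in> borel_measurable M \<and>
     (\<exists>p. (\<forall>n. \<forall>(c, a, b)\<in>set (p n). 0 \<le> a \<and> a \<le> b \<and> b \<le> t) \<and>
       (\<lambda>n. \<integral>\<^sup>+s\<in>{0..t}. ennreal ((step_fun (p n) s - f s)\<^sup>2) \<partial>lborel) \<longlonglongrightarrow> 0 \<and>
       (\<lambda>n. \<integral>\<^sup>+\<omega>. ennreal ((step_integral X (p n) \<omega> - Z \<omega>)\<^sup>2) \<partial>M) \<longlonglongrightarrow> 0)"

section \<open>Spectral and Euler--Maruyama approximations\<close>

text \<open>
  \<open>I l m t\<close> stands for the stochastic convolution, i.e. the integral of \<open>exp (- sph_eig l * (t - s))\<close>
  over \<open>[0, t]\<close> with respect to the \<open>(l, m)\<close> coefficient of the noise.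
\<close>

definition stoch_convolution ::
  "'w measure \<Rightarrow> (real \<Rightarrow> 'w \<Rightarrow> nat \<Rightarrow> int \<Rightarrow> real) \<Rightarrow> real \<Rightarrow>
   (nat \<Rightarrow> int \<Rightarrow> real \<Rightarrow> 'w \<Rightarrow> real) \<Rightarrow> bool" where
  "stoch_convolution M L T I \<longleftrightarrow>
     (\<forall>l. \<forall>m\<in>{- int l..int l}. \<forall>t\<in>{0..T}.
        has_stoch_integral M (\<lambda>s \<omega>. L s \<omega> l m) (\<lambda>s. exp (- sph_eig l * (t - s))) t (I l m t))"

definition spectral_approx ::
  "('w \<Rightarrow> l2_sphere) \<Rightarrow> (nat \<Rightarrow> int \<Rightarrow> real \<Rightarrow> 'w \<Rightarrow> real) \<Rightarrow> nat \<Rightarrow> real \<Rightarrow> 'w \<Rightarrow> l2_sphere" where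
  "spectral_approx X0 I \<kappa> t \<omega> =
     (\<Sum>l\<le>\<kappa>. \<Sum>m\<in>{- int l..int l}.
        (exp (- sph_eig l * t) * sph_coeff (X0 \<omega>) l m + I l m t \<omega>) *\<^sub>R Ylm l m)"

datatype em_scheme = Forward | Backward

fun em_xi :: "em_scheme \<Rightarrow> real \<Rightarrow> nat \<Rightarrow> real" where
  "em_xi Forward h l = 1 - sph_eig l * h"
| "em_xi Backward h l = inverse (1 + sph_eig l * h)"

fun em_delta :: "em_scheme \<Rightarrow> nat" where
  "em_delta Forward = 0"
| "em_delta Backward = 1"

definition em_approx ::
  "em_scheme \<Rightarrow> ('w \<Rightarrow> l2_sphere) \<Rightarrow> (real \<Rightarrow> 'w \<Rightarrow> nat \<Rightarrow> int \<Rightarrow> real) \<Rightarrow>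
   nat \<Rightarrow> real \<Rightarrow> nat \<Rightarrow> 'w \<Rightarrow> l2_sphere" where
  "em_approx sch X0 L \<kappa> h k \<omega> =
     (\<Sum>l\<le>\<kappa>. \<Sum>m\<in>{- int l..int l}.
        (em_xi sch h l ^ k * sph_coeff (X0 \<omega>) l m +
         (\<Sum>j=1..k. em_xi sch h l ^ (k - j + em_delta sch) *
            (L (real j * h) \<omega> l m - L (real (j - 1) * h) \<omega> l m))) *\<^sub>R Ylm l m)"

end

theory Submission
  imports Defs
begin

text \<open>
Write \<open>X\<close> for the spectral approximation, \<open>Y\<close> for its Euler--Maruyama counterpart, both at a grid point
\<open>t = k h\<close>, and \<open>G\<close> for the integral of \<open>\<phi>' (y Y + (1 - y) X)\<close> over \<open>y \<in> [0, 1]\<close>. The fundamental theorem of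
calculus along the segment from \<open>X\<close> to \<open>Y\<close> gives \<open>\<phi> X - \<phi> Y = \<langle>G, X - Y\<rangle>\<close>
(\<open>fundamental_theorem_line\<close>), and the duality between \<open>H\<^sup>\<rho>\<close> and its dual turns the weak error into
\<open>K\<close> times the strong error of \<open>X - Y\<close> in the Sobolev norm of order \<open>- \<rho>\<close> (\<open>weak_error_le\<close>). This is
where the weak rate exceeds the strong one: the regularity of the derivative pays for a weaker norm.
Since \<open>X - Y\<close> is a finite combination of spherical harmonics, the pairing is a finite sum of products
of coefficients, and the duality is the Cauchy--Schwarz inequality for sums.

In the mode \<open>(l, m)\<close> with eigenvalue \<open>\<lambda> = sph_eig l\<close> and \<open>x = \<lambda> h \<le> Cc\<close> the error is the sum of an initial
and a noise term. The elementary fact behind both is that one Euler step replaces \<open>exp (- x)\<close> by a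
number \<open>\<xi>\<close> with \<open>\<bar>exp (- x) - \<xi>\<bar> \<le> x\<^sup>2\<close> that still decays, \<open>0 \<le> \<xi> \<le> exp (- c x)\<close>, with \<open>c\<close> depending only on
the coupling constant (\<open>em_xi_bounds\<close>). Hence \<open>\<bar>exp (- k x) - \<xi> ^ k\<bar>\<close> is at most a constant times
\<open>x \<cdot> (k x) \<cdot> exp (- c k x)\<close>.

For the initial value, \<open>x\<close> is bounded by a multiple of \<open>x powr \<mu>\<close> and the factor \<open>k x = \<lambda> t\<close> is traded
against the exponential for any power between \<open>- 1\<close> and \<open>1\<close>, which yields
\<open>h powr \<mu> * t powr (s - \<mu>) * \<lambda> powr s\<close> with \<open>s = min 1 ((\<gamma> + \<rho>) / 2)\<close> (\<open>initial_error_bound\<close>); the factor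
\<open>\<lambda> powr s\<close> raises the order of the norm from \<open>- \<rho>\<close> to \<open>2 s - \<rho> = min (2 - \<rho>) \<gamma>\<close>.

For the noise, both terms are integrals of deterministic functions against the same Levy process
\<open>L\<^sub>l\<^sub>m\<close>. Additivity of mean and variance in time gives \<open>E [L\<^sub>l\<^sub>m s \<cdot> L\<^sub>l\<^sub>m t] = v min s t + m\<^sup>2 s t\<close>
(\<open>linear_moments_of_increments\<close>), and hence an Ito inequality: the mean square of an integral is at
most \<open>v + m\<^sup>2 t\<close> times the squared \<open>L\<^sup>2\<close> norm of the integrand. The integrands differ by at most a
multiple of \<open>x exp (- c \<lambda> (t - s) / 2)\<close>, whose squared norm is of order \<open>\<lambda> h\<^sup>2\<close> (\<open>em_kernel_error\<close>).
Summing over the modes with the weights \<open>(1 + \<lambda>) powr (- \<rho>)\<close> and exchanging surplus powers of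
\<open>1 + \<lambda>\<close> for powers of \<open>1 / h\<close> gives the rate \<open>min ((\<beta> + \<rho>) / 2) 1\<close> (\<open>frequency_step_coupling\<close>),
as soon as the noise is summable with weights \<open>(1 + \<lambda>) powr (\<beta> - 1)\<close>. That is hypothesis (a), and it
follows from hypothesis (b) by comparison with \<open>\<Sum> l powr (2 \<beta> - 1 - \<alpha>)\<close>
(\<open>noise_expansion_of_scaled_identical\<close>).
\<close>

section \<open>Sobolev norms of coefficient families\<close>

lemma sph_eig_nonneg [simp]: "0 \<le> sph_eig l"
  by (simp add: sph_eig_def)

lemma ennsqrt_power2 [simp]: "(ennsqrt x)\<^sup>2 = x"
proof (cases x)
  case (real r)
  then show ?thesis by (simp add: ennsqrt_def ennreal_power)
qed (simp add: ennsqrt_def power2_eq_square ennreal_top_mult)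

lemma ennsqrt_mono: "x \<le> y \<Longrightarrow> ennsqrt x \<le> ennsqrt y"
  by (cases x; cases y) (auto simp: ennsqrt_def top_unique intro!: ennreal_leI)

lemma measurable_ennsqrt [measurable]: "ennsqrt \<in> borel_measurable borel"
  unfolding ennsqrt_def by measurable

lemma H_norm_power2:
  "(H_norm \<eta> c)\<^sup>2 = (\<Sum>l. ennreal (\<Sum>m\<in>{- int l..int l}. (1 + sph_eig l) powr \<eta> * (c l m)\<^sup>2))"
  by (simp add: H_norm_def)

lemma L2_H_norm_power2: "(L2_H_norm M \<eta> Z)\<^sup>2 = (\<integral>\<^sup>+\<omega>. (H_norm \<eta> (Z \<omega>))\<^sup>2 \<partial>M)"
  by (simp add: L2_H_norm_def)

lemma H_norm_partial_sum_le:
  "ennreal (\<Sum>l\<le>\<kappa>. \<Sum>m\<in>{- int l..int l}. (1 + sph_eig l) powr \<eta> * (c l m)\<^sup>2) \<le> (H_norm \<eta> c)\<^sup>2"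
proof -
  have "ennreal (\<Sum>l\<le>\<kappa>. \<Sum>m\<in>{- int l..int l}. (1 + sph_eig l) powr \<eta> * (c l m)\<^sup>2) =
      (\<Sum>l\<le>\<kappa>. ennreal (\<Sum>m\<in>{- int l..int l}. (1 + sph_eig l) powr \<eta> * (c l m)\<^sup>2))"
    by (intro sum_ennreal[symmetric] sum_nonneg) auto
  also have "\<dots> \<le> (H_norm \<eta> c)\<^sup>2"
    unfolding H_norm_power2 by (intro sum_le_suminf) auto
  finally show ?thesis .
qed

lemma H_norm_coefficient_le:
  assumes "m \<in> {- int l..int l}"
  shows "ennreal ((1 + sph_eig l) powr \<eta> * (c l m)\<^sup>2) \<le> (H_norm \<eta> c)\<^sup>2"
proof -
  have "(1 + sph_eig l) powr \<eta> * (c l m)\<^sup>2 \<le> (\<Sum>m\<in>{- int l..int l}. (1 + sph_eig l) powr \<eta> * (c l m)\<^sup>2)"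
    using assms by (intro member_le_sum) auto
  also have "\<dots> \<le> (\<Sum>l\<le>l. \<Sum>m\<in>{- int l..int l}. (1 + sph_eig l) powr \<eta> * (c l m)\<^sup>2)"
    by (intro member_le_sum sum_nonneg) auto
  finally show ?thesis
    using H_norm_partial_sum_le[where \<kappa> = l] by (blast intro: order_trans ennreal_leI)
qed

lemma measurable_H_norm [measurable]:
  assumes [measurable]: "\<And>l m. (\<lambda>\<omega>. Z \<omega> l m) \<in> borel_measurable M"
  shows "(\<lambda>\<omega>. H_norm \<eta> (Z \<omega>)) \<in> borel_measurable M"
  unfolding H_norm_def by measurable

lemma ennsqrt_of_power2: "ennsqrt (x\<^sup>2) = x"
proof (cases x)
  case (real r)
  then have "x\<^sup>2 = ennreal (r\<^sup>2)" by (simp add: ennreal_power)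
  then show ?thesis using real by (simp add: ennsqrt_def)
qed (simp add: ennsqrt_def power2_eq_square ennreal_top_mult)

lemma ennreal_power2_le_imp_le: "x\<^sup>2 \<le> y\<^sup>2 \<Longrightarrow> x \<le> (y::ennreal)"
  using ennsqrt_mono[of "x\<^sup>2" "y\<^sup>2"] by (simp add: ennsqrt_of_power2)

lemma L2_H_norm_mono:
  assumes "\<eta> \<le> \<eta>'"
  shows "L2_H_norm M \<eta> Z \<le> L2_H_norm M \<eta>' Z"
proof -
  have "(H_norm \<eta> c)\<^sup>2 \<le> (H_norm \<eta>' c)\<^sup>2" for c
    unfolding H_norm_power2 using assms
    by (intro suminf_le ennreal_leI sum_mono mult_right_mono powr_mono) auto
  then show ?thesis
    unfolding L2_H_norm_def by (intro ennsqrt_mono nn_integral_mono)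
qed

lemma measurable_sph_coeff:
  assumes "g \<in> borel_measurable M"
  shows "(\<lambda>\<omega>. sph_coeff (g \<omega>) l m) \<in> borel_measurable M"
proof -
  have "(\<lambda>f. f \<bullet> Ylm l m) \<in> borel_measurable borel"
    by (intro borel_measurable_continuous_onI continuous_intros)
  from measurable_compose[OF assms this] show ?thesis unfolding sph_coeff_def .
qed

section \<open>One step of the Euler schemes against the exponential\<close>

text \<open>
Telescoping: \<open>a ^ k - r ^ k\<close> is a sum of \<open>k\<close> terms, each with one factor \<open>a - r\<close> and \<open>k - 1\<close> factors
bounded by \<open>q\<close>.
\<close>

lemma power_diff_le:
  fixes a r q :: real
  assumes "0 \<le> a" "a \<le> q" "0 \<le> r" "r \<le> q"
  shows "\<bar>a ^ k - r ^ k\<bar> \<le> real k * \<bar>a - r\<bar> * q ^ (k - 1)"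
proof (induction k)
  case (Suc k)
  have "a ^ Suc k - r ^ Suc k = a * (a ^ k - r ^ k) + (a - r) * r ^ k"
    by (simp add: algebra_simps)
  also have "\<bar>\<dots>\<bar> \<le> a * \<bar>a ^ k - r ^ k\<bar> + \<bar>a - r\<bar> * r ^ k"
    using assms by (intro order_trans[OF abs_triangle_ineq]) (simp add: abs_mult)
  also have "\<dots> \<le> q * (real k * \<bar>a - r\<bar> * q ^ (k - 1)) + \<bar>a - r\<bar> * q ^ k"
    using assms Suc by (intro add_mono mult_mono power_mono mult_nonneg_nonneg) auto
  also have "\<dots> = real (Suc k) * \<bar>a - r\<bar> * q ^ k"
    by (cases k) (simp_all add: algebra_simps)
  finally show ?case by simp
qed simp

lemma exp_minus_quadratic_bounds:
  fixes x :: real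
  assumes "0 \<le> x"
  shows "1 - x \<le> exp (- x)" "exp (- x) \<le> 1 - x + x\<^sup>2"
proof -
  show "1 - x \<le> exp (- x)" using exp_ge_add_one_self[of "- x"] by simp
  show "exp (- x) \<le> 1 - x + x\<^sup>2"
  proof (cases "x \<le> 1")
    case True
    have "1 = (1 + x) * (1 - x + x\<^sup>2) - x^3" by (simp add: algebra_simps power2_eq_square power3_eq_cube)
    also have "\<dots> \<le> (1 + x) * (1 - x + x\<^sup>2)" using assms by simp
    also have "\<dots> \<le> exp x * (1 - x + x\<^sup>2)"
      using assms True exp_ge_add_one_self[of x] by (intro mult_right_mono) auto
    finally show ?thesis by (simp add: exp_minus field_simps)
  next
    case False
    then have "1 \<le> 1 - x + x\<^sup>2" by (simp add: power2_eq_square)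
    with assms show ?thesis by (smt (verit) exp_le_one_iff)
  qed
qed

text \<open>
Both schemes replace \<open>exp (- x)\<close> by its first order approximation from either side, \<open>1 - x\<close> or
\<open>1 / (1 + x)\<close>. The backward value decays more slowly than \<open>exp (- x)\<close>; on \<open>x \<le> Cc\<close> the inequality
\<open>ln (1 + x) \<ge> x / (1 + x) \<ge> c x\<close> still gives exponential decay at a rate \<open>c\<close> that is uniform in the
frequency and the step size. For the forward scheme \<open>Cc \<le> 1\<close> is what keeps \<open>\<xi>\<close> nonnegative.
\<close>

lemma em_xi_bounds:
  assumes c: "c = inverse (1 + \<bar>Cc\<bar>)" and cc: "sch = Forward \<longrightarrow> Cc \<le> 1"
    and x: "x = sph_eig l * h" "0 \<le> x" "x \<le> Cc"
  shows "0 \<le> em_xi sch h l" "em_xi sch h l \<le> exp (- c * x)"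
    "\<bar>exp (- x) - em_xi sch h l\<bar> \<le> x\<^sup>2" "0 \<le> 1 - em_xi sch h l" "1 - em_xi sch h l \<le> x"
proof -
  have c1: "0 < c" "c \<le> 1" by (auto simp: c field_simps)
  have ex: "exp (-x) \<le> exp (- c * x)"
    using mult_right_mono[of c 1 x] c1 x by simp
  note e = exp_minus_quadratic_bounds[OF \<open>0 \<le> x\<close>]
  show "0 \<le> em_xi sch h l" using x cc by (cases sch) auto
  show "0 \<le> 1 - em_xi sch h l"
    using x by (cases sch) (auto simp: field_simps)
  show "1 - em_xi sch h l \<le> x"
  proof (cases sch)
    case Backward
    have "1 \<le> (1 + x) * inverse (1 + x) + x * x * inverse (1 + x)"
      using x by (simp add: right_inverse)
    then show ?thesis using x Backward by (simp add: field_simps)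
  qed (use x in simp)
  show "em_xi sch h l \<le> exp (- c * x)"
  proof (cases sch)
    case Forward
    have "1 - x \<le> exp (- c * x)" using e ex by linarith
    then show ?thesis using Forward x by simp
  next
    case Backward
    have "c * x \<le> x / (1 + x)"
      unfolding c divide_inverse using x
      by (subst mult.commute) (intro mult_left_mono le_imp_inverse_le; simp)
    also have "\<dots> = 1 - inverse (1 + x)" using x by (simp add: field_simps)
    also have "\<dots> \<le> ln (1 + x)"
      using ln_le_minus_one[of "inverse (1 + x)"] x by (simp add: ln_inverse)
    finally have "exp (c * x) \<le> 1 + x"
      using x by (metis add_nonneg_pos exp_le_cancel_iff exp_ln add.commute zero_less_one)
    then show ?thesis using Backward x by (simp add: exp_minus le_imp_inverse_le)
  qed
  show "\<bar>exp (- x) - em_xi sch h l\<bar> \<le> x\<^sup>2"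
  proof (cases sch)
    case Forward then show ?thesis using e x by (auto simp: abs_le_iff)
  next
    case Backward
    have "inverse (1 + x) = 1 - x + x\<^sup>2 * inverse (1 + x)"
      using x by (simp add: field_simps power2_eq_square)
    moreover have "x\<^sup>2 * inverse (1 + x) \<le> x\<^sup>2 * 1"
      using x by (intro mult_left_mono) (auto simp: field_simps)
    moreover have "0 \<le> x\<^sup>2 * inverse (1 + x)" using x by simp
    ultimately have "\<bar>exp (- x) - inverse (1 + x)\<bar> \<le> x\<^sup>2" using e by linarith
    then show ?thesis using x Backward by simp
  qed
qed

text \<open>
The \<open>k\<close> local errors of size \<open>x\<^sup>2\<close> are damped by the \<open>k - 1\<close> remaining steps. The right-hand side is
arranged as \<open>x\<close> times a function of \<open>k x\<close>, because \<open>x\<close> supplies the power of the step size and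
\<open>k x\<close> is the eigenvalue times the elapsed time. Replacing \<open>k - 1\<close> by \<open>k\<close> in the exponent costs \<open>exp x\<close>.
\<close>

lemma exp_power_diff_le:
  fixes r x c :: real
  assumes c: "0 < c" "c \<le> 1" and x: "0 \<le> x"
    and r: "0 \<le> r" "r \<le> exp (- c * x)" "\<bar>exp (- x) - r\<bar> \<le> x\<^sup>2"
  shows "\<bar>exp (- (real k * x)) - r ^ k\<bar> \<le> exp x * x * (real k * x * exp (- c * (real k * x)))"
proof (cases k)
  case (Suc i)
  have ex: "exp (-x) \<le> exp (- c * x)"
    using mult_right_mono[of c 1 x] c x by simp
  have "\<bar>exp (- x) ^ k - r ^ k\<bar> \<le> real k * \<bar>exp (- x) - r\<bar> * exp (- c * x) ^ (k - 1)"
    using r ex by (intro power_diff_le) auto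
  also have "\<dots> \<le> real k * x\<^sup>2 * exp (- c * x) ^ (k - 1)"
    using r by (intro mult_right_mono mult_left_mono) auto
  also have "exp (- c * x) ^ (k - 1) = exp (c * x) * exp (- c * (real k * x))"
    by (simp add: Suc exp_of_nat_mult[symmetric] exp_add[symmetric] algebra_simps)
  also have "real k * x\<^sup>2 * \<dots> \<le> real k * x\<^sup>2 * (exp x * exp (- c * (real k * x)))"
    using mult_right_mono[of c 1 x] c x by (intro mult_left_mono mult_right_mono) auto
  finally show ?thesis
    by (simp add: exp_of_nat_mult[symmetric] power2_eq_square mult_ac)
qed simp

lemma powr_times_exp_le:
  fixes c u p :: real
  assumes "0 < c" "0 < u" "0 \<le> p" "p \<le> 2"
  shows "u powr p * exp (- c * u) \<le> 1 + 2 / c\<^sup>2"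
proof -
  have "u powr p \<le> 1 + u\<^sup>2"
  proof (cases "u \<le> 1")
    case True
    then have "u powr p \<le> 1" using assms by (simp add: powr_le1)
    then show ?thesis by (simp add: add_increasing2)
  next
    case False
    then have "u powr p \<le> u powr 2" using assms by (intro powr_mono) auto
    also have "\<dots> = u\<^sup>2" using assms by simp
    finally show ?thesis by simp
  qed
  moreover have "c\<^sup>2 * u\<^sup>2 / 2 \<le> exp (c * u)"
    using exp_lower_Taylor_quadratic[of "c * u"] mult_pos_pos[OF assms(1,2)]
    by (simp only: power_mult_distrib) linarith
  then have "u\<^sup>2 \<le> 2 / c\<^sup>2 * exp (c * u)" using assms by (simp add: field_simps)
  moreover have "1 \<le> exp (c * u)" using assms by simp
  ultimately have "u powr p \<le> (1 + 2 / c\<^sup>2) * exp (c * u)"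
    unfolding distrib_right by linarith
  then show ?thesis using assms by (simp add: exp_minus field_simps)
qed

text \<open>
Two exchanges in the bound \<open>x u exp (- c u)\<close> with \<open>u = k x = sph_eig l * t\<close>: boundedness of \<open>x\<close> allows
\<open>x\<close> to be replaced by \<open>x powr \<mu>\<close>, and the exponential absorbs \<open>u powr (1 - s + \<mu>)\<close>, an exponent in
\<open>[0, 2]\<close>, leaving \<open>u powr (s - \<mu>)\<close>. The powers \<open>\<mu>\<close> and \<open>s - \<mu>\<close> of the eigenvalue add up to \<open>s\<close>.
\<close>

lemma initial_error_bound:
  fixes s \<mu> Cc :: real
  assumes s: "0 \<le> s" "s \<le> 1" and mu: "0 < \<mu>" "\<mu> \<le> 1" and cc: "sch = Forward \<longrightarrow> Cc \<le> 1"
  shows "\<exists>C\<ge>0. \<forall>l (k::nat) h t. 0 < h \<longrightarrow> sph_eig l * h \<le> Cc \<longrightarrow> 1 \<le> k \<longrightarrow> t = real k * h \<longrightarrow>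
    \<bar>exp (- sph_eig l * t) - em_xi sch h l ^ k\<bar> \<le> C * (h powr \<mu> * t powr (s - \<mu>) * (1 + sph_eig l) powr s)"
proof -
  define c where "c = inverse (1 + \<bar>Cc\<bar>)"
  have c1: "0 < c" "c \<le> 1" by (auto simp: c_def field_simps)
  define B where "B = max 1 Cc"
  define C where "C = exp B * B * (1 + 2 / c\<^sup>2)"
  have B: "1 \<le> B" "Cc \<le> B" by (auto simp: B_def)
  have C: "0 \<le> C" using B by (simp add: C_def)
  have "\<bar>exp (- sph_eig l * t) - em_xi sch h l ^ k\<bar> \<le> C * (h powr \<mu> * t powr (s - \<mu>) * (1 + sph_eig l) powr s)"
    if h: "0 < h" "sph_eig l * h \<le> Cc" and k: "1 \<le> k" "t = real k * h" for l h t and k :: nat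
  proof (cases "sph_eig l = 0")
    case True
    then have "em_xi sch h l = 1" by (cases sch) auto
    then show ?thesis using True C by simp
  next
    case False
    then have lam: "0 < sph_eig l" using sph_eig_nonneg[of l] by linarith
    define x where "x = sph_eig l * h"
    define u where "u = real k * x"
    have x: "0 < x" "x \<le> Cc" using lam h by (auto simp: x_def)
    have u: "0 < u" "u = sph_eig l * t" using x k by (auto simp: u_def x_def)
    note xi = em_xi_bounds[OF c_def cc x_def less_imp_le[OF x(1)] x(2)]
    have "\<bar>exp (- (real k * x)) - em_xi sch h l ^ k\<bar> \<le> exp x * x * (u * exp (- c * u))"
      using exp_power_diff_le[OF c1 less_imp_le[OF x(1)] xi(1-3), of k] by (simp add: u_def)
    also have "u * exp (- c * u) = u powr (s - \<mu>) * (u powr (1 - s + \<mu>) * exp (- c * u))"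
      using u by (simp add: powr_add[symmetric] mult.assoc[symmetric])
    also have "exp x * x = exp x * (x powr \<mu> * x powr (1 - \<mu>))"
      using x by (simp add: powr_add[symmetric])
    also have "exp x * (x powr \<mu> * x powr (1 - \<mu>)) *
        (u powr (s - \<mu>) * (u powr (1 - s + \<mu>) * exp (- c * u)))
      \<le> exp B * (x powr \<mu> * B) * (u powr (s - \<mu>) * (1 + 2 / c\<^sup>2))"
    proof (intro mult_mono)
      have "x powr (1 - \<mu>) \<le> B powr (1 - \<mu>)" using x mu B by (intro powr_mono2) auto
      also have "\<dots> \<le> B powr 1" using mu B by (intro powr_mono) auto
      finally show "x powr (1 - \<mu>) \<le> B" using B by simp
      show "u powr (1 - s + \<mu>) * exp (- c * u) \<le> 1 + 2 / c\<^sup>2"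
        using u c1 s mu by (intro powr_times_exp_le) auto
    qed (use x B u in auto)
    also have "\<dots> = C * (h powr \<mu> * t powr (s - \<mu>) * sph_eig l powr s)"
    proof -
      have "x powr \<mu> * u powr (s - \<mu>) = h powr \<mu> * t powr (s - \<mu>) * (sph_eig l powr \<mu> * sph_eig l powr (s - \<mu>))"
        using lam h k by (simp add: x_def u powr_mult)
      also have "sph_eig l powr \<mu> * sph_eig l powr (s - \<mu>) = sph_eig l powr s"
        using lam by (simp add: powr_add[symmetric])
      finally show ?thesis by (simp add: C_def mult_ac)
    qed
    also have "\<dots> \<le> C * (h powr \<mu> * t powr (s - \<mu>) * (1 + sph_eig l) powr s)"
      using C s lam by (intro mult_left_mono powr_mono2) auto
    finally show ?thesis using u by (simp add: u_def)
  qed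
  then show ?thesis using C by blast
qed

text \<open>
On the scale where one step has length \<open>x\<close>, the exact kernel \<open>exp (- \<tau>)\<close> at a distance \<open>\<tau>\<close> from the
final time is compared with the power of \<open>r\<close> that the scheme uses on the whole step containing it. Three
errors of size \<open>x\<close> occur: moving \<open>\<tau>\<close> to the grid point \<open>i x\<close>, replacing the exponential by the power,
and the additional factor \<open>r\<close> of the backward scheme. Half of the decay rate is given up to absorb the
factor \<open>i x\<close> of the second one.
\<close>

lemma noise_kernel_bound:
  fixes c x \<tau> r :: real
  assumes c: "0 < c" "c \<le> 1" and x: "0 \<le> x" "x \<le> B"
    and r: "0 \<le> r" "r \<le> exp (- c * x)" "\<bar>exp (- x) - r\<bar> \<le> x\<^sup>2" "0 \<le> 1 - r" "1 - r \<le> x"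
    and \<tau>: "real i * x \<le> \<tau>" "\<tau> \<le> real (Suc i) * x" and \<delta>: "\<delta> \<le> 1"
  shows "\<bar>exp (- \<tau>) - r ^ (i + \<delta>)\<bar> \<le> (2 + 2 * exp B / c) * x * exp (- (c / 2) * (real i * x))"
proof -
  define u where "u = real i * x"
  have u: "0 \<le> u" using x by (simp add: u_def)
  have eu: "exp (- u) \<le> exp (- (c / 2) * u)" "exp (- c * u) \<le> exp (- (c / 2) * u)"
    using mult_right_mono[of "c/2" 1 u] c u by auto
  have 1: "\<bar>exp (- \<tau>) - exp (- u)\<bar> \<le> x * exp (- u)"
  proof -
    have "exp (- \<tau>) \<le> exp (- u)" "exp (- u) * exp (- x) \<le> exp (- \<tau>)"
      using \<tau> by (auto simp: u_def exp_add[symmetric] algebra_simps)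
    moreover have "exp (- u) * (1 - x) \<le> exp (- u) * exp (- x)"
      using exp_minus_quadratic_bounds[OF x(1)] by (intro mult_left_mono) auto
    ultimately show ?thesis by (simp add: algebra_simps)
  qed
  have 2: "\<bar>exp (- u) - r ^ i\<bar> \<le> exp B * x * (2 / c * exp (- (c / 2) * u))"
  proof -
    have "\<bar>exp (- u) - r ^ i\<bar> \<le> exp x * x * (u * exp (- c * u))"
      using exp_power_diff_le[OF c x(1) r(1-3), of i] by (simp add: u_def)
    also have "u * exp (- c * u) \<le> 2 / c * exp (- (c / 2) * u)"
    proof -
      have "c / 2 * u \<le> exp (c / 2 * u)" using exp_ge_add_one_self[of "c / 2 * u"] by linarith
      then have "c / 2 * u * exp (- c * u) \<le> exp (c / 2 * u) * exp (- c * u)"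
        by (intro mult_right_mono) auto
      also have "\<dots> = exp (- (c / 2) * u)" by (simp add: exp_add[symmetric] algebra_simps)
      finally show ?thesis using c by (simp add: field_simps)
    qed
    also have "exp x * x * (2 / c * exp (- (c / 2) * u)) \<le> exp B * x * (2 / c * exp (- (c / 2) * u))"
      using x c by (intro mult_right_mono) auto
    finally show ?thesis using x by (simp add: mult_left_mono)
  qed
  have 3: "\<bar>r ^ i - r ^ (i + \<delta>)\<bar> \<le> x * exp (- c * u)"
  proof -
    have "r ^ i \<le> exp (- c * x) ^ i" using r by (intro power_mono) auto
    also have "\<dots> = exp (- c * u)" by (simp add: u_def exp_of_nat_mult[symmetric] algebra_simps)
    finally have ri: "r ^ i \<le> exp (- c * u)" .
    from \<delta> consider "\<delta> = 0" | "\<delta> = 1" by linarith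
    then show ?thesis
    proof cases
      case 2
      have "\<bar>r ^ i - r ^ (i + \<delta>)\<bar> = (1 - r) * r ^ i"
        using r 2 by (subst abs_of_nonneg) (auto simp: algebra_simps mult_left_le_one_le)
      also have "\<dots> \<le> x * exp (- c * u)" using r ri x by (intro mult_mono) auto
      finally show ?thesis .
    qed (use x in simp)
  qed
  have "\<bar>exp (- \<tau>) - r ^ (i + \<delta>)\<bar> \<le> x * exp (- u) + exp B * x * (2 / c * exp (- (c / 2) * u)) + x * exp (- c * u)"
    using 1 2 3 by linarith
  also have "\<dots> \<le> x * exp (- (c / 2) * u) + exp B * x * (2 / c * exp (- (c / 2) * u)) + x * exp (- (c / 2) * u)"
    using eu x c by (intro add_mono mult_left_mono) auto
  also have "\<dots> = (2 + 2 * exp B / c) * x * exp (- (c / 2) * u)"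
    by (simp add: field_simps)
  finally show ?thesis by (simp add: u_def)
qed

text \<open>
This is a Riemann sum of \<open>exp (- c \<cdot>)\<close> on \<open>[0, \<infinity>)\<close>. It bounds a sum over time steps by a constant
that depends neither on the number of steps nor on the frequency.
\<close>

lemma geometric_exp_sum_le:
  fixes c x :: real
  assumes "0 < c" "0 \<le> x" "c * x \<le> B"
  shows "x * (\<Sum>i<k. exp (- c * (real i * x))) \<le> (1 + B) / c"
proof (cases "x = 0")
  case False
  with assms have x: "0 < c * x" by simp
  have "(\<Sum>i<k. exp (- c * (real i * x))) = (\<Sum>i<k. exp (- (c * x)) ^ i)"
    by (simp add: exp_of_nat_mult[symmetric] algebra_simps)
  also have "\<dots> = (1 - exp (- (c * x)) ^ k) / (1 - exp (- (c * x)))"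
    using x by (subst sum_gp_strict) auto
  also have "\<dots> \<le> 1 / (1 - exp (- (c * x)))"
    using x by (intro divide_right_mono) auto
  also have "\<dots> \<le> (1 + c * x) / (c * x)"
  proof -
    have "(1 + c * x) * exp (- (c * x)) \<le> 1"
      using exp_ge_add_one_self[of "c * x"] by (simp add: exp_minus field_simps)
    then show ?thesis using x by (simp add: field_simps)
  qed
  finally have "x * (\<Sum>i<k. exp (- c * (real i * x))) \<le> x * ((1 + c * x) / (c * x))"
    using assms by (intro mult_left_mono) auto
  also have "\<dots> = (1 + c * x) / c" using False assms by (simp add: divide_simps)
  also have "\<dots> \<le> (1 + B) / c" using assms by (intro divide_right_mono) auto
  finally show ?thesis .
qed (use assms in simp)

section \<open>Second moments of a Levy coefficient\<close>

text \<open>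
Cauchy's functional equation. The difference \<open>g t = f t - t * f 1\<close> is additive and vanishes on the natural
numbers, so it has period 1; being bounded on \<open>[0, 1]\<close> it is bounded everywhere, and then
\<open>n * g t = g (n * t)\<close> forces \<open>g t = 0\<close>.
\<close>

lemma additive_bounded_imp_linear:
  fixes f :: "real \<Rightarrow> real"
  assumes add: "\<And>s t. 0 \<le> s \<Longrightarrow> 0 \<le> t \<Longrightarrow> f (s + t) = f s + f t"
    and \<delta>: "0 < \<delta>" and bdd: "\<And>t. 0 \<le> t \<Longrightarrow> t \<le> \<delta> \<Longrightarrow> \<bar>f t\<bar> \<le> B" and t: "0 \<le> t"
  shows "f t = t * f 1"
proof -
  define g where "g = (\<lambda>t. f t - t * f 1)"
  have g_add: "g (s + t) = g s + g t" if "0 \<le> s" "0 \<le> t" for s t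
    using add[OF that] by (simp add: g_def algebra_simps)
  have g0: "g 0 = 0" using g_add[of 0 0] by simp
  have g_mult: "g (real n * t) = real n * g t" if "0 \<le> t" for n t
  proof (induction n)
    case (Suc n)
    have "g (real (Suc n) * t) = g (t + real n * t)" by (simp add: algebra_simps)
    also have "\<dots> = g t + g (real n * t)" using that by (intro g_add) auto
    finally show ?case using Suc by (simp add: algebra_simps)
  qed (simp add: g0)
  have "g 1 = 0" by (simp add: g_def)
  then have g_nat: "g (real n) = 0" for n using g_mult[of 1 n] by simp
  \<comment> \<open>A bound near 0 gives a bound on \<open>[0, 1]\<close>, as \<open>N\<close> steps of length at most \<open>\<delta>\<close> cover it.\<close>
  obtain N :: nat where N: "1 / \<delta> < real N" using reals_Archimedean2 by blast
  then have Npos: "0 < N" using \<delta> by (metis divide_pos_pos gr0I less_asym of_nat_0 zero_less_one)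
  define B' where "B' = real N * (B + \<delta> * \<bar>f 1\<bar>)"
  have g_bdd1: "\<bar>g s\<bar> \<le> B'" if s: "0 \<le> s" "s \<le> 1" for s
  proof -
    define r where "r = s / real N"
    have r: "0 \<le> r" "r \<le> \<delta>"
    proof -
      have "s \<le> \<delta> * real N" using N \<delta> s by (simp add: field_simps)
      then show "r \<le> \<delta>" using Npos by (simp add: r_def field_simps)
    qed (use s in \<open>simp add: r_def\<close>)
    have "\<bar>g r\<bar> \<le> \<bar>f r\<bar> + r * \<bar>f 1\<bar>"
      unfolding g_def using abs_triangle_ineq4[of "f r" "r * f 1"] r by (simp add: abs_mult)
    also have "\<dots> \<le> B + \<delta> * \<bar>f 1\<bar>" using r bdd by (intro add_mono mult_right_mono) auto
    finally have "real N * \<bar>g r\<bar> \<le> B'" unfolding B'_def by (intro mult_left_mono) auto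
    moreover have "g s = real N * g r" using g_mult[OF r(1), of N] Npos by (simp add: r_def)
    ultimately show ?thesis by (simp add: abs_mult)
  qed
  have g_bdd: "\<bar>g s\<bar> \<le> B'" if s: "0 \<le> s" for s
  proof -
    have "s = real (nat \<lfloor>s\<rfloor>) + frac s" using s by (simp add: frac_def)
    then have "g s = g (frac s)"
      using g_add[of "real (nat \<lfloor>s\<rfloor>)" "frac s"] g_nat by simp
    then show ?thesis using g_bdd1[of "frac s"] by (simp add: less_imp_le frac_lt_1)
  qed
  have "g t = 0"
  proof (rule ccontr)
    assume "g t \<noteq> 0"
    then obtain n :: nat where n: "B' / \<bar>g t\<bar> < real n" using reals_Archimedean2 by blast
    then have "B' < real n * \<bar>g t\<bar>" using \<open>g t \<noteq> 0\<close> by (simp add: field_simps)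
    also have "\<dots> = \<bar>g (real n * t)\<bar>" using g_mult[OF t] by (simp add: abs_mult)
    also have "\<dots> \<le> B'" using t by (intro g_bdd) auto
    finally show False by simp
  qed
  then show ?thesis by (simp add: g_def)
qed

text \<open>
What the error analysis uses of a Levy process with variance \<open>v\<close> and mean \<open>m\<close> per unit time. Covariances
\<open>v * min s t\<close> and means \<open>m * t\<close> are combined in one formula for the second moments, because that formula
is bilinear in the process and so extends to increments and step integrals.
\<close>

locale linear_moments = prob_space M for M :: "'w measure" +
  fixes X :: "real \<Rightarrow> 'w \<Rightarrow> real" and v m :: real
  assumes X_measurable [measurable]: "0 \<le> t \<Longrightarrow> X t \<in> borel_measurable M"
    and X_square_integrable: "0 \<le> t \<Longrightarrow> integrable M (\<lambda>\<omega>. (X t \<omega>)\<^sup>2)"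
    and v_nonneg: "0 \<le> v"
    and X_second_moment: "0 \<le> s \<Longrightarrow> 0 \<le> t \<Longrightarrow> expectation (\<lambda>\<omega>. X s \<omega> * X t \<omega>) = v * min s t + m\<^sup>2 * (s * t)"

lemma integrable_mult_square:
  fixes f g :: "'w \<Rightarrow> real"
  assumes [measurable]: "f \<in> borel_measurable M" "g \<in> borel_measurable M"
    and "integrable M (\<lambda>\<omega>. (f \<omega>)\<^sup>2)" "integrable M (\<lambda>\<omega>. (g \<omega>)\<^sup>2)"
  shows "integrable M (\<lambda>\<omega>. f \<omega> * g \<omega>)"
proof (rule Bochner_Integration.integrable_bound)
  show "integrable M (\<lambda>\<omega>. (f \<omega>)\<^sup>2 + (g \<omega>)\<^sup>2)" using assms by simp
  show "AE \<omega> in M. norm (f \<omega> * g \<omega>) \<le> norm ((f \<omega>)\<^sup>2 + (g \<omega>)\<^sup>2)"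
  proof (rule AE_I2)
    fix \<omega>
    have "2 * (\<bar>f \<omega>\<bar> * \<bar>g \<omega>\<bar>) \<le> (f \<omega>)\<^sup>2 + (g \<omega>)\<^sup>2"
      using sum_squares_bound[of "\<bar>f \<omega>\<bar>" "\<bar>g \<omega>\<bar>"] by simp
    moreover have "0 \<le> \<bar>f \<omega>\<bar> * \<bar>g \<omega>\<bar>" by simp
    ultimately have "\<bar>f \<omega>\<bar> * \<bar>g \<omega>\<bar> \<le> (f \<omega>)\<^sup>2 + (g \<omega>)\<^sup>2" by linarith
    then show "norm (f \<omega> * g \<omega>) \<le> norm ((f \<omega>)\<^sup>2 + (g \<omega>)\<^sup>2)" by (simp add: abs_mult)
  qed
qed simp

text \<open>
Stationarity and uncorrelated increments make the mean and the variance of \<open>X t\<close> additive in \<open>t\<close>. The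
variance is nonnegative, hence monotone, hence linear. The mean has no sign; it is bounded near \<open>0\<close>
because \<open>X t\<close> is close to its mean by Chebyshev's inequality and close to \<open>0\<close> by stochastic continuity, both
with substantial probability.
\<close>

lemma (in prob_space) linear_moments_of_increments:
  fixes X :: "real \<Rightarrow> 'a \<Rightarrow> real"
  assumes meas: "\<And>t. 0 \<le> t \<Longrightarrow> X t \<in> borel_measurable M"
    and sq: "\<And>t. 0 \<le> t \<Longrightarrow> integrable M (\<lambda>\<omega>. (X t \<omega>)\<^sup>2)"
    and zero: "AE \<omega> in M. X 0 \<omega> = 0"
    and uncorrelated: "\<And>s t. 0 \<le> s \<Longrightarrow> s \<le> t \<Longrightarrow>
        expectation (\<lambda>\<omega>. (X s \<omega> - X 0 \<omega>) * (X t \<omega> - X s \<omega>)) =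
        expectation (\<lambda>\<omega>. X s \<omega> - X 0 \<omega>) * expectation (\<lambda>\<omega>. X t \<omega> - X s \<omega>)"
    and stationary: "\<And>s t. 0 \<le> s \<Longrightarrow> 0 \<le> t \<Longrightarrow>
        distr M borel (\<lambda>\<omega>. X (s + t) \<omega> - X s \<omega>) = distr M borel (X t)"
    and stoch_cont: "((\<lambda>s. prob {\<omega> \<in> space M. 1 < \<bar>X s \<omega> - X 0 \<omega>\<bar>}) \<longlongrightarrow> 0) (at 0 within {0..})"
  shows "linear_moments M X (variance (X 1)) (expectation (X 1))"
proof -
  have int: "integrable M (X t)" if "0 \<le> t" for t
    using square_integrable_imp_integrable[OF meas sq] that by simp
  have prod_int: "integrable M (\<lambda>\<omega>. X s \<omega> * X t \<omega>)" if "0 \<le> s" "0 \<le> t" for s t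
    using that by (intro integrable_mult_square meas sq)
  have incr_E: "expectation (\<lambda>\<omega>. X (s + t) \<omega> - X s \<omega>) = expectation (X t)"
    and incr_E2: "expectation (\<lambda>\<omega>. (X (s + t) \<omega> - X s \<omega>)\<^sup>2) = expectation (\<lambda>\<omega>. (X t \<omega>)\<^sup>2)"
    if st: "0 \<le> s" "0 \<le> t" for s t
  proof -
    have [measurable]: "X (s + t) \<in> borel_measurable M" "X s \<in> borel_measurable M" "X t \<in> borel_measurable M"
      using st by (auto intro: meas)
    have "expectation (\<lambda>\<omega>. X (s + t) \<omega> - X s \<omega>) = integral\<^sup>L (distr M borel (\<lambda>\<omega>. X (s + t) \<omega> - X s \<omega>)) (\<lambda>x. x)"
      by (subst integral_distr) auto
    also have "\<dots> = expectation (X t)"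
      unfolding stationary[OF st] by (subst integral_distr) auto
    finally show "expectation (\<lambda>\<omega>. X (s + t) \<omega> - X s \<omega>) = expectation (X t)" .
    have "expectation (\<lambda>\<omega>. (X (s + t) \<omega> - X s \<omega>)\<^sup>2) = integral\<^sup>L (distr M borel (\<lambda>\<omega>. X (s + t) \<omega> - X s \<omega>)) (\<lambda>x. x\<^sup>2)"
      by (subst integral_distr) auto
    also have "\<dots> = expectation (\<lambda>\<omega>. (X t \<omega>)\<^sup>2)"
      unfolding stationary[OF st] by (subst integral_distr) auto
    finally show "expectation (\<lambda>\<omega>. (X (s + t) \<omega> - X s \<omega>)\<^sup>2) = expectation (\<lambda>\<omega>. (X t \<omega>)\<^sup>2)" .
  qed
  have cov: "expectation (\<lambda>\<omega>. X s \<omega> * X (s + t) \<omega>) = expectation (\<lambda>\<omega>. (X s \<omega>)\<^sup>2) + expectation (X s) * expectation (X t)"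
    if st: "0 \<le> s" "0 \<le> t" for s t
  proof -
    have [measurable]: "X (s + t) \<in> borel_measurable M" "X s \<in> borel_measurable M" "X 0 \<in> borel_measurable M"
      using st by (auto intro: meas)
    have "expectation (\<lambda>\<omega>. X s \<omega> * (X (s + t) \<omega> - X s \<omega>)) = expectation (\<lambda>\<omega>. (X s \<omega> - X 0 \<omega>) * (X (s + t) \<omega> - X s \<omega>))"
      using zero by (intro integral_cong_AE) auto
    also have "\<dots> = expectation (\<lambda>\<omega>. X s \<omega> - X 0 \<omega>) * expectation (\<lambda>\<omega>. X (s + t) \<omega> - X s \<omega>)"
      using st by (intro uncorrelated) auto
    also have "expectation (\<lambda>\<omega>. X s \<omega> - X 0 \<omega>) = expectation (X s)"
      using zero by (intro integral_cong_AE) auto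
    finally have "expectation (\<lambda>\<omega>. X s \<omega> * X (s + t) \<omega> - X s \<omega> * X s \<omega>) = expectation (X s) * expectation (X t)"
      by (simp add: incr_E st right_diff_distrib)
    then show ?thesis
      using st prod_int[of s s] prod_int[of s "s + t"] by (simp add: power2_eq_square)
  qed
  have E_add: "expectation (X (s + t)) = expectation (X s) + expectation (X t)" if "0 \<le> s" "0 \<le> t" for s t
    using incr_E[OF that] that by (simp add: int)
  have V_eq: "variance (X t) = expectation (\<lambda>\<omega>. (X t \<omega>)\<^sup>2) - (expectation (X t))\<^sup>2" if "0 \<le> t" for t
    using that by (intro variance_eq int sq)
  have V_add: "variance (X (s + t)) = variance (X s) + variance (X t)" if st: "0 \<le> s" "0 \<le> t" for s t
  proof -
    have "expectation (\<lambda>\<omega>. (X (s + t) \<omega> - X s \<omega>)\<^sup>2) =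
        expectation (\<lambda>\<omega>. (X (s + t) \<omega>)\<^sup>2 - 2 * (X s \<omega> * X (s + t) \<omega>) + (X s \<omega>)\<^sup>2)"
      by (intro Bochner_Integration.integral_cong) (auto simp: power2_diff)
    also have "\<dots> = expectation (\<lambda>\<omega>. (X (s + t) \<omega>)\<^sup>2) - 2 * expectation (\<lambda>\<omega>. X s \<omega> * X (s + t) \<omega>) + expectation (\<lambda>\<omega>. (X s \<omega>)\<^sup>2)"
      using st by (simp add: sq prod_int)
    finally have "expectation (\<lambda>\<omega>. (X (s + t) \<omega>)\<^sup>2) =
        expectation (\<lambda>\<omega>. (X t \<omega>)\<^sup>2) + expectation (\<lambda>\<omega>. (X s \<omega>)\<^sup>2) + 2 * (expectation (X s) * expectation (X t))"
      using incr_E2[OF st] cov[OF st] by simp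
    then show ?thesis
      using V_eq[of "s + t"] V_eq[of s] V_eq[of t] E_add[OF st] st by (simp add: power2_sum)
  qed
  have V_nonneg: "0 \<le> variance (X t)" for t by (rule variance_positive)
  have V: "variance (X t) = t * variance (X 1)" if t: "0 \<le> t" for t
  proof (rule additive_bounded_imp_linear[where \<delta> = 1 and B = "variance (X 1)" and f = "\<lambda>t. variance (X t)"])
    fix t :: real assume "0 \<le> t" "t \<le> 1"
    then have "variance (X 1) = variance (X t) + variance (X (1 - t))" using V_add[of t "1 - t"] by simp
    then show "\<bar>variance (X t)\<bar> \<le> variance (X 1)" using V_nonneg[of t] V_nonneg[of "1 - t"] by simp
  qed (use V_add t in auto)
  have E: "expectation (X t) = t * expectation (X 1)" if t: "0 \<le> t" for t
  proof -
    have "\<forall>\<^sub>F s in at 0 within {0..}. prob {\<omega> \<in> space M. 1 < \<bar>X s \<omega> - X 0 \<omega>\<bar>} < 1 / 2"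
      using order_tendstoD(2)[OF stoch_cont, of "1 / 2"] by simp
    then obtain d where d: "0 < d" "\<And>s. 0 \<le> s \<Longrightarrow> s \<noteq> 0 \<Longrightarrow> s < d \<Longrightarrow> prob {\<omega> \<in> space M. 1 < \<bar>X s \<omega> - X 0 \<omega>\<bar>} < 1 / 2"
      unfolding eventually_at by (auto simp: dist_real_def)
    \<comment> \<open>The bounds 1/2 and 1/4 on the two exceptional events leave a common good point.\<close>
    define \<delta> where "\<delta> = min (d / 2) (1 / (4 * (variance (X 1) + 1)))"
    have \<delta>: "0 < \<delta>" "\<delta> < d" "\<delta> * variance (X 1) \<le> 1 / 4"
    proof -
      have p: "0 < variance (X 1) + 1" using V_nonneg[of 1] by linarith
      then show "0 < \<delta>" "\<delta> < d" using d by (auto simp: \<delta>_def)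
      have "\<delta> * variance (X 1) \<le> 1 / (4 * (variance (X 1) + 1)) * (variance (X 1) + 1)"
        using p V_nonneg[of 1] by (intro mult_mono) (auto simp: \<delta>_def)
      also have "\<dots> = 1 / 4" using p by (simp add: field_simps)
      finally show "\<delta> * variance (X 1) \<le> 1 / 4" .
    qed
    have bdd: "\<bar>expectation (X s)\<bar> \<le> 2" if s: "0 \<le> s" "s \<le> \<delta>" for s
    proof (cases "s = 0")
      case True
      then show ?thesis using E_add[of 0 0] by simp
    next
      case False
      have [measurable]: "X s \<in> borel_measurable M" "X 0 \<in> borel_measurable M" using s by (auto intro: meas)
      define A1 where "A1 = {\<omega> \<in> space M. 1 < \<bar>X s \<omega> - X 0 \<omega>\<bar>}"
      define A2 where "A2 = {\<omega> \<in> space M. 1 \<le> \<bar>X s \<omega> - expectation (X s)\<bar>}"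
      have [measurable]: "A1 \<in> events" "A2 \<in> events" by (auto simp: A1_def A2_def)
      have "prob A2 \<le> variance (X s)"
        unfolding A2_def using Chebyshev_inequality[of "X s" 1] s by (simp add: sq)
      also have "variance (X s) \<le> \<delta> * variance (X 1)"
        unfolding V[OF s(1)] using s V_nonneg[of 1] by (intro mult_right_mono) auto
      also have "\<dots> \<le> 1 / 4" by (rule \<delta>)
      finally have "prob A2 \<le> 1 / 4" .
      moreover have "prob A1 < 1 / 2" unfolding A1_def using d s \<delta> False by auto
      moreover have "prob (A1 \<union> A2) \<le> prob A1 + prob A2" by (intro measure_Un_le) auto
      ultimately have "prob (A1 \<union> A2) < 1" by linarith
      \<comment> \<open>At such a point \<open>X s\<close> is within 1 of both 0 and its mean.\<close>
      have "\<exists>\<omega>\<in>space M. X 0 \<omega> = 0 \<and> \<omega> \<notin> A1 \<union> A2"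
      proof (rule ccontr)
        assume neg: "\<not> ?thesis"
        from zero AE_space have "AE \<omega> in M. \<omega> \<in> A1 \<union> A2"
          by eventually_elim (use neg in blast)
        then have "prob (A1 \<union> A2) = 1" by (subst prob_eq_1) auto
        with \<open>prob (A1 \<union> A2) < 1\<close> show False by simp
      qed
      then show ?thesis by (auto simp: A1_def A2_def)
    qed
    show ?thesis
      using additive_bounded_imp_linear[of "\<lambda>t. expectation (X t)", OF E_add \<delta>(1) bdd t] by simp
  qed
  have cov': "expectation (\<lambda>\<omega>. X s \<omega> * X t \<omega>) = variance (X 1) * s + (expectation (X 1))\<^sup>2 * (s * t)"
    if st: "0 \<le> s" "s \<le> t" for s t
  proof -
    have "expectation (\<lambda>\<omega>. X s \<omega> * X t \<omega>) = expectation (\<lambda>\<omega>. (X s \<omega>)\<^sup>2) + expectation (X s) * expectation (X (t - s))"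
      using cov[of s "t - s"] st by simp
    also have "expectation (\<lambda>\<omega>. (X s \<omega>)\<^sup>2) = variance (X s) + (expectation (X s))\<^sup>2"
      using V_eq st by simp
    also have "variance (X s) = s * variance (X 1)" using st by (intro V)
    also have "expectation (X s) = s * expectation (X 1)" using st by (intro E)
    also have "expectation (X (t - s)) = (t - s) * expectation (X 1)" using st by (intro E) auto
    finally show ?thesis by (simp add: algebra_simps power2_eq_square)
  qed
  show ?thesis
  proof
    fix s t :: real assume st: "0 \<le> s" "0 \<le> t"
    show "expectation (\<lambda>\<omega>. X s \<omega> * X t \<omega>) = variance (X 1) * min s t + (expectation (X 1))\<^sup>2 * (s * t)"
    proof (cases "s \<le> t")
      case True then show ?thesis using cov' st by simp
    next
      case False then show ?thesis using cov'[of t s] st by (simp add: mult.commute)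
    qed
  qed (use meas sq V_nonneg in auto)
qed

lemma measurable_coefficient: "(\<lambda>c :: nat \<Rightarrow> int \<Rightarrow> real. c l m) \<in> borel_measurable borel"
proof -
  have 1: "(\<lambda>c :: nat \<Rightarrow> int \<Rightarrow> real. c l) \<in> borel_measurable borel" by (rule measurable_product_coordinates)
  have 2: "(\<lambda>c :: int \<Rightarrow> real. c m) \<in> borel_measurable borel" by (rule measurable_product_coordinates)
  show ?thesis by (rule measurable_compose[OF 1 2])
qed

text \<open>
The coordinate map carries independence and the distribution of increments over to the coefficient. Stochastic
continuity carries over because \<open>H_norm \<eta>\<close> dominates a fixed multiple of the absolute value of each
coefficient.
\<close>

lemma levy_coefficient_moments:
  fixes L :: "real \<Rightarrow> 'w \<Rightarrow> nat \<Rightarrow> int \<Rightarrow> real"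
  assumes M: "prob_space M" and L: "sq_int_H_levy_process M \<eta> L" and m: "m \<in> {- int l..int l}"
  shows "linear_moments M (\<lambda>t \<omega>. L t \<omega> l m) (noise_var M L l m) (noise_mean M L l m)"
proof -
  interpret prob_space M by (rule M)
  let ?w = "(1 + sph_eig l) powr \<eta>"
  have "0 < 1 + sph_eig l" using sph_eig_nonneg[of l] by linarith
  then have w: "0 < ?w" by simp
  note coord = measurable_coefficient
  have meas: "(\<lambda>\<omega>. L t \<omega> l' m') \<in> borel_measurable M" if "0 \<le> t" for t l' m'
  proof -
    have "L t \<in> borel_measurable M" using L that by (auto simp: sq_int_H_levy_process_def levy_process_def)
    from measurable_compose[OF this coord[of l' m']] show ?thesis .
  qed
  have sq: "integrable M (\<lambda>\<omega>. (L t \<omega> l m)\<^sup>2)" if t: "0 \<le> t" for t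
  proof (rule integrableI_bounded)
    show "(\<lambda>\<omega>. (L t \<omega> l m)\<^sup>2) \<in> borel_measurable M" using meas[OF t] by measurable
    have "(L2_H_norm M \<eta> (L t))\<^sup>2 < \<infinity>"
      using L t by (simp add: sq_int_H_levy_process_def power_less_top_ennreal)
    then have fin: "(\<integral>\<^sup>+\<omega>. (H_norm \<eta> (L t \<omega>))\<^sup>2 \<partial>M) < \<infinity>" by (simp add: L2_H_norm_power2)
    have "ennreal ?w * (\<integral>\<^sup>+\<omega>. ennreal ((L t \<omega> l m)\<^sup>2) \<partial>M) = (\<integral>\<^sup>+\<omega>. ennreal ?w * ennreal ((L t \<omega> l m)\<^sup>2) \<partial>M)"
      using meas[OF t, of l m] by (intro nn_integral_cmult[symmetric]) simp
    also have "\<dots> \<le> (\<integral>\<^sup>+\<omega>. (H_norm \<eta> (L t \<omega>))\<^sup>2 \<partial>M)"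
    proof (rule nn_integral_mono)
      fix \<omega>
      show "ennreal ?w * ennreal ((L t \<omega> l m)\<^sup>2) \<le> (H_norm \<eta> (L t \<omega>))\<^sup>2"
        using H_norm_coefficient_le[OF m, of \<eta> "L t \<omega>"] w by (subst ennreal_mult[symmetric]) auto
    qed
    also have "\<dots> < \<infinity>" by (rule fin)
    finally have "ennreal ?w * (\<integral>\<^sup>+\<omega>. ennreal ((L t \<omega> l m)\<^sup>2) \<partial>M) < \<infinity>" .
    then show "(\<integral>\<^sup>+\<omega>. ennreal (norm ((L t \<omega> l m)\<^sup>2)) \<partial>M) < \<infinity>"
      using w by (auto simp: ennreal_mult_less_top)
  qed
  have zero: "AE \<omega> in M. L 0 \<omega> l m = 0"
  proof -
    have "AE \<omega> in M. H_norm \<eta> (L 0 \<omega>) = 0"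
      using L by (auto simp: sq_int_H_levy_process_def levy_process_def)
    then show ?thesis
    proof eventually_elim
      case (elim \<omega>)
      then have "ennreal (?w * (L 0 \<omega> l m)\<^sup>2) \<le> 0"
        using H_norm_coefficient_le[OF m, of \<eta> "L 0 \<omega>"] by simp
      then have "?w * (L 0 \<omega> l m)\<^sup>2 \<le> 0" by (simp add: ennreal_eq_0_iff)
      then show ?case using w by (simp add: mult_le_0_iff)
    qed
  qed
  have indep: "expectation (\<lambda>\<omega>. (L s \<omega> l m - L 0 \<omega> l m) * (L t \<omega> l m - L s \<omega> l m)) =
      expectation (\<lambda>\<omega>. L s \<omega> l m - L 0 \<omega> l m) * expectation (\<lambda>\<omega>. L t \<omega> l m - L s \<omega> l m)"
    if st: "0 \<le> s" "s \<le> t" for s t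
  proof -
    define \<tau> where "\<tau> = (\<lambda>i::nat. if i = 0 then 0 else if i = 1 then s else t)"
    have "0 \<le> \<tau> 0 \<and> (\<forall>i<2. \<tau> i \<le> \<tau> (Suc i))"
      using st by (auto simp: \<tau>_def)
    moreover have "\<forall>n s. 0 \<le> s 0 \<and> (\<forall>i<n. s i \<le> s (Suc i)) \<longrightarrow>
        indep_vars (\<lambda>_. borel) (\<lambda>i \<omega>. L (s (Suc i)) \<omega> - L (s i) \<omega>) {..<n::nat}"
      using L by (simp add: sq_int_H_levy_process_def levy_process_def)
    ultimately have "indep_vars (\<lambda>_. borel) (\<lambda>i \<omega>. L (\<tau> (Suc i)) \<omega> - L (\<tau> i) \<omega>) {..<2}"
      by blast
    from indep_vars_compose2[OF this, of "\<lambda>_ c. c l m" "\<lambda>_. borel", OF coord]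
    have iv: "indep_vars (\<lambda>_. borel) (\<lambda>i \<omega>. L (\<tau> (Suc i)) \<omega> l m - L (\<tau> i) \<omega> l m) {..<2}"
      by simp
    have "integrable M (\<lambda>\<omega>. L t \<omega> l m)" if "0 \<le> t" for t
      using square_integrable_imp_integrable[OF meas sq] that by simp
    then have int: "integrable M (\<lambda>\<omega>. L (\<tau> (Suc i)) \<omega> l m - L (\<tau> i) \<omega> l m)" if "i < 2" for i
      using st by (auto simp: \<tau>_def)
    have "expectation (\<lambda>\<omega>. \<Prod>i<2. L (\<tau> (Suc i)) \<omega> l m - L (\<tau> i) \<omega> l m) =
        (\<Prod>i<2. expectation (\<lambda>\<omega>. L (\<tau> (Suc i)) \<omega> l m - L (\<tau> i) \<omega> l m))"
      using iv int by (intro indep_vars_lebesgue_integral) auto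
    then show ?thesis
      by (simp add: numeral_2_eq_2 lessThan_Suc \<tau>_def mult.commute)
  qed
  have stat: "distr M borel (\<lambda>\<omega>. L (s + t) \<omega> l m - L s \<omega> l m) = distr M borel (\<lambda>\<omega>. L t \<omega> l m)"
    if st: "0 \<le> s" "0 \<le> t" for s t
  proof -
    have eq: "distr M borel (\<lambda>\<omega>. L (s + t) \<omega> - L s \<omega>) = distr M borel (L t)"
      using L st by (simp add: sq_int_H_levy_process_def levy_process_def)
    have Lm: "L u \<in> borel_measurable M" if "0 \<le> u" for u
      using L that by (simp add: sq_int_H_levy_process_def levy_process_def)
    have dm: "(\<lambda>\<omega>. L (s + t) \<omega> - L s \<omega>) \<in> borel_measurable M"
      using st by (auto intro!: measurable_coordinatewise_then_product borel_measurable_diff meas)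
    have "distr (distr M borel (\<lambda>\<omega>. L (s + t) \<omega> - L s \<omega>)) borel (\<lambda>c. c l m) =
        distr M borel (\<lambda>\<omega>. L (s + t) \<omega> l m - L s \<omega> l m)"
      by (subst distr_distr[OF coord[of l m] dm]) (simp add: comp_def)
    moreover have "distr (distr M borel (L t)) borel (\<lambda>c. c l m) = distr M borel (\<lambda>\<omega>. L t \<omega> l m)"
      using st by (subst distr_distr[OF coord[of l m] Lm]) (simp_all add: comp_def)
    ultimately show ?thesis using eq by simp
  qed
  have cont: "((\<lambda>s. prob {\<omega> \<in> space M. 1 < \<bar>L s \<omega> l m - L 0 \<omega> l m\<bar>}) \<longlongrightarrow> 0) (at 0 within {0..})"
  proof (rule tendsto_sandwich[OF _ _ tendsto_const])
    \<comment> \<open>A coefficient of absolute value above 1 forces a norm larger than \<open>\<epsilon>\<close>.\<close>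
    define \<epsilon> where "\<epsilon> = sqrt ?w"
    have \<epsilon>: "0 < \<epsilon>" "\<epsilon>\<^sup>2 = ?w" using w by (auto simp: \<epsilon>_def)
    show "((\<lambda>s. prob {\<omega> \<in> space M. ennreal \<epsilon> < H_norm \<eta> (L s \<omega> - L 0 \<omega>)}) \<longlongrightarrow> 0) (at 0 within {0..})"
      using L \<epsilon> by (simp add: sq_int_H_levy_process_def levy_process_def)
    show "\<forall>\<^sub>F s in at 0 within {0..}. prob {\<omega> \<in> space M. 1 < \<bar>L s \<omega> l m - L 0 \<omega> l m\<bar>}
        \<le> prob {\<omega> \<in> space M. ennreal \<epsilon> < H_norm \<eta> (L s \<omega> - L 0 \<omega>)}"
    proof (rule eventually_at_filter[THEN iffD2], rule always_eventually, intro allI impI)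
      fix s :: real assume "s \<in> {0..}"
      then have [measurable]: "(\<lambda>\<omega>. L s \<omega> l' m') \<in> borel_measurable M"
        "(\<lambda>\<omega>. L 0 \<omega> l' m') \<in> borel_measurable M" for l' m' by (auto intro: meas)
      have "(\<lambda>\<omega>. H_norm \<eta> (L s \<omega> - L 0 \<omega>)) \<in> borel_measurable M"
        by (rule measurable_H_norm) simp
      then have [measurable]: "{\<omega> \<in> space M. ennreal \<epsilon> < H_norm \<eta> (L s \<omega> - L 0 \<omega>)} \<in> events"
        by measurable
      show "prob {\<omega> \<in> space M. 1 < \<bar>L s \<omega> l m - L 0 \<omega> l m\<bar>}
        \<le> prob {\<omega> \<in> space M. ennreal \<epsilon> < H_norm \<eta> (L s \<omega> - L 0 \<omega>)}"
      proof (rule finite_measure_mono)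
        show "{\<omega> \<in> space M. 1 < \<bar>L s \<omega> l m - L 0 \<omega> l m\<bar>} \<subseteq> {\<omega> \<in> space M. ennreal \<epsilon> < H_norm \<eta> (L s \<omega> - L 0 \<omega>)}"
        proof safe
          fix \<omega> assume "1 < \<bar>L s \<omega> l m - L 0 \<omega> l m\<bar>"
          then have "1 < (L s \<omega> l m - L 0 \<omega> l m)\<^sup>2"
            using power_strict_mono[of 1 "\<bar>L s \<omega> l m - L 0 \<omega> l m\<bar>" 2] by simp
          then have "ennreal (\<epsilon>\<^sup>2) < ennreal (?w * (L s \<omega> l m - L 0 \<omega> l m)\<^sup>2)"
            using w \<epsilon> mult_strict_left_mono[OF _ w, of 1 "(L s \<omega> l m - L 0 \<omega> l m)\<^sup>2"]
            by (intro ennreal_lessI) linarith+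
          also have "\<dots> \<le> (H_norm \<eta> (L s \<omega> - L 0 \<omega>))\<^sup>2"
            using H_norm_coefficient_le[OF m, of \<eta> "L s \<omega> - L 0 \<omega>"] by simp
          finally have "(ennreal \<epsilon>)\<^sup>2 < (H_norm \<eta> (L s \<omega> - L 0 \<omega>))\<^sup>2"
            using \<epsilon> by (simp add: ennreal_power)
          then show "ennreal \<epsilon> < H_norm \<eta> (L s \<omega> - L 0 \<omega>)"
            by (meson not_le power_mono zero_le)
        qed
      qed simp
    qed
  qed simp
  from linear_moments_of_increments[OF meas sq zero indep stat cont]
  show ?thesis by (simp add: noise_var_def noise_mean_def)
qed

section \<open>Step integrands and the stochastic integral\<close>

definition steps_within :: "real \<Rightarrow> (real \<times> real \<times> real) list \<Rightarrow> bool" where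
  "steps_within t p \<longleftrightarrow> (\<forall>(c, a, b)\<in>set p. 0 \<le> a \<and> a \<le> b \<and> b \<le> t)"

lemma steps_within_Nil [simp]: "steps_within t []"
  by (simp add: steps_within_def)

lemma steps_within_Cons [simp]:
  "steps_within t ((c, a, b) # p) \<longleftrightarrow> 0 \<le> a \<and> a \<le> b \<and> b \<le> t \<and> steps_within t p"
  by (auto simp: steps_within_def)

lemma step_fun_Nil [simp]: "step_fun [] = (\<lambda>s. 0)"
  by (simp add: step_fun_def fun_eq_iff)

lemma step_fun_Cons [simp]:
  "step_fun ((c, a, b) # p) = (\<lambda>s. c * indicator {a<..b} s + step_fun p s)"
  by (simp add: step_fun_def fun_eq_iff)

lemma step_integral_Nil [simp]: "step_integral X [] = (\<lambda>\<omega>. 0)"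
  by (simp add: step_integral_def fun_eq_iff)

lemma step_integral_Cons [simp]:
  "step_integral X ((c, a, b) # p) = (\<lambda>\<omega>. c * (X b \<omega> - X a \<omega>) + step_integral X p \<omega>)"
  by (simp add: step_integral_def fun_eq_iff)

definition steps_diff :: "(real \<times> real \<times> real) list \<Rightarrow> (real \<times> real \<times> real) list \<Rightarrow> (real \<times> real \<times> real) list" where
  "steps_diff p q = p @ map (\<lambda>(c, a, b). (- c, a, b)) q"

lemma step_fun_diff: "step_fun (steps_diff p q) s = step_fun p s - step_fun q s"
proof -
  have "step_fun (map (\<lambda>(c, a, b). (- c, a, b)) q) s = - step_fun q s"
    by (induction q) auto
  then show ?thesis by (simp add: steps_diff_def step_fun_def)
qed

lemma step_integral_diff: "step_integral X (steps_diff p q) \<omega> = step_integral X p \<omega> - step_integral X q \<omega>"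
proof -
  have "step_integral X (map (\<lambda>(c, a, b). (- c, a, b)) q) \<omega> = - step_integral X q \<omega>"
    by (induction q) auto
  then show ?thesis by (simp add: steps_diff_def step_integral_def)
qed

lemma steps_within_diff: "steps_within t p \<Longrightarrow> steps_within t q \<Longrightarrow> steps_within t (steps_diff p q)"
  by (auto simp: steps_within_def steps_diff_def)

lemma measurable_step_fun [measurable]: "step_fun p \<in> borel_measurable borel"
proof (induction p)
  case (Cons x p)
  then show ?case by (cases x) simp
qed simp

lemma integrable_indicator_Ioc [simp]: "integrable lborel (indicator {a<..b::real} :: real \<Rightarrow> real)"
  by (cases "a \<le> b") auto

lemma integrable_step_fun: "integrable lborel (step_fun p)"
proof (induction p)
  case (Cons x p)
  then show ?case by (cases x) (simp add: integrable_mult_right)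
qed simp

lemma integrable_indicator_step_fun: "integrable lborel (\<lambda>s. indicator {a<..b} s * step_fun p s)"
  using integrable_real_mult_indicator[OF _ integrable_step_fun, of "{a<..b}" p]
  by (simp add: mult.commute)

lemma integrable_step_fun_mult: "integrable lborel (\<lambda>s. step_fun p s * step_fun q s)"
proof (induction p)
  case (Cons x p)
  then show ?case
    using integrable_indicator_step_fun[of _ _ q]
    by (cases x) (simp add: distrib_right mult.assoc)
qed simp

lemma step_fun_outside:
  "steps_within t p \<Longrightarrow> s \<notin> {0<..t} \<Longrightarrow> step_fun p s = 0"
proof (induction p)
  case (Cons x p)
  then show ?case by (cases x) (auto simp: indicator_def)
qed simp

text \<open>
The variance of a step function with respect to the uniform distribution on \<open>(0, t]\<close> is nonnegative.
\<close>

lemma integral_step_fun_power2_le: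
  assumes p: "steps_within t p" and t: "0 < t"
  shows "(\<integral>s. step_fun p s \<partial>lborel)\<^sup>2 \<le> t * (\<integral>s. (step_fun p s)\<^sup>2 \<partial>lborel)"
proof -
  define J where "J = (\<integral>s. step_fun p s \<partial>lborel)"
  have sq: "integrable lborel (\<lambda>s. (step_fun p s)\<^sup>2)"
    using integrable_step_fun_mult[of p p] by (simp add: power2_eq_square)
  have "0 \<le> (\<integral>s. (step_fun p s - J / t * indicator {0<..t} s)\<^sup>2 \<partial>lborel)" by simp
  also have "\<dots> = (\<integral>s. (step_fun p s)\<^sup>2 - 2 * J / t * step_fun p s + (J / t)\<^sup>2 * indicator {0<..t} s \<partial>lborel)"
  proof (intro Bochner_Integration.integral_cong refl)
    fix s
    show "(step_fun p s - J / t * indicator {0<..t} s)\<^sup>2 = (step_fun p s)\<^sup>2 - 2 * J / t * step_fun p s + (J / t)\<^sup>2 * indicator {0<..t} s"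
      using step_fun_outside[OF p, of s] by (cases "s \<in> {0<..t}") (auto simp: power2_diff)
  qed
  also have "\<dots> = (\<integral>s. (step_fun p s)\<^sup>2 \<partial>lborel) - 2 * J / t * J + (J / t)\<^sup>2 * t"
    using sq t by (simp add: integrable_step_fun J_def)
  also have "\<dots> = (\<integral>s. (step_fun p s)\<^sup>2 \<partial>lborel) - J\<^sup>2 / t"
    using t by (simp add: power2_eq_square)
  finally show ?thesis using t by (simp add: J_def field_simps)
qed

context linear_moments
begin

lemma integrable_X_mult: "0 \<le> s \<Longrightarrow> 0 \<le> t \<Longrightarrow> integrable M (\<lambda>\<omega>. X s \<omega> * X t \<omega>)"
  by (intro integrable_mult_square X_measurable X_square_integrable)

text \<open>
The length of \<open>{a<..b} \<inter> {c<..d}\<close> is \<open>min b d - min b c - min a d + min a c\<close>, which is what the covariance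
kernel \<open>min\<close> produces.
\<close>

lemma expectation_increment_mult:
  assumes "0 \<le> a" "a \<le> b" "0 \<le> c" "c \<le> d"
  shows "expectation (\<lambda>\<omega>. (X b \<omega> - X a \<omega>) * (X d \<omega> - X c \<omega>)) =
    v * (\<integral>s. indicator {a<..b} s * indicator {c<..d} s \<partial>lborel) + m\<^sup>2 * ((b - a) * (d - c))"
proof -
  have "expectation (\<lambda>\<omega>. (X b \<omega> - X a \<omega>) * (X d \<omega> - X c \<omega>)) =
      expectation (\<lambda>\<omega>. X b \<omega> * X d \<omega> - X b \<omega> * X c \<omega> - X a \<omega> * X d \<omega> + X a \<omega> * X c \<omega>)"
    by (simp add: algebra_simps)
  also have "\<dots> = v * (min b d - min b c - min a d + min a c) + m\<^sup>2 * ((b - a) * (d - c))"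
    using assms by (simp add: integrable_X_mult X_second_moment algebra_simps)
  also have "min b d - min b c - min a d + min a c = max 0 (min b d - max a c)"
    using assms by (auto simp: min_def max_def)
  also have "\<dots> = (\<integral>s. indicator {a<..b} s * indicator {c<..d} s \<partial>lborel)"
  proof -
    have "{a<..b} \<inter> {c<..d} = {max a c<..min b d}" by auto
    then have "(\<integral>s. indicator {a<..b} s * indicator {c<..d} s \<partial>lborel) = measure lborel {max a c<..min b d}"
      by (simp add: indicator_inter_arith[symmetric])
    also have "\<dots> = max 0 (min b d - max a c)"
      by (cases "max a c \<le> min b d") auto
    finally show ?thesis ..
  qed
  finally show ?thesis .
qed

lemma increment_integrable:
  assumes "0 \<le> a" "0 \<le> b" "0 \<le> c" "0 \<le> d"
  shows "integrable M (\<lambda>\<omega>. (X b \<omega> - X a \<omega>) * (X d \<omega> - X c \<omega>))"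
  using assms by (simp add: algebra_simps integrable_X_mult)

lemma expectation_increment_step_integral:
  assumes "0 \<le> a" "a \<le> b" "steps_within t q"
  shows "integrable M (\<lambda>\<omega>. (X b \<omega> - X a \<omega>) * step_integral X q \<omega>) \<and>
    expectation (\<lambda>\<omega>. (X b \<omega> - X a \<omega>) * step_integral X q \<omega>) =
    v * (\<integral>s. indicator {a<..b} s * step_fun q s \<partial>lborel) + m\<^sup>2 * ((b - a) * (\<integral>s. step_fun q s \<partial>lborel))"
  using assms(3)
proof (induction q)
  case (Cons z q)
  obtain e c d where z: "z = (e, c, d)" by (cases z)
  from Cons z have cd: "0 \<le> c" "c \<le> d" "steps_within t q" by auto
  note IH = Cons.IH[OF cd(3)]
  have int: "integrable M (\<lambda>\<omega>. e * ((X b \<omega> - X a \<omega>) * (X d \<omega> - X c \<omega>)))"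
    using increment_integrable[of a b c d] assms cd by simp
  have eq: "(X b \<omega> - X a \<omega>) * step_integral X (z # q) \<omega> =
      e * ((X b \<omega> - X a \<omega>) * (X d \<omega> - X c \<omega>)) + (X b \<omega> - X a \<omega>) * step_integral X q \<omega>" for \<omega>
    by (simp add: z algebra_simps)
  have ind: "integrable lborel (\<lambda>s. indicator {a<..b} s * indicator {c<..d} s :: real)"
    using integrable_indicator_step_fun[of a b "[(1, c, d)]"] by simp
  have "(\<integral>s. indicator {a<..b} s * step_fun (z # q) s \<partial>lborel) =
      (\<integral>s. e * (indicator {a<..b} s * indicator {c<..d} s) + indicator {a<..b} s * step_fun q s \<partial>lborel)"
    by (simp add: z algebra_simps)
  also have "\<dots> = e * (\<integral>s. indicator {a<..b} s * indicator {c<..d} s \<partial>lborel) + (\<integral>s. indicator {a<..b} s * step_fun q s \<partial>lborel)"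
    using ind by (simp add: integrable_indicator_step_fun)
  finally have 1: "(\<integral>s. indicator {a<..b} s * step_fun (z # q) s \<partial>lborel) = \<dots>" .
  have 2: "(\<integral>s. step_fun (z # q) s \<partial>lborel) = e * (d - c) + (\<integral>s. step_fun q s \<partial>lborel)"
    using cd by (simp add: z integrable_step_fun)
  have "expectation (\<lambda>\<omega>. (X b \<omega> - X a \<omega>) * step_integral X (z # q) \<omega>) =
      e * expectation (\<lambda>\<omega>. (X b \<omega> - X a \<omega>) * (X d \<omega> - X c \<omega>)) + expectation (\<lambda>\<omega>. (X b \<omega> - X a \<omega>) * step_integral X q \<omega>)"
    unfolding eq using int IH by simp
  also have "\<dots> = v * (\<integral>s. indicator {a<..b} s * step_fun (z # q) s \<partial>lborel) + m\<^sup>2 * ((b - a) * (\<integral>s. step_fun (z # q) s \<partial>lborel))"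
    unfolding 1 2 expectation_increment_mult[OF assms(1,2) cd(1,2)] using IH by (simp add: algebra_simps)
  finally show ?case unfolding eq using int IH by auto
qed simp

text \<open>
The Ito isometry for step functions, with the additional rank one term that a nonzero mean contributes. It is
bilinear in the two lists, which may contain overlapping intervals.
\<close>

lemma expectation_step_integral_mult:
  assumes "steps_within t p" "steps_within t q"
  shows "integrable M (\<lambda>\<omega>. step_integral X p \<omega> * step_integral X q \<omega>) \<and>
    expectation (\<lambda>\<omega>. step_integral X p \<omega> * step_integral X q \<omega>) =
    v * (\<integral>s. step_fun p s * step_fun q s \<partial>lborel) + m\<^sup>2 * ((\<integral>s. step_fun p s \<partial>lborel) * (\<integral>s. step_fun q s \<partial>lborel))"
  using assms(1)
proof (induction p)
  case (Cons z p)
  obtain e a b where z: "z = (e, a, b)" by (cases z)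
  from Cons z have ab: "0 \<le> a" "a \<le> b" "steps_within t p" by auto
  note IH = Cons.IH[OF ab(3)]
  note S = expectation_increment_step_integral[OF ab(1,2) assms(2)]
  have eq: "step_integral X (z # p) \<omega> * step_integral X q \<omega> =
      e * ((X b \<omega> - X a \<omega>) * step_integral X q \<omega>) + step_integral X p \<omega> * step_integral X q \<omega>" for \<omega>
    by (simp add: z algebra_simps)
  have "(\<integral>s. step_fun (z # p) s * step_fun q s \<partial>lborel) =
      (\<integral>s. e * (indicator {a<..b} s * step_fun q s) + step_fun p s * step_fun q s \<partial>lborel)"
    by (simp add: z algebra_simps)
  also have "\<dots> = e * (\<integral>s. indicator {a<..b} s * step_fun q s \<partial>lborel) + (\<integral>s. step_fun p s * step_fun q s \<partial>lborel)"
    by (simp add: integrable_indicator_step_fun integrable_step_fun_mult)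
  finally have 1: "(\<integral>s. step_fun (z # p) s * step_fun q s \<partial>lborel) = \<dots>" .
  have 2: "(\<integral>s. step_fun (z # p) s \<partial>lborel) = e * (b - a) + (\<integral>s. step_fun p s \<partial>lborel)"
    using ab by (simp add: z integrable_step_fun)
  have "expectation (\<lambda>\<omega>. step_integral X (z # p) \<omega> * step_integral X q \<omega>) =
      e * expectation (\<lambda>\<omega>. (X b \<omega> - X a \<omega>) * step_integral X q \<omega>) + expectation (\<lambda>\<omega>. step_integral X p \<omega> * step_integral X q \<omega>)"
    unfolding eq using S IH by simp
  also have "\<dots> = v * (\<integral>s. step_fun (z # p) s * step_fun q s \<partial>lborel) +
      m\<^sup>2 * ((\<integral>s. step_fun (z # p) s \<partial>lborel) * (\<integral>s. step_fun q s \<partial>lborel))"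
    unfolding 1 2 S[THEN conjunct2] IH[THEN conjunct2] by (simp add: algebra_simps)
  finally show ?case unfolding eq using S IH by auto
qed simp

text \<open>
Absorbing the squared integral into the \<open>L\<^sup>2\<close> norm costs a factor \<open>t\<close> in front of \<open>m\<^sup>2\<close>. Nothing is lost for
the final rate, as variances and squared means carry the same weights in the summability of the noise.
\<close>

lemma nn_integral_step_integral_power2_le:
  assumes p: "steps_within t p" and t: "0 < t"
  shows "(\<integral>\<^sup>+\<omega>. ennreal ((step_integral X p \<omega>)\<^sup>2) \<partial>M) \<le>
    ennreal (v + m\<^sup>2 * t) * (\<integral>\<^sup>+s. ennreal ((step_fun p s)\<^sup>2) \<partial>lborel)"
proof -
  have sq: "integrable lborel (\<lambda>s. (step_fun p s)\<^sup>2)"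
    using integrable_step_fun_mult[of p p] by (simp add: power2_eq_square)
  note S = expectation_step_integral_mult[OF p p]
  have "(\<integral>\<^sup>+\<omega>. ennreal ((step_integral X p \<omega>)\<^sup>2) \<partial>M) = ennreal (expectation (\<lambda>\<omega>. (step_integral X p \<omega>)\<^sup>2))"
    using S by (intro nn_integral_eq_integral) (auto simp: power2_eq_square)
  also have "expectation (\<lambda>\<omega>. (step_integral X p \<omega>)\<^sup>2) = v * (\<integral>s. (step_fun p s)\<^sup>2 \<partial>lborel) + m\<^sup>2 * (\<integral>s. step_fun p s \<partial>lborel)\<^sup>2"
    using S by (simp add: power2_eq_square)
  also have "\<dots> \<le> v * (\<integral>s. (step_fun p s)\<^sup>2 \<partial>lborel) + m\<^sup>2 * (t * (\<integral>s. (step_fun p s)\<^sup>2 \<partial>lborel))"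
    using integral_step_fun_power2_le[OF p t] by (intro add_left_mono mult_left_mono) auto
  also have "\<dots> = (v + m\<^sup>2 * t) * (\<integral>s. (step_fun p s)\<^sup>2 \<partial>lborel)" by (simp add: algebra_simps)
  also have "ennreal \<dots> = ennreal (v + m\<^sup>2 * t) * ennreal (\<integral>s. (step_fun p s)\<^sup>2 \<partial>lborel)"
    using v_nonneg t by (intro ennreal_mult) auto
  also have "ennreal (\<integral>s. (step_fun p s)\<^sup>2 \<partial>lborel) = (\<integral>\<^sup>+s. ennreal ((step_fun p s)\<^sup>2) \<partial>lborel)"
    using sq by (intro nn_integral_eq_integral[symmetric]) auto
  finally show ?thesis by (simp add: ennreal_leI)
qed

lemma measurable_step_integral: "steps_within t p \<Longrightarrow> step_integral X p \<in> borel_measurable M"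
proof (induction p)
  case (Cons x p)
  then show ?case by (cases x) (auto intro!: borel_measurable_add borel_measurable_times borel_measurable_diff X_measurable)
qed simp

end

lemma power2_diff_le_twice: "(a - c)\<^sup>2 \<le> 2 * (a - b)\<^sup>2 + 2 * ((b - c)\<^sup>2 :: real)"
proof -
  have "0 \<le> ((a - b) - (b - c))\<^sup>2" by simp
  then show ?thesis by (simp add: power2_eq_square algebra_simps)
qed

lemma nn_integral_power2_diff_le:
  fixes f g k :: "'a \<Rightarrow> real"
  assumes [measurable]: "f \<in> borel_measurable N" "g \<in> borel_measurable N" "k \<in> borel_measurable N"
  shows "(\<integral>\<^sup>+x. ennreal ((f x - k x)\<^sup>2) \<partial>N) \<le>
    2 * (\<integral>\<^sup>+x. ennreal ((f x - g x)\<^sup>2) \<partial>N) + 2 * (\<integral>\<^sup>+x. ennreal ((g x - k x)\<^sup>2) \<partial>N)"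
proof -
  have "(\<integral>\<^sup>+x. ennreal ((f x - k x)\<^sup>2) \<partial>N) \<le>
      (\<integral>\<^sup>+x. 2 * ennreal ((f x - g x)\<^sup>2) + 2 * ennreal ((g x - k x)\<^sup>2) \<partial>N)"
  proof (intro nn_integral_mono)
    fix x
    have "ennreal ((f x - k x)\<^sup>2) \<le> ennreal (2 * (f x - g x)\<^sup>2 + 2 * (g x - k x)\<^sup>2)"
      by (intro ennreal_leI power2_diff_le_twice)
    then show "ennreal ((f x - k x)\<^sup>2) \<le> 2 * ennreal ((f x - g x)\<^sup>2) + 2 * ennreal ((g x - k x)\<^sup>2)"
      by (simp add: ennreal_mult')
  qed
  also have "\<dots> = 2 * (\<integral>\<^sup>+x. ennreal ((f x - g x)\<^sup>2) \<partial>N) + 2 * (\<integral>\<^sup>+x. ennreal ((g x - k x)\<^sup>2) \<partial>N)"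
    by (subst nn_integral_add) (auto simp: nn_integral_cmult)
  finally show ?thesis .
qed

text \<open>
The stochastic integral is a mean square limit of step integrals, so the Ito inequality passes to the limit;
two applications of \<open>power2_diff_le_twice\<close> account for the factor 4.
\<close>

lemma (in linear_moments) stoch_integral_step_error:
  assumes Z: "has_stoch_integral M X f t Z" and t: "0 < t" and q: "steps_within t q"
    and [measurable]: "f \<in> borel_measurable borel"
    and A: "(\<integral>\<^sup>+s\<in>{0..t}. ennreal ((f s - step_fun q s)\<^sup>2) \<partial>lborel) \<le> ennreal A" "0 \<le> A"
  shows "(\<integral>\<^sup>+\<omega>. ennreal ((Z \<omega> - step_integral X q \<omega>)\<^sup>2) \<partial>M) \<le> ennreal (4 * (v + m\<^sup>2 * t) * A)"
proof -
  from Z obtain p where [measurable]: "Z \<in> borel_measurable M"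
    and p: "\<And>n. steps_within t (p n)"
    and pf: "(\<lambda>n. \<integral>\<^sup>+s\<in>{0..t}. ennreal ((step_fun (p n) s - f s)\<^sup>2) \<partial>lborel) \<longlonglongrightarrow> 0"
    and pZ: "(\<lambda>n. \<integral>\<^sup>+\<omega>. ennreal ((step_integral X (p n) \<omega> - Z \<omega>)\<^sup>2) \<partial>M) \<longlonglongrightarrow> 0"
    unfolding has_stoch_integral_def steps_within_def by auto
  define w where "w = v + m\<^sup>2 * t"
  have w: "0 \<le> w" using v_nonneg t by (simp add: w_def)
  define W where "W = ennreal w"
  let ?e = "\<lambda>n. \<integral>\<^sup>+\<omega>. ennreal ((step_integral X (p n) \<omega> - Z \<omega>)\<^sup>2) \<partial>M"
  let ?b = "\<lambda>n. \<integral>\<^sup>+s\<in>{0..t}. ennreal ((step_fun (p n) s - f s)\<^sup>2) \<partial>lborel"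
  have [measurable]: "step_integral X q \<in> borel_measurable M" "step_integral X (p n) \<in> borel_measurable M" for n
    using measurable_step_integral p q by blast+
  have bound: "(\<integral>\<^sup>+\<omega>. ennreal ((Z \<omega> - step_integral X q \<omega>)\<^sup>2) \<partial>M) \<le> 2 * ?e n + 2 * (W * (2 * ?b n + 2 * ennreal A))" for n
  proof -
    let ?r = "steps_diff (p n) q"
    have "(\<integral>\<^sup>+\<omega>. ennreal ((Z \<omega> - step_integral X q \<omega>)\<^sup>2) \<partial>M) \<le>
        2 * (\<integral>\<^sup>+\<omega>. ennreal ((Z \<omega> - step_integral X (p n) \<omega>)\<^sup>2) \<partial>M) +
        2 * (\<integral>\<^sup>+\<omega>. ennreal ((step_integral X (p n) \<omega> - step_integral X q \<omega>)\<^sup>2) \<partial>M)"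
      by (rule nn_integral_power2_diff_le) measurable
    also have "(\<integral>\<^sup>+\<omega>. ennreal ((Z \<omega> - step_integral X (p n) \<omega>)\<^sup>2) \<partial>M) = ?e n"
      by (simp add: power2_commute)
    also have "(\<integral>\<^sup>+\<omega>. ennreal ((step_integral X (p n) \<omega> - step_integral X q \<omega>)\<^sup>2) \<partial>M) \<le>
        W * (\<integral>\<^sup>+s. ennreal ((step_fun ?r s)\<^sup>2) \<partial>lborel)"
      using nn_integral_step_integral_power2_le[OF steps_within_diff[OF p[of n] q] t]
      by (simp add: step_integral_diff W_def w_def)
    also have "(\<integral>\<^sup>+s. ennreal ((step_fun ?r s)\<^sup>2) \<partial>lborel) =
        (\<integral>\<^sup>+s. ennreal ((step_fun (p n) s * indicator {0..t} s - step_fun q s * indicator {0..t} s)\<^sup>2) \<partial>lborel)"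
    proof (intro nn_integral_cong)
      fix s
      show "ennreal ((step_fun ?r s)\<^sup>2) = ennreal ((step_fun (p n) s * indicator {0..t} s - step_fun q s * indicator {0..t} s)\<^sup>2)"
        using step_fun_outside[OF p, of s n] step_fun_outside[OF q, of s]
        by (cases "s \<in> {0..t}") (auto simp: step_fun_diff)
    qed
    also have "\<dots> \<le> 2 * (\<integral>\<^sup>+s. ennreal ((step_fun (p n) s * indicator {0..t} s - f s * indicator {0..t} s)\<^sup>2) \<partial>lborel) +
        2 * (\<integral>\<^sup>+s. ennreal ((f s * indicator {0..t} s - step_fun q s * indicator {0..t} s)\<^sup>2) \<partial>lborel)"
      by (rule nn_integral_power2_diff_le) measurable
    also have "(\<integral>\<^sup>+s. ennreal ((step_fun (p n) s * indicator {0..t} s - f s * indicator {0..t} s)\<^sup>2) \<partial>lborel) = ?b n"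
      by (intro nn_integral_cong) (auto simp: indicator_def)
    also have "(\<integral>\<^sup>+s. ennreal ((f s * indicator {0..t} s - step_fun q s * indicator {0..t} s)\<^sup>2) \<partial>lborel) =
        (\<integral>\<^sup>+s\<in>{0..t}. ennreal ((f s - step_fun q s)\<^sup>2) \<partial>lborel)"
      by (intro nn_integral_cong) (auto simp: indicator_def)
    also have "\<dots> \<le> ennreal A" by (rule A)
    finally show ?thesis by (simp add: mult_left_mono add_mono)
  qed
  have "(\<lambda>n. 2 * ?e n + 2 * (W * (2 * ?b n + 2 * ennreal A))) \<longlonglongrightarrow> 2 * 0 + 2 * (W * (2 * 0 + 2 * ennreal A))"
    using pf pZ by (intro tendsto_add ennreal_tendsto_cmult tendsto_const) (auto simp: W_def)
  from LIMSEQ_le_const[OF this, of "\<integral>\<^sup>+\<omega>. ennreal ((Z \<omega> - step_integral X q \<omega>)\<^sup>2) \<partial>M"] bound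
  have "(\<integral>\<^sup>+\<omega>. ennreal ((Z \<omega> - step_integral X q \<omega>)\<^sup>2) \<partial>M) \<le> 2 * (W * (2 * ennreal A))" by auto
  also have "\<dots> = ennreal (2 * (w * (2 * A)))"
    using A w by (simp only: W_def ennreal_mult mult_nonneg_nonneg zero_le_numeral ennreal_numeral)
  finally show ?thesis by (simp add: w_def algebra_simps)
qed

section \<open>The integrand of the Euler schemes\<close>

text \<open>
The noise part of an Euler scheme is itself a step integral, with weight \<open>w j\<close> on the \<open>j\<close>-th step. This puts
it on the same footing as the stochastic convolution that it approximates.
\<close>

definition grid_steps :: "(nat \<Rightarrow> real) \<Rightarrow> real \<Rightarrow> nat \<Rightarrow> (real \<times> real \<times> real) list" where
  "grid_steps w h k = map (\<lambda>j. (w j, real (j - 1) * h, real j * h)) [1..<Suc k]"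

lemma steps_within_grid: "0 \<le> h \<Longrightarrow> steps_within (real k * h) (grid_steps w h k)"
  by (auto simp: steps_within_def grid_steps_def intro!: mult_right_mono)

lemma step_integral_grid:
  "step_integral X (grid_steps w h k) \<omega> = (\<Sum>j=1..k. w j * (X (real j * h) \<omega> - X (real (j - 1) * h) \<omega>))"
  by (simp add: step_integral_def grid_steps_def comp_def interv_sum_list_conv_sum_set_nat atLeastLessThanSuc_atLeastAtMost del: upt_Suc)

lemma step_fun_grid:
  assumes h: "0 < h" and s: "real i * h < s" "s \<le> real (Suc i) * h" and i: "i < k"
  shows "step_fun (grid_steps w h k) s = w (Suc i)"
proof -
  have "step_fun (grid_steps w h k) s = (\<Sum>j=1..k. w j * indicator {real (j - 1) * h<..real j * h} s)"
    by (simp add: step_fun_def grid_steps_def comp_def interv_sum_list_conv_sum_set_nat atLeastLessThanSuc_atLeastAtMost del: upt_Suc)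
  also have "\<dots> = (\<Sum>j=1..k. if j = Suc i then w (Suc i) else 0)"
  proof (intro sum.cong refl)
    fix j assume j: "j \<in> {1..k}"
    have "s \<notin> {real (j - 1) * h<..real j * h}" if "j \<noteq> Suc i"
    proof
      assume sj: "s \<in> {real (j - 1) * h<..real j * h}"
      have "real i * h < real j * h" using sj s by auto
      then have "i < j" using h by simp
      have "real (j - 1) * h < real (Suc i) * h" using sj s by auto
      then have "j - 1 < Suc i" using h by (simp only: mult_less_cancel_right_pos of_nat_less_iff)
      with \<open>i < j\<close> that show False by auto
    qed
    then show "w j * indicator {real (j - 1) * h<..real j * h} s = (if j = Suc i then w (Suc i) else 0)"
      using s by auto
  qed
  also have "\<dots> = w (Suc i)" using i by simp
  finally show ?thesis .
qed

lemma grid_interval_exists: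
  assumes h: "0 < h" and s: "0 < s" "s \<le> real k * h"
  obtains i where "i < k" "real i * h < s" "s \<le> real (Suc i) * h"
proof -
  define i where "i = nat (\<lceil>s / h\<rceil> - 1)"
  have pos: "0 < s / h" using h s by simp
  then have i: "real i = of_int \<lceil>s / h\<rceil> - 1" by (simp add: i_def)
  have 1: "real i < s / h" "s / h \<le> real (Suc i)" using i ceiling_correct[of "s / h"] by auto
  have "s / h \<le> real k" using s h by (simp add: pos_divide_le_eq)
  with 1(1) have "i < k" by linarith
  moreover have "real i * h < s" using 1(1) h by (simp add: pos_less_divide_eq)
  moreover have "s \<le> real (Suc i) * h" using 1(2) h by (simp only: pos_divide_le_eq)
  ultimately show ?thesis by (rule that)
qed

text \<open>
The pointwise error in the \<open>i\<close>-th step before the final time is of order \<open>x exp (- c i x / 2)\<close> with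
\<open>x = sph_eig l * h\<close>. Its square summed over steps of length \<open>h\<close> is of order \<open>x\<^sup>2 h\<close> times a geometric sum
of order \<open>1 / x\<close>, and \<open>x h = sph_eig l * h\<^sup>2\<close>.
\<close>

lemma em_kernel_error:
  assumes cc: "sch = Forward \<longrightarrow> Cc \<le> 1"
  shows "\<exists>C\<ge>0. \<forall>l k h t. 0 < h \<longrightarrow> sph_eig l * h \<le> Cc \<longrightarrow> t = real k * h \<longrightarrow>
    (\<integral>\<^sup>+s\<in>{0..t}. ennreal ((exp (- sph_eig l * (t - s)) -
        step_fun (grid_steps (\<lambda>j. em_xi sch h l ^ (k - j + em_delta sch)) h k) s)\<^sup>2) \<partial>lborel)
      \<le> ennreal (C * (sph_eig l * h\<^sup>2))"
proof -
  define c where "c = inverse (1 + \<bar>Cc\<bar>)"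
  have c: "0 < c" "c \<le> 1" by (auto simp: c_def field_simps)
  define D where "D = 2 + 2 * exp Cc / c"
  define C where "C = D\<^sup>2 * ((1 + \<bar>Cc\<bar>) / c)"
  have C: "0 \<le> C" using c by (simp add: C_def)
  have "(\<integral>\<^sup>+s\<in>{0..t}. ennreal ((exp (- sph_eig l * (t - s)) -
        step_fun (grid_steps (\<lambda>j. em_xi sch h l ^ (k - j + em_delta sch)) h k) s)\<^sup>2) \<partial>lborel)
      \<le> ennreal (C * (sph_eig l * h\<^sup>2))"
    if h: "0 < h" "sph_eig l * h \<le> Cc" and t: "t = real k * h" for l h t and k :: nat
  proof -
    define x where "x = sph_eig l * h"
    have x: "0 \<le> x" "x \<le> Cc" using h by (auto simp: x_def)
    define r where "r = em_xi sch h l"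
    note xi = em_xi_bounds[OF c_def cc x_def x, folded r_def]
    define q where "q = grid_steps (\<lambda>j. em_xi sch h l ^ (k - j + em_delta sch)) h k"
    define E where "E = (\<lambda>i. D\<^sup>2 * x\<^sup>2 * exp (- c * (real i * x)))"
    let ?I = "\<lambda>i. {real i * h<..real (Suc i) * h}"
    have pw: "(exp (- sph_eig l * (t - s)) - step_fun q s)\<^sup>2 \<le> (\<Sum>i<k. E (k - Suc i) * indicator (?I i) s)"
      if s: "0 < s" "s \<le> t" for s
    proof -
      obtain i where i: "i < k" "real i * h < s" "s \<le> real (Suc i) * h"
        using grid_interval_exists[OF h(1) s(1), of k] s t by auto
      have step: "step_fun q s = r ^ (k - Suc i + em_delta sch)"
        unfolding q_def r_def by (rule step_fun_grid[OF h(1) i(2,3,1)])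
      have "\<bar>exp (- (sph_eig l * (t - s))) - r ^ (k - Suc i + em_delta sch)\<bar> \<le>
          D * x * exp (- (c / 2) * (real (k - Suc i) * x))"
        unfolding D_def
      proof (rule noise_kernel_bound[OF c x xi])
        have k: "real (k - Suc i) = real k - real i - 1" using i by (simp add: of_nat_diff)
        have "(real k - real i - 1) * h \<le> t - s" "t - s \<le> (real k - real i) * h"
          using i t by (auto simp: algebra_simps)
        from mult_left_mono[OF this(1), of "sph_eig l"] mult_left_mono[OF this(2), of "sph_eig l"]
        show "real (k - Suc i) * x \<le> sph_eig l * (t - s)" "sph_eig l * (t - s) \<le> real (Suc (k - Suc i)) * x"
          using k by (auto simp: x_def mult_ac)
        show "em_delta sch \<le> 1" by (cases sch) auto
      qed
      then have "\<bar>exp (- (sph_eig l * (t - s))) - r ^ (k - Suc i + em_delta sch)\<bar>\<^sup>2 \<le>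
          (D * x * exp (- (c / 2) * (real (k - Suc i) * x)))\<^sup>2"
        by (intro power_mono) auto
      also have "\<dots> = E (k - Suc i)"
        by (simp add: E_def power_mult_distrib exp_double[symmetric])
      also have "E (k - Suc i) = E (k - Suc i) * indicator (?I i) s" using i by simp
      also have "\<dots> \<le> (\<Sum>i<k. E (k - Suc i) * indicator (?I i) s)"
        using i by (intro member_le_sum[where f = "\<lambda>i. E (k - Suc i) * indicator (?I i) s"]) (auto simp: E_def)
      finally show ?thesis by (simp add: step)
    qed
    have "(\<integral>\<^sup>+s\<in>{0..t}. ennreal ((exp (- sph_eig l * (t - s)) - step_fun q s)\<^sup>2) \<partial>lborel) \<le>
        (\<integral>\<^sup>+s. ennreal (\<Sum>i<k. E (k - Suc i) * indicator (?I i) s) \<partial>lborel)"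
    proof (rule nn_integral_mono_AE)
      \<comment> \<open>The half-open steps do not cover the left end point.\<close>
      have "AE s in lborel. s \<noteq> (0::real)" by (rule AE_lborel_singleton)
      then show "AE s in lborel. ennreal ((exp (- sph_eig l * (t - s)) - step_fun q s)\<^sup>2) * indicator {0..t} s
          \<le> ennreal (\<Sum>i<k. E (k - Suc i) * indicator (?I i) s)"
      proof eventually_elim
        case (elim s)
        then show ?case using pw[of s] by (cases "s \<in> {0..t}") (auto intro!: ennreal_leI)
      qed
    qed
    also have "\<dots> = ennreal (\<integral>s. (\<Sum>i<k. E (k - Suc i) * indicator (?I i) s) \<partial>lborel)"
    proof (rule nn_integral_eq_integral)
      show "integrable lborel (\<lambda>s. \<Sum>i<k. E (k - Suc i) * indicator (?I i) s)"
        by (intro Bochner_Integration.integrable_sum integrable_mult_right integrable_indicator_Ioc)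
      show "AE s in lborel. 0 \<le> (\<Sum>i<k. E (k - Suc i) * indicator (?I i) s)"
        by (intro AE_I2 sum_nonneg mult_nonneg_nonneg) (simp_all add: E_def)
    qed
    also have "(\<integral>s. (\<Sum>i<k. E (k - Suc i) * indicator (?I i) s) \<partial>lborel) = (\<Sum>i<k. E (k - Suc i) * h)"
    proof -
      have I: "(\<integral>s. indicator (?I i) s \<partial>lborel) = h" for i using h by (simp add: distrib_right)
      have "(\<integral>s. (\<Sum>i<k. E (k - Suc i) * indicator (?I i) s) \<partial>lborel) =
          (\<Sum>i<k. \<integral>s. E (k - Suc i) * indicator (?I i) s \<partial>lborel)"
        by (intro Bochner_Integration.integral_sum integrable_mult_right integrable_indicator_Ioc)
      also have "\<dots> = (\<Sum>i<k. E (k - Suc i) * h)"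
        by (intro sum.cong refl) (subst integral_mult_right_zero, simp only: I)
      finally show ?thesis .
    qed
    also have "\<dots> = (\<Sum>i<k. E i * h)"
      by (rule sum.nat_diff_reindex)
    also have "\<dots> = D\<^sup>2 * x * h * (x * (\<Sum>i<k. exp (- c * (real i * x))))"
      by (simp add: E_def sum_distrib_left power2_eq_square mult_ac)
    also have "\<dots> \<le> D\<^sup>2 * x * h * ((1 + \<bar>Cc\<bar>) / c)"
    proof (intro mult_left_mono geometric_exp_sum_le c x)
      show "c * x \<le> \<bar>Cc\<bar>" using mult_right_mono[of c 1 x] c x by simp
    qed (use x h in auto)
    also have "\<dots> = C * (sph_eig l * h\<^sup>2)"
      by (simp add: C_def x_def power2_eq_square mult_ac)
    finally show ?thesis by (simp add: q_def ennreal_leI)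
  qed
  then show ?thesis using C by blast
qed

lemma (in linear_moments) em_mode_error:
  assumes "has_stoch_integral M X (\<lambda>s. exp (- sph_eig l * (t - s))) t Z"
    and h: "0 < h" "1 \<le> k" "t = real k * h" and C: "0 \<le> C"
    and "(\<integral>\<^sup>+s\<in>{0..t}. ennreal ((exp (- sph_eig l * (t - s)) -
        step_fun (grid_steps w h k) s)\<^sup>2) \<partial>lborel) \<le> ennreal (C * (sph_eig l * h\<^sup>2))"
  shows "(\<integral>\<^sup>+\<omega>. ennreal ((Z \<omega> - (\<Sum>j=1..k. w j * (X (real j * h) \<omega> - X (real (j - 1) * h) \<omega>)))\<^sup>2) \<partial>M)
    \<le> ennreal (4 * (v + m\<^sup>2 * t) * (C * (sph_eig l * h\<^sup>2)))"
proof -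
  have "0 < t" using h by simp
  moreover have "steps_within t (grid_steps w h k)" using steps_within_grid[of h k w] h by simp
  moreover have "(\<lambda>s. exp (- sph_eig l * (t - s))) \<in> borel_measurable borel" by measurable
  ultimately show ?thesis
    using stoch_integral_step_error[of "\<lambda>s. exp (- sph_eig l * (t - s))" t Z "grid_steps w h k"] assms
    by (simp add: step_integral_grid)
qed

section \<open>Summability of the noise and the coupling of frequency and step size\<close>

text \<open>
There are \<open>2 l + 1\<close> modes of degree \<open>l\<close>, each contributing a multiple of
\<open>l powr (2 * (\<beta> - 1)) * l powr (- \<alpha>)\<close>, so the series is dominated by \<open>\<Sum> l powr (2 * \<beta> - 1 - \<alpha>)\<close>, which
converges exactly when \<open>\<beta> < \<alpha> / 2\<close>.
\<close>

lemma noise_expansion_of_scaled_identical: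
  assumes M: "prob_space M" and L: "sq_int_H_levy_process M \<eta> L"
    and noise: "noise_scaled_identical M L \<alpha>" and \<beta>: "\<beta> < \<alpha> / 2"
  shows "noise_expansion_converges M L (\<beta> - 1)"
proof -
  interpret prob_space M by (rule M)
  from noise obtain a C' Lh mh vh where
    a: "\<And>l. 1 \<le> l \<Longrightarrow> \<bar>a l\<bar> \<le> C' * real l powr (- \<alpha> / 2)"
    and eq: "\<And>l m. m \<in> {- int l..int l} \<Longrightarrow> AE \<omega> in M. \<forall>t\<ge>0. L t \<omega> l m = a l * Lh l m t \<omega>"
    and lev: "\<And>l m. m \<in> {- int l..int l} \<Longrightarrow> real_levy_process M (Lh l m)"
    and mom: "\<And>l m t. m \<in> {- int l..int l} \<Longrightarrow> 0 \<le> t \<Longrightarrow> integrable M (\<lambda>\<omega>. (Lh l m t \<omega>)\<^sup>2) \<and>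
        (\<integral>\<omega>. Lh l m t \<omega> \<partial>M) = t * mh \<and> (\<integral>\<omega>. (Lh l m t \<omega> - (\<integral>\<omega>'. Lh l m t \<omega>' \<partial>M))\<^sup>2 \<partial>M) = t * vh"
    unfolding noise_scaled_identical_def by blast
  have moments: "noise_mean M L l m = a l * mh" "noise_var M L l m = (a l)\<^sup>2 * vh" if m: "m \<in> {- int l..int l}" for l m
  proof -
    interpret X: linear_moments M "\<lambda>t \<omega>. L t \<omega> l m" "noise_var M L l m" "noise_mean M L l m"
      by (rule levy_coefficient_moments[OF M L m])
    have [measurable]: "Lh l m 1 \<in> borel_measurable M"
      using lev[OF m] by (simp add: levy_process_def)
    have [measurable]: "(\<lambda>\<omega>. L 1 \<omega> l m) \<in> borel_measurable M" by (rule X.X_measurable) simp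
    have ae: "AE \<omega> in M. L 1 \<omega> l m = a l * Lh l m 1 \<omega>" using eq[OF m] by eventually_elim simp
    have "noise_mean M L l m = (\<integral>\<omega>. a l * Lh l m 1 \<omega> \<partial>M)"
      unfolding noise_mean_def using ae by (intro integral_cong_AE) auto
    then show mean: "noise_mean M L l m = a l * mh" using mom[OF m, of 1] by simp
    have "noise_var M L l m = (\<integral>\<omega>. (a l)\<^sup>2 * (Lh l m 1 \<omega> - mh)\<^sup>2 \<partial>M)"
      unfolding noise_var_def mean
    proof (intro integral_cong_AE)
      show "AE \<omega> in M. (L 1 \<omega> l m - a l * mh)\<^sup>2 = (a l)\<^sup>2 * (Lh l m 1 \<omega> - mh)\<^sup>2"
        using ae by eventually_elim (simp add: power_mult_distrib[symmetric] right_diff_distrib)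
    qed auto
    also have "\<dots> = (a l)\<^sup>2 * (\<integral>\<omega>. (Lh l m 1 \<omega> - mh)\<^sup>2 \<partial>M)" by simp
    also have "mh = (\<integral>\<omega>. Lh l m 1 \<omega> \<partial>M)" using mom[OF m, of 1] by simp
    also have "(\<integral>\<omega>. (Lh l m 1 \<omega> - (\<integral>\<omega>'. Lh l m 1 \<omega>' \<partial>M))\<^sup>2 \<partial>M) = vh"
      by (subst mom[OF m, of 1, THEN conjunct2, THEN conjunct2]) simp_all
    finally show "noise_var M L l m = (a l)\<^sup>2 * vh" .
  qed
  have vh: "0 \<le> vh"
  proof -
    have "0 \<le> (\<integral>\<omega>. (Lh 0 0 1 \<omega> - (\<integral>\<omega>'. Lh 0 0 1 \<omega>' \<partial>M))\<^sup>2 \<partial>M)" by simp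
    also have "\<dots> = vh" by (subst mom[of 0 0 1, THEN conjunct2, THEN conjunct2]) simp_all
    finally show ?thesis .
  qed
  define V where "V = vh + mh\<^sup>2"
  have V: "0 \<le> V" using vh by (simp add: V_def)
  define D where "D = 3 * C'\<^sup>2 * V * max 1 (3 powr (\<beta> - 1))"
  have bound: "norm (\<Sum>m\<in>{- int l..int l}. (1 + sph_eig l) powr (\<beta> - 1) * (noise_var M L l m + (noise_mean M L l m)\<^sup>2))
      \<le> D * real l powr (2 * \<beta> - 1 - \<alpha>)" if l: "1 \<le> l" for l
  proof -
    have l': "1 \<le> real l" using l by simp
    have "(1 + sph_eig l) powr (\<beta> - 1) \<le> max 1 (3 powr (\<beta> - 1)) * real l powr (2 * (\<beta> - 1))"
    proof -
      have "(real l)\<^sup>2 = real l powr 2" using l' by simp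
      then have l2: "(real l)\<^sup>2 powr (\<beta> - 1) = real l powr (2 * (\<beta> - 1))"
        by (simp only: powr_powr)
      have b: "(real l)\<^sup>2 \<le> 1 + sph_eig l" "1 + sph_eig l \<le> 3 * (real l)\<^sup>2"
        unfolding sph_eig_def power2_eq_square distrib_left using l' mult_left_mono[OF l', of "real l"]
        by linarith+
      show ?thesis
      proof (cases "0 \<le> \<beta> - 1")
        case True
        have "(1 + sph_eig l) powr (\<beta> - 1) \<le> (3 * (real l)\<^sup>2) powr (\<beta> - 1)"
          using b True by (intro powr_mono2) auto
        also have "\<dots> = 3 powr (\<beta> - 1) * real l powr (2 * (\<beta> - 1))"
          by (simp add: powr_mult l2)
        also have "\<dots> \<le> max 1 (3 powr (\<beta> - 1)) * real l powr (2 * (\<beta> - 1))"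
          by (intro mult_right_mono) auto
        finally show ?thesis .
      next
        case False
        have "(1 + sph_eig l) powr (\<beta> - 1) \<le> (real l)\<^sup>2 powr (\<beta> - 1)"
          using b False l' by (intro powr_mono2') auto
        also have "\<dots> \<le> max 1 (3 powr (\<beta> - 1)) * (real l)\<^sup>2 powr (\<beta> - 1)"
          using mult_right_mono[of 1 "max 1 (3 powr (\<beta> - 1))" "(real l)\<^sup>2 powr (\<beta> - 1)"] by simp
        finally show ?thesis by (simp add: l2)
      qed
    qed
    moreover have "(a l)\<^sup>2 \<le> C'\<^sup>2 * real l powr (- \<alpha>)"
    proof -
      have "\<bar>a l\<bar>\<^sup>2 \<le> (C' * real l powr (- \<alpha> / 2))\<^sup>2" using a[OF l] by (intro power_mono) auto
      also have "\<dots> = C'\<^sup>2 * (real l powr (- \<alpha> / 2) * real l powr (- \<alpha> / 2))"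
        by (simp add: power2_eq_square mult_ac)
      also have "real l powr (- \<alpha> / 2) * real l powr (- \<alpha> / 2) = real l powr (- \<alpha>)"
        by (simp only: powr_add[symmetric]) simp
      finally show ?thesis by simp
    qed
    ultimately have ineq: "(1 + sph_eig l) powr (\<beta> - 1) * ((a l)\<^sup>2 * V) \<le>
        (max 1 (3 powr (\<beta> - 1)) * real l powr (2 * (\<beta> - 1))) * ((C'\<^sup>2 * real l powr (- \<alpha>)) * V)"
      using V by (intro mult_mono mult_nonneg_nonneg) auto
    have "(2 * real l + 1) * ((1 + sph_eig l) powr (\<beta> - 1) * ((a l)\<^sup>2 * V)) \<le>
        (3 * real l) * ((max 1 (3 powr (\<beta> - 1)) * real l powr (2 * (\<beta> - 1))) * ((C'\<^sup>2 * real l powr (- \<alpha>)) * V))"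
      using V l' by (intro mult_mono[OF _ ineq] mult_nonneg_nonneg) auto
    also have "\<dots> = D * (real l powr 1 * real l powr (2 * (\<beta> - 1)) * real l powr (- \<alpha>))"
      using l' by (simp add: D_def mult_ac)
    also have "real l powr 1 * real l powr (2 * (\<beta> - 1)) * real l powr (- \<alpha>) = real l powr (2 * \<beta> - 1 - \<alpha>)"
      using l' by (simp only: powr_add[symmetric]) (simp add: algebra_simps)
    also have "(2 * real l + 1) * ((1 + sph_eig l) powr (\<beta> - 1) * ((a l)\<^sup>2 * V)) =
        (\<Sum>m\<in>{- int l..int l}. (1 + sph_eig l) powr (\<beta> - 1) * (noise_var M L l m + (noise_mean M L l m)\<^sup>2))"
      by (simp add: moments V_def power_mult_distrib algebra_simps)
    finally have "(\<Sum>m\<in>{- int l..int l}. (1 + sph_eig l) powr (\<beta> - 1) * (noise_var M L l m + (noise_mean M L l m)\<^sup>2)) \<le>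
        D * real l powr (2 * \<beta> - 1 - \<alpha>)" .
    moreover have "0 \<le> (\<Sum>m\<in>{- int l..int l}. (1 + sph_eig l) powr (\<beta> - 1) * (noise_var M L l m + (noise_mean M L l m)\<^sup>2))"
      using vh by (intro sum_nonneg) (simp add: moments)
    ultimately show ?thesis by simp
  qed
  have "summable (\<lambda>l. D * real l powr (2 * \<beta> - 1 - \<alpha>))"
    using \<beta> by (intro summable_mult) (simp add: summable_real_powr_iff)
  then show ?thesis
    unfolding noise_expansion_converges_def by (rule summable_comparison_test'[where N = 1]) (rule bound)
qed

text \<open>
The factor \<open>lam * h\<^sup>2\<close> is the squared noise error of a mode. Compared with the weight
\<open>(1 + lam) powr (\<beta> - 1)\<close> for which the noise is summable, there remains \<open>(1 + lam) powr (2 - (\<beta> + \<rho>))\<close>. If this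
exponent is positive, each factor \<open>1 + lam\<close> is bounded by a multiple of \<open>1 / h\<close> by the coupling and lowers the
power of \<open>h\<close>; otherwise the full power \<open>h\<^sup>2\<close> survives.
\<close>

lemma frequency_step_coupling:
  fixes lam :: real
  assumes lam: "0 \<le> lam" and h: "0 < h" "h \<le> T" and c: "lam * h \<le> Cc"
  shows "(1 + lam) powr (- \<rho>) * (lam * h\<^sup>2) \<le>
    max 1 ((T + \<bar>Cc\<bar>) powr (2 - (\<beta> + \<rho>))) * ((h powr min ((\<beta> + \<rho>) / 2) 1)\<^sup>2 * (1 + lam) powr (\<beta> - 1))"
proof -
  define g where "g = \<beta> + \<rho>"
  have pos: "0 < 1 + lam" using lam by linarith
  have h2: "h\<^sup>2 = h powr (2 - min g 2) * h powr min g 2"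
    using h by (simp add: powr_add[symmetric])
  have hm: "(h powr min (g / 2) 1)\<^sup>2 = h powr min g 2"
    using h by (simp add: power2_eq_square powr_add[symmetric] min_def)
  have "(1 + lam) powr (- \<rho>) * (lam * h\<^sup>2) \<le> (1 + lam) powr (- \<rho>) * ((1 + lam) powr 1 * h\<^sup>2)"
    using lam by (intro mult_left_mono mult_right_mono) auto
  also have "\<dots> = ((1 + lam) powr (- \<rho>) * (1 + lam) powr 1) * h\<^sup>2" by simp
  also have "(1 + lam) powr (- \<rho>) * (1 + lam) powr 1 = (1 + lam) powr (2 - g) * (1 + lam) powr (\<beta> - 1)"
    by (simp only: powr_add[symmetric]) (simp add: g_def)
  also have "(1 + lam) powr (2 - g) * (1 + lam) powr (\<beta> - 1) * h\<^sup>2 =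
      ((1 + lam) powr (2 - g) * h powr (2 - min g 2)) * (h powr min g 2 * (1 + lam) powr (\<beta> - 1))"
    by (subst h2) (simp add: mult_ac)
  also have "\<dots> \<le> max 1 ((T + \<bar>Cc\<bar>) powr (2 - g)) * (h powr min g 2 * (1 + lam) powr (\<beta> - 1))"
  proof (rule mult_right_mono)
    show "(1 + lam) powr (2 - g) * h powr (2 - min g 2) \<le> max 1 ((T + \<bar>Cc\<bar>) powr (2 - g))"
    proof (cases "g \<le> 2")
      case True
      then have "(1 + lam) powr (2 - g) * h powr (2 - min g 2) = ((1 + lam) * h) powr (2 - g)"
        using pos h by (simp add: powr_mult)
      also have "\<dots> \<le> (T + \<bar>Cc\<bar>) powr (2 - g)"
        using True lam h c by (intro powr_mono2) (auto simp: distrib_right)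
      finally show ?thesis by simp
    next
      case False
      then have "(1 + lam) powr (2 - g) * h powr (2 - min g 2) = (1 + lam) powr (2 - g)" using h by simp
      also have "\<dots> \<le> (1 + lam) powr 0" using False lam by (intro powr_mono) auto
      finally show ?thesis using pos by simp
    qed
  qed simp
  finally show ?thesis by (simp add: g_def[symmetric] hm)
qed

section \<open>The error in a Sobolev space of negative order\<close>

lemma ennreal_sum_sum:
  assumes "\<And>l m. 0 \<le> f l m"
  shows "ennreal (\<Sum>l\<in>A. \<Sum>m\<in>B l. f l m) = (\<Sum>l\<in>A. \<Sum>m\<in>B l. ennreal (f l m))"
proof -
  have "ennreal (\<Sum>l\<in>A. \<Sum>m\<in>B l. f l m) = (\<Sum>l\<in>A. ennreal (\<Sum>m\<in>B l. f l m))"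
    using assms by (intro sum_ennreal[symmetric] sum_nonneg)
  also have "\<dots> = (\<Sum>l\<in>A. \<Sum>m\<in>B l. ennreal (f l m))"
    using assms by (intro sum.cong refl sum_ennreal[symmetric])
  finally show ?thesis .
qed

lemma nn_integral_sum_sum:
  assumes "\<And>l m. l \<in> A \<Longrightarrow> m \<in> B l \<Longrightarrow> f l m \<in> borel_measurable M"
  shows "(\<integral>\<^sup>+x. (\<Sum>l\<in>A. \<Sum>m\<in>B l. f l m x) \<partial>M) = (\<Sum>l\<in>A. \<Sum>m\<in>B l. \<integral>\<^sup>+x. f l m x \<partial>M)"
proof -
  have "(\<integral>\<^sup>+x. (\<Sum>l\<in>A. \<Sum>m\<in>B l. f l m x) \<partial>M) = (\<Sum>l\<in>A. \<integral>\<^sup>+x. (\<Sum>m\<in>B l. f l m x) \<partial>M)"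
    using assms by (intro nn_integral_sum borel_measurable_sum)
  also have "\<dots> = (\<Sum>l\<in>A. \<Sum>m\<in>B l. \<integral>\<^sup>+x. f l m x \<partial>M)"
    using assms by (intro sum.cong refl nn_integral_sum)
  finally show ?thesis .
qed

definition mode_error ::
  "em_scheme \<Rightarrow> ('w \<Rightarrow> l2_sphere) \<Rightarrow> (real \<Rightarrow> 'w \<Rightarrow> nat \<Rightarrow> int \<Rightarrow> real) \<Rightarrow>
   (nat \<Rightarrow> int \<Rightarrow> real \<Rightarrow> 'w \<Rightarrow> real) \<Rightarrow> real \<Rightarrow> nat \<Rightarrow> 'w \<Rightarrow> nat \<Rightarrow> int \<Rightarrow> real" where
  "mode_error sch X0 L I h k \<omega> l m =
     (exp (- sph_eig l * (real k * h)) * sph_coeff (X0 \<omega>) l m + I l m (real k * h) \<omega>) -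
     (em_xi sch h l ^ k * sph_coeff (X0 \<omega>) l m +
      (\<Sum>j=1..k. em_xi sch h l ^ (k - j + em_delta sch) *
         (L (real j * h) \<omega> l m - L (real (j - 1) * h) \<omega> l m)))"

text \<open>
The error of each mode is split into its initial and its noise part. For the initial part, the growth
\<open>(1 + sph_eig l) powr (2 * s)\<close> of the squared mode error raises the order of the Sobolev norm from \<open>- \<rho>\<close> to
\<open>min (2 - \<rho>) \<gamma>\<close>. For the noise part, the sum over all modes is bounded by the sum \<open>S\<close> of the noise
expansion, which makes the constant independent of the truncation level.
\<close>

lemma strong_error_negative_norm:
  fixes L :: "real \<Rightarrow> 'w \<Rightarrow> nat \<Rightarrow> int \<Rightarrow> real"
  assumes M: "prob_space M" and T: "0 < T" and L: "sq_int_H_levy_process M \<eta> L"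
    and X0: "X0 \<in> borel_measurable M" "L2_H_norm M \<gamma> (\<lambda>\<omega>. sph_coeff (X0 \<omega>)) < \<infinity>"
    and I: "stoch_convolution M L T I" and cc: "sch = Forward \<longrightarrow> Cc \<le> 1"
    and \<gamma>: "0 \<le> \<gamma>" and \<rho>: "0 \<le> \<rho>" and mu: "0 < \<mu>" "\<mu> \<le> 1"
    and noise: "noise_expansion_converges M L (\<beta> - 1)"
  shows "\<exists>C\<ge>0. \<forall>\<kappa> n k h. n \<ge> 1 \<longrightarrow> k \<in> {1..n} \<longrightarrow> h = T / real n \<longrightarrow> sph_eig \<kappa> * h \<le> Cc \<longrightarrow>
    (\<integral>\<^sup>+\<omega>. ennreal (\<Sum>l\<le>\<kappa>. \<Sum>m\<in>{- int l..int l}.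
        (1 + sph_eig l) powr (- \<rho>) * (mode_error sch X0 L I h k \<omega> l m)\<^sup>2) \<partial>M)
    \<le> ennreal ((C * (h powr \<mu> * (real k * h) powr (min 1 ((\<gamma> + \<rho>) / 2) - \<mu>)
          * enn2real (L2_H_norm M (min (2 - \<rho>) \<gamma>) (\<lambda>\<omega>. sph_coeff (X0 \<omega>)))
        + h powr min ((\<beta> + \<rho>) / 2) 1))\<^sup>2)"
proof -
  interpret prob_space M by (rule M)
  define s where "s = min 1 ((\<gamma> + \<rho>) / 2)"
  have s: "0 \<le> s" "s \<le> 1" using \<gamma> \<rho> by (auto simp: s_def)
  define N where "N = enn2real (L2_H_norm M (min (2 - \<rho>) \<gamma>) (\<lambda>\<omega>. sph_coeff (X0 \<omega>)))"
  have N: "0 \<le> N" by (simp add: N_def)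
  have N_eq: "L2_H_norm M (min (2 - \<rho>) \<gamma>) (\<lambda>\<omega>. sph_coeff (X0 \<omega>)) = ennreal N"
  proof -
    have "L2_H_norm M (min (2 - \<rho>) \<gamma>) (\<lambda>\<omega>. sph_coeff (X0 \<omega>)) \<le> L2_H_norm M \<gamma> (\<lambda>\<omega>. sph_coeff (X0 \<omega>))"
      by (rule L2_H_norm_mono) simp
    also have "\<dots> < \<infinity>" by (rule X0)
    finally show ?thesis by (simp add: N_def)
  qed
  obtain C1 where C1: "0 \<le> C1" and initial:
    "\<And>l k h t. 0 < h \<Longrightarrow> sph_eig l * h \<le> Cc \<Longrightarrow> 1 \<le> k \<Longrightarrow> t = real k * h \<Longrightarrow>
      \<bar>exp (- sph_eig l * t) - em_xi sch h l ^ k\<bar> \<le> C1 * (h powr \<mu> * t powr (s - \<mu>) * (1 + sph_eig l) powr s)"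
    using initial_error_bound[OF s mu cc] by blast
  obtain C2 where C2: "0 \<le> C2" and kernel:
    "\<And>l k h t. 0 < h \<Longrightarrow> sph_eig l * h \<le> Cc \<Longrightarrow> t = real k * h \<Longrightarrow>
      (\<integral>\<^sup>+s\<in>{0..t}. ennreal ((exp (- sph_eig l * (t - s)) -
        step_fun (grid_steps (\<lambda>j. em_xi sch h l ^ (k - j + em_delta sch)) h k) s)\<^sup>2) \<partial>lborel)
      \<le> ennreal (C2 * (sph_eig l * h\<^sup>2))"
    using em_kernel_error[OF cc] by blast
  let ?V = "\<lambda>l m. noise_var M L l m + (noise_mean M L l m)\<^sup>2"
  have var_nonneg: "0 \<le> noise_var M L l m" for l m by (simp add: noise_var_def)
  have V_nonneg: "0 \<le> ?V l m" for l m using var_nonneg by simp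
  define S where "S = (\<Sum>l. \<Sum>m\<in>{- int l..int l}. (1 + sph_eig l) powr (\<beta> - 1) * ?V l m)"
  have S_nonneg: "0 \<le> S"
    unfolding S_def using noise V_nonneg
    by (intro suminf_nonneg sum_nonneg mult_nonneg_nonneg) (auto simp: noise_expansion_converges_def)
  have S: "(\<Sum>l\<le>\<kappa>. \<Sum>m\<in>{- int l..int l}. (1 + sph_eig l) powr (\<beta> - 1) * ?V l m) \<le> S" for \<kappa>
    unfolding S_def using noise V_nonneg
    by (intro sum_le_suminf sum_nonneg mult_nonneg_nonneg) (auto simp: noise_expansion_converges_def)
  define B where "B = max 1 ((T + \<bar>Cc\<bar>) powr (2 - (\<beta> + \<rho>)))"
  \<comment> \<open>The factor 2 stems from splitting the error, 4 from the Ito inequality, \<open>C2\<close> from the kernel, \<open>B\<close> from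
    the coupling; \<open>max 1 T\<close> bounds \<open>v + m\<^sup>2 t\<close> by a multiple of \<open>v + m\<^sup>2\<close>.\<close>
  define C3 where "C3 = sqrt (2 * (4 * max 1 T * C2 * B * S))"
  have C3: "0 \<le> C3" "C3\<^sup>2 = 2 * (4 * max 1 T * C2 * B * S)"
    using C2 S_nonneg by (auto simp: C3_def B_def)
  define C where "C = 2 * C1 + C3"
  have "(\<integral>\<^sup>+\<omega>. ennreal (\<Sum>l\<le>\<kappa>. \<Sum>m\<in>{- int l..int l}.
        (1 + sph_eig l) powr (- \<rho>) * (mode_error sch X0 L I h k \<omega> l m)\<^sup>2) \<partial>M)
    \<le> ennreal ((C * (h powr \<mu> * (real k * h) powr (s - \<mu>) * N + h powr min ((\<beta> + \<rho>) / 2) 1))\<^sup>2)"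
    if n: "n \<ge> 1" and k: "k \<in> {1..n}" and h: "h = T / real n" and c: "sph_eig \<kappa> * h \<le> Cc" for \<kappa> n k h
  proof -
    define t where "t = real k * h"
    have h0: "0 < h" using n T by (simp add: h)
    have hT: "h \<le> T" using n T by (simp add: h field_simps)
    have "real k * h \<le> real n * h" using k h0 by (intro mult_right_mono) auto
    moreover have "real n * h = T" using n h by simp
    ultimately have t: "0 < t" "t \<le> T" using k h0 by (auto simp: t_def)
    have cl: "sph_eig l * h \<le> Cc" if "l \<le> \<kappa>" for l
    proof -
      have "sph_eig l \<le> sph_eig \<kappa>" using that unfolding sph_eig_def by (intro mult_mono) auto
      then show ?thesis using c h0 mult_right_mono[of "sph_eig l" "sph_eig \<kappa>" h] by linarith
    qed
    define a where "a = h powr \<mu> * t powr (s - \<mu>)"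
    define b where "b = h powr min ((\<beta> + \<rho>) / 2) 1"
    have a: "0 \<le> a" and b: "0 \<le> b" by (auto simp: a_def b_def)
    let ?x = "\<lambda>\<omega> l m. sph_coeff (X0 \<omega>) l m"
    let ?xi = "\<lambda>l. exp (- sph_eig l * t) - em_xi sch h l ^ k"
    let ?J = "\<lambda>\<omega> l m. \<Sum>j=1..k. em_xi sch h l ^ (k - j + em_delta sch) *
         (L (real j * h) \<omega> l m - L (real (j - 1) * h) \<omega> l m)"
    let ?w = "\<lambda>l. (1 + sph_eig l) powr (- \<rho>)"
    have [measurable]: "(\<lambda>\<omega>. ?x \<omega> l m) \<in> borel_measurable M" for l m
      using X0(1) by (rule measurable_sph_coeff)
    have Z: "has_stoch_integral M (\<lambda>s \<omega>. L s \<omega> l m) (\<lambda>s. exp (- sph_eig l * (t - s))) t (I l m t)"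
      if "m \<in> {- int l..int l}" for l m
      using I that t by (simp add: stoch_convolution_def)
    have I_meas: "I l m t \<in> borel_measurable M" if "m \<in> {- int l..int l}" for l m
      using Z[OF that] by (simp add: has_stoch_integral_def)
    have L_meas: "(\<lambda>\<omega>. L u \<omega> l m) \<in> borel_measurable M" if "m \<in> {- int l..int l}" "0 \<le> u" for l m u
    proof -
      interpret X: linear_moments M "\<lambda>t \<omega>. L t \<omega> l m" "noise_var M L l m" "noise_mean M L l m"
        by (rule levy_coefficient_moments[OF M L that(1)])
      show ?thesis using that by (intro X.X_measurable)
    qed
    have IJ_meas: "(\<lambda>\<omega>. I l m t \<omega> - ?J \<omega> l m) \<in> borel_measurable M" if "m \<in> {- int l..int l}" for l m
      using that h0 by (intro borel_measurable_diff borel_measurable_sum borel_measurable_times borel_measurable_const I_meas L_meas) auto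
    define U where "U = (\<lambda>\<omega>. \<Sum>l\<le>\<kappa>. \<Sum>m\<in>{- int l..int l}. ?w l * (?xi l * ?x \<omega> l m)\<^sup>2)"
    define W where "W = (\<lambda>\<omega>. \<Sum>l\<le>\<kappa>. \<Sum>m\<in>{- int l..int l}. ?w l * (I l m t \<omega> - ?J \<omega> l m)\<^sup>2)"
    have U_nonneg: "0 \<le> U \<omega>" and W_nonneg: "0 \<le> W \<omega>" for \<omega>
      unfolding U_def W_def by (intro sum_nonneg mult_nonneg_nonneg; simp)+
    have [measurable]: "U \<in> borel_measurable M" unfolding U_def by measurable
    have [measurable]: "W \<in> borel_measurable M"
      unfolding W_def
      by (intro borel_measurable_sum borel_measurable_times borel_measurable_power borel_measurable_const IJ_meas; assumption)
    have split: "(\<Sum>l\<le>\<kappa>. \<Sum>m\<in>{- int l..int l}. ?w l * (mode_error sch X0 L I h k \<omega> l m)\<^sup>2) \<le> 2 * U \<omega> + 2 * W \<omega>" for \<omega>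
    proof -
      have "(\<Sum>l\<le>\<kappa>. \<Sum>m\<in>{- int l..int l}. ?w l * (mode_error sch X0 L I h k \<omega> l m)\<^sup>2) \<le>
        (\<Sum>l\<le>\<kappa>. \<Sum>m\<in>{- int l..int l}. 2 * (?w l * (?xi l * ?x \<omega> l m)\<^sup>2) + 2 * (?w l * (I l m t \<omega> - ?J \<omega> l m)\<^sup>2))"
      proof (intro sum_mono)
        fix l m
        have "mode_error sch X0 L I h k \<omega> l m = ?xi l * ?x \<omega> l m - (- (I l m t \<omega> - ?J \<omega> l m))"
          unfolding mode_error_def t_def by (simp add: left_diff_distrib)
        then have "(mode_error sch X0 L I h k \<omega> l m)\<^sup>2 \<le> 2 * (?xi l * ?x \<omega> l m)\<^sup>2 + 2 * (I l m t \<omega> - ?J \<omega> l m)\<^sup>2"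
          using power2_diff_le_twice[of "?xi l * ?x \<omega> l m" "- (I l m t \<omega> - ?J \<omega> l m)" 0] by simp
        from mult_left_mono[OF this, of "?w l"]
        show "?w l * (mode_error sch X0 L I h k \<omega> l m)\<^sup>2 \<le>
            2 * (?w l * (?xi l * ?x \<omega> l m)\<^sup>2) + 2 * (?w l * (I l m t \<omega> - ?J \<omega> l m)\<^sup>2)"
          by (simp add: distrib_left mult.left_commute)
      qed
      also have "\<dots> = 2 * U \<omega> + 2 * W \<omega>"
        by (simp add: U_def W_def sum.distrib sum_distrib_left)
      finally show ?thesis .
    qed
    have U_bound: "(\<integral>\<^sup>+\<omega>. ennreal (U \<omega>) \<partial>M) \<le> ennreal ((C1 * a * N)\<^sup>2)"
    proof -
      have "(\<integral>\<^sup>+\<omega>. ennreal (U \<omega>) \<partial>M) \<le> (\<integral>\<^sup>+\<omega>. ennreal ((C1 * a)\<^sup>2) * (H_norm (min (2 - \<rho>) \<gamma>) (sph_coeff (X0 \<omega>)))\<^sup>2 \<partial>M)"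
      proof (rule nn_integral_mono)
        fix \<omega>
        have "U \<omega> \<le> (\<Sum>l\<le>\<kappa>. \<Sum>m\<in>{- int l..int l}. (C1 * a)\<^sup>2 * ((1 + sph_eig l) powr min (2 - \<rho>) \<gamma> * (?x \<omega> l m)\<^sup>2))"
          unfolding U_def
        proof (intro sum_mono)
          fix l m assume "l \<in> {..\<kappa>}"
          then have "\<bar>?xi l\<bar> \<le> C1 * (a * (1 + sph_eig l) powr s)"
            using initial[OF h0 cl, of l k t] k by (simp add: a_def t_def)
          then have "\<bar>?xi l\<bar>\<^sup>2 \<le> (C1 * (a * (1 + sph_eig l) powr s))\<^sup>2" by (intro power_mono) auto
          then have "?w l * \<bar>?xi l\<bar>\<^sup>2 \<le> ?w l * (C1 * (a * (1 + sph_eig l) powr s))\<^sup>2" by (intro mult_left_mono) auto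
          also have "\<dots> = (C1 * a)\<^sup>2 * (?w l * ((1 + sph_eig l) powr s * (1 + sph_eig l) powr s))"
            by (simp add: power2_eq_square mult_ac)
          also have "?w l * ((1 + sph_eig l) powr s * (1 + sph_eig l) powr s) = (1 + sph_eig l) powr min (2 - \<rho>) \<gamma>"
          proof -
            have "- \<rho> + (s + s) = min (2 - \<rho>) \<gamma>"
            proof (cases "\<gamma> + \<rho> \<le> 2")
              case True
              then have "2 * s = \<gamma> + \<rho>" "min (2 - \<rho>) \<gamma> = \<gamma>" by (auto simp: s_def)
              then show ?thesis by simp
            next
              case False
              then have "s = 1" "min (2 - \<rho>) \<gamma> = 2 - \<rho>" by (auto simp: s_def)
              then show ?thesis by simp
            qed
            then show ?thesis by (simp only: powr_add[symmetric])
          qed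
          finally have "?w l * \<bar>?xi l\<bar>\<^sup>2 * (?x \<omega> l m)\<^sup>2 \<le> (C1 * a)\<^sup>2 * (1 + sph_eig l) powr min (2 - \<rho>) \<gamma> * (?x \<omega> l m)\<^sup>2"
            by (intro mult_right_mono) auto
          then show "?w l * (?xi l * ?x \<omega> l m)\<^sup>2 \<le> (C1 * a)\<^sup>2 * ((1 + sph_eig l) powr min (2 - \<rho>) \<gamma> * (?x \<omega> l m)\<^sup>2)"
            by (simp only: power_mult_distrib power2_abs mult.assoc)
        qed
        also have "\<dots> = (C1 * a)\<^sup>2 * (\<Sum>l\<le>\<kappa>. \<Sum>m\<in>{- int l..int l}. (1 + sph_eig l) powr min (2 - \<rho>) \<gamma> * (?x \<omega> l m)\<^sup>2)"
          by (simp only: sum_distrib_left)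
        finally have "ennreal (U \<omega>) \<le> ennreal ((C1 * a)\<^sup>2) * ennreal (\<Sum>l\<le>\<kappa>. \<Sum>m\<in>{- int l..int l}. (1 + sph_eig l) powr min (2 - \<rho>) \<gamma> * (?x \<omega> l m)\<^sup>2)"
          by (subst ennreal_mult[symmetric]) (auto intro!: ennreal_leI sum_nonneg)
        also have "\<dots> \<le> ennreal ((C1 * a)\<^sup>2) * (H_norm (min (2 - \<rho>) \<gamma>) (sph_coeff (X0 \<omega>)))\<^sup>2"
          by (intro mult_left_mono H_norm_partial_sum_le) simp
        finally show "ennreal (U \<omega>) \<le> \<dots>" .
      qed
      also have "\<dots> = ennreal ((C1 * a)\<^sup>2) * (L2_H_norm M (min (2 - \<rho>) \<gamma>) (\<lambda>\<omega>. sph_coeff (X0 \<omega>)))\<^sup>2"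
        unfolding L2_H_norm_power2 by (intro nn_integral_cmult) measurable
      also have "\<dots> = ennreal ((C1 * a * N)\<^sup>2)"
        unfolding N_eq using N by (simp add: ennreal_power ennreal_mult[symmetric] power_mult_distrib)
      finally show ?thesis .
    qed
    have W_bound: "(\<integral>\<^sup>+\<omega>. ennreal (W \<omega>) \<partial>M) \<le> ennreal (4 * max 1 T * C2 * B * S * b\<^sup>2)"
    proof -
      have mode: "(\<integral>\<^sup>+\<omega>. ennreal (?w l * (I l m t \<omega> - ?J \<omega> l m)\<^sup>2) \<partial>M) \<le>
          ennreal (4 * max 1 T * C2 * B * b\<^sup>2 * ((1 + sph_eig l) powr (\<beta> - 1) * ?V l m))"
        if l: "l \<le> \<kappa>" and m: "m \<in> {- int l..int l}" for l m
      proof -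
        interpret X: linear_moments M "\<lambda>t \<omega>. L t \<omega> l m" "noise_var M L l m" "noise_mean M L l m"
          by (rule levy_coefficient_moments[OF M L m])
        have sq_meas: "(\<lambda>\<omega>. ennreal ((I l m t \<omega> - ?J \<omega> l m)\<^sup>2)) \<in> borel_measurable M"
          by (intro measurable_compose[OF _ measurable_ennreal] borel_measurable_power IJ_meas[OF m])
        have "(\<integral>\<^sup>+\<omega>. ennreal (?w l * (I l m t \<omega> - ?J \<omega> l m)\<^sup>2) \<partial>M) =
            (\<integral>\<^sup>+\<omega>. ennreal (?w l) * ennreal ((I l m t \<omega> - ?J \<omega> l m)\<^sup>2) \<partial>M)"
          by (intro nn_integral_cong ennreal_mult) simp_all
        also have "\<dots> = ennreal (?w l) * (\<integral>\<^sup>+\<omega>. ennreal ((I l m t \<omega> - ?J \<omega> l m)\<^sup>2) \<partial>M)"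
          by (rule nn_integral_cmult[OF sq_meas])
        also have "\<dots> \<le> ennreal (?w l) * ennreal (4 * (noise_var M L l m + (noise_mean M L l m)\<^sup>2 * t) * (C2 * (sph_eig l * h\<^sup>2)))"
          using k by (intro mult_left_mono X.em_mode_error[OF Z[OF m] h0 _ t_def C2 kernel[OF h0 cl[OF l] t_def]]) auto
        also have "\<dots> = ennreal (?w l * (4 * (noise_var M L l m + (noise_mean M L l m)\<^sup>2 * t) * (C2 * (sph_eig l * h\<^sup>2))))"
          using var_nonneg t C2 by (intro ennreal_mult[symmetric]) auto
        also have "\<dots> \<le> ennreal (4 * max 1 T * C2 * B * b\<^sup>2 * ((1 + sph_eig l) powr (\<beta> - 1) * ?V l m))"
        proof (rule ennreal_leI)
          have v: "noise_var M L l m + (noise_mean M L l m)\<^sup>2 * t \<le> max 1 T * ?V l m"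
          proof -
            have "noise_var M L l m * 1 + (noise_mean M L l m)\<^sup>2 * t \<le>
                noise_var M L l m * max 1 T + (noise_mean M L l m)\<^sup>2 * max 1 T"
              using var_nonneg t by (intro add_mono mult_left_mono) auto
            then show ?thesis by (simp add: algebra_simps)
          qed
          have f: "?w l * (sph_eig l * h\<^sup>2) \<le> B * (b\<^sup>2 * (1 + sph_eig l) powr (\<beta> - 1))"
            unfolding B_def b_def by (rule frequency_step_coupling[OF sph_eig_nonneg h0 hT cl[OF l]])
          have "(4 * C2) * ((noise_var M L l m + (noise_mean M L l m)\<^sup>2 * t) * (?w l * (sph_eig l * h\<^sup>2))) \<le>
              (4 * C2) * ((max 1 T * ?V l m) * (B * (b\<^sup>2 * (1 + sph_eig l) powr (\<beta> - 1))))"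
            using C2 V_nonneg[of l m] by (intro mult_left_mono mult_mono[OF v f] mult_nonneg_nonneg) simp_all
          then show "?w l * (4 * (noise_var M L l m + (noise_mean M L l m)\<^sup>2 * t) * (C2 * (sph_eig l * h\<^sup>2))) \<le>
              4 * max 1 T * C2 * B * b\<^sup>2 * ((1 + sph_eig l) powr (\<beta> - 1) * ?V l m)"
            by (simp only: mult_ac)
        qed
        finally show ?thesis .
      qed
      have "(\<integral>\<^sup>+\<omega>. ennreal (W \<omega>) \<partial>M) = (\<integral>\<^sup>+\<omega>. (\<Sum>l\<le>\<kappa>. \<Sum>m\<in>{- int l..int l}. ennreal (?w l * (I l m t \<omega> - ?J \<omega> l m)\<^sup>2)) \<partial>M)"
        unfolding W_def by (intro nn_integral_cong ennreal_sum_sum mult_nonneg_nonneg) simp_all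
      also have "\<dots> = (\<Sum>l\<le>\<kappa>. \<Sum>m\<in>{- int l..int l}. \<integral>\<^sup>+\<omega>. ennreal (?w l * (I l m t \<omega> - ?J \<omega> l m)\<^sup>2) \<partial>M)"
        by (intro nn_integral_sum_sum measurable_compose[OF _ measurable_ennreal] borel_measurable_times
            borel_measurable_const borel_measurable_power IJ_meas; assumption)
      also have "\<dots> \<le> (\<Sum>l\<le>\<kappa>. \<Sum>m\<in>{- int l..int l}. ennreal (4 * max 1 T * C2 * B * b\<^sup>2 * ((1 + sph_eig l) powr (\<beta> - 1) * ?V l m)))"
        by (intro sum_mono mode) auto
      also have "\<dots> = ennreal (\<Sum>l\<le>\<kappa>. \<Sum>m\<in>{- int l..int l}. 4 * max 1 T * C2 * B * b\<^sup>2 * ((1 + sph_eig l) powr (\<beta> - 1) * ?V l m))"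
      proof -
        have "0 \<le> 4 * max 1 T * C2 * B * b\<^sup>2 * ((1 + sph_eig l) powr (\<beta> - 1) * ?V l m)" for l m
          using C2 V_nonneg[of l m] by (intro mult_nonneg_nonneg) (auto simp: B_def)
        then show ?thesis by (intro ennreal_sum_sum[symmetric])
      qed
      also have "\<dots> = ennreal (4 * max 1 T * C2 * B * b\<^sup>2 * (\<Sum>l\<le>\<kappa>. \<Sum>m\<in>{- int l..int l}. (1 + sph_eig l) powr (\<beta> - 1) * ?V l m))"
        by (simp only: sum_distrib_left)
      also have "\<dots> \<le> ennreal (4 * max 1 T * C2 * B * b\<^sup>2 * S)"
        using C2 by (intro ennreal_leI mult_left_mono S) (auto simp: B_def)
      finally show ?thesis by (simp add: mult_ac)
    qed
    have "(\<integral>\<^sup>+\<omega>. ennreal (\<Sum>l\<le>\<kappa>. \<Sum>m\<in>{- int l..int l}. ?w l * (mode_error sch X0 L I h k \<omega> l m)\<^sup>2) \<partial>M)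
        \<le> (\<integral>\<^sup>+\<omega>. 2 * ennreal (U \<omega>) + 2 * ennreal (W \<omega>) \<partial>M)"
    proof (rule nn_integral_mono)
      fix \<omega>
      have "ennreal (2 * U \<omega> + 2 * W \<omega>) = 2 * ennreal (U \<omega>) + 2 * ennreal (W \<omega>)"
        using U_nonneg[of \<omega>] W_nonneg[of \<omega>] by (simp add: ennreal_mult)
      then show "ennreal (\<Sum>l\<le>\<kappa>. \<Sum>m\<in>{- int l..int l}. ?w l * (mode_error sch X0 L I h k \<omega> l m)\<^sup>2) \<le> 2 * ennreal (U \<omega>) + 2 * ennreal (W \<omega>)"
        using ennreal_leI[OF split[of \<omega>]] by simp
    qed
    also have "\<dots> = 2 * (\<integral>\<^sup>+\<omega>. ennreal (U \<omega>) \<partial>M) + 2 * (\<integral>\<^sup>+\<omega>. ennreal (W \<omega>) \<partial>M)"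
      by (subst nn_integral_add) (auto simp: nn_integral_cmult)
    also have "\<dots> \<le> 2 * ennreal ((C1 * a * N)\<^sup>2) + 2 * ennreal (4 * max 1 T * C2 * B * S * b\<^sup>2)"
      by (intro add_mono mult_left_mono U_bound W_bound) simp_all
    also have "\<dots> = ennreal (2 * (C1 * a * N)\<^sup>2 + (C3 * b)\<^sup>2)"
    proof -
      have "(C3 * b)\<^sup>2 = 2 * (4 * max 1 T * C2 * B * S * b\<^sup>2)" by (simp add: power_mult_distrib C3(2))
      moreover have "0 \<le> 4 * max 1 T * C2 * B * S * b\<^sup>2"
        using C2 S_nonneg by (intro mult_nonneg_nonneg) (auto simp: B_def)
      ultimately show ?thesis by (simp only: ennreal_plus ennreal_mult zero_le_numeral zero_le_power2 mult_nonneg_nonneg ennreal_numeral)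
    qed
    also have "\<dots> \<le> ennreal ((C * (a * N + b))\<^sup>2)"
    proof (rule ennreal_leI)
      have nn: "0 \<le> a * N" "0 \<le> C * (a * N)" "0 \<le> C * b" using a b N C1 C3 by (simp_all add: C_def)
      have "2 * (C1 * a * N)\<^sup>2 \<le> (2 * C1 * (a * N))\<^sup>2"
        by (simp add: power_mult_distrib mult_ac)
      also have "\<dots> \<le> (C * (a * N))\<^sup>2"
        using C1 C3 nn by (intro power_mono mult_right_mono) (auto simp: C_def)
      finally have 1: "2 * (C1 * a * N)\<^sup>2 \<le> (C * (a * N))\<^sup>2" .
      have 2: "(C3 * b)\<^sup>2 \<le> (C * b)\<^sup>2"
        using C1 C3 b by (intro power_mono mult_right_mono) (auto simp: C_def)
      have "(C * (a * N))\<^sup>2 + (C * b)\<^sup>2 \<le> (C * (a * N) + C * b)\<^sup>2"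
        proof -
          have "0 \<le> 2 * (C * (a * N)) * (C * b)"
            by (rule mult_nonneg_nonneg[OF mult_nonneg_nonneg nn(3)]) (use nn(2) in simp_all)
          then show ?thesis unfolding power2_sum by linarith
        qed
      with 1 2 show "2 * (C1 * a * N)\<^sup>2 + (C3 * b)\<^sup>2 \<le> (C * (a * N + b))\<^sup>2"
        by (simp add: distrib_left)
    qed
    finally show ?thesis by (simp add: a_def b_def t_def)
  qed
  moreover have "0 \<le> C" using C1 C3 by (simp add: C_def)
  ultimately show ?thesis unfolding N_def s_def by blast
qed

section \<open>From the error in negative order to the weak error\<close>

lemma fundamental_theorem_line:
  assumes \<phi>: "\<And>f. GDERIV \<phi> f :> \<phi>' f"
    and int: "(\<lambda>y. \<phi>' (y *\<^sub>R b + (1 - y) *\<^sub>R a)) integrable_on {0..1}"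
  shows "\<phi> a - \<phi> b = integral {0..1} (\<lambda>y. \<phi>' (y *\<^sub>R b + (1 - y) *\<^sub>R a)) \<bullet> (a - b)"
proof -
  let ?G = "\<lambda>y::real. \<phi>' (y *\<^sub>R b + (1 - y) *\<^sub>R a)"
  have d: "((\<lambda>y. \<phi> (y *\<^sub>R b + (1 - y) *\<^sub>R a)) has_vector_derivative (?G y \<bullet> (b - a))) (at y within {0..1})" for y :: real
  proof -
    have l: "((\<lambda>y::real. y *\<^sub>R b + (1 - y) *\<^sub>R a) has_derivative (\<lambda>t. t *\<^sub>R (b - a))) (at y)"
      by (auto intro!: derivative_eq_intros simp: algebra_simps)
    have "(\<phi> has_derivative (\<lambda>k. k \<bullet> ?G y)) (at (y *\<^sub>R b + (1 - y) *\<^sub>R a))"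
      using \<phi> by (simp add: gderiv_def)
    from has_derivative_compose[OF l this]
    have "((\<lambda>y. \<phi> (y *\<^sub>R b + (1 - y) *\<^sub>R a)) has_derivative (\<lambda>t. t *\<^sub>R (?G y \<bullet> (b - a)))) (at y)"
      by (simp add: inner_commute)
    then show ?thesis
      unfolding has_vector_derivative_def by (rule has_derivative_at_withinI)
  qed
  have "((\<lambda>y. ?G y \<bullet> (b - a)) has_integral (\<phi> b - \<phi> a)) {0..1}"
    using fundamental_theorem_of_calculus[OF _ d] by simp
  moreover have "((\<lambda>y. ?G y \<bullet> (b - a)) has_integral (integral {0..1} ?G \<bullet> (b - a))) {0..1}"
    using has_integral_linear[OF integrable_integral[OF int] bounded_linear_inner_left[of "b - a"]]
    by (simp add: comp_def)
  ultimately have "\<phi> b - \<phi> a = integral {0..1} ?G \<bullet> (b - a)"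
    by (rule has_integral_unique)
  then show ?thesis by (simp add: inner_diff_right)
qed

text \<open>
The finite-dimensional form of the duality between the Sobolev spaces of order \<open>\<rho>\<close> and \<open>- \<rho>\<close>.
\<close>

lemma Cauchy_Schwarz_Sobolev_duality:
  fixes c d :: "nat \<Rightarrow> int \<Rightarrow> real"
  shows "\<bar>\<Sum>l\<le>\<kappa>. \<Sum>m\<in>{- int l..int l}. d l m * c l m\<bar> \<le>
    sqrt (\<Sum>l\<le>\<kappa>. \<Sum>m\<in>{- int l..int l}. (1 + sph_eig l) powr \<rho> * (c l m)\<^sup>2) *
    sqrt (\<Sum>l\<le>\<kappa>. \<Sum>m\<in>{- int l..int l}. (1 + sph_eig l) powr (- \<rho>) * (d l m)\<^sup>2)"
proof -
  let ?S = "SIGMA l:{..\<kappa>}. {- int l..int l}"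
  let ?a = "\<lambda>(l, m). (1 + sph_eig l) powr (\<rho> / 2) * c l m"
  let ?b = "\<lambda>(l, m). (1 + sph_eig l) powr (- \<rho> / 2) * d l m"
  have pos: "0 < 1 + sph_eig l" for l using sph_eig_nonneg[of l] by linarith
  have ab: "?a x * ?b x = (case x of (l, m) \<Rightarrow> d l m * c l m)" for x
  proof (cases x)
    case (Pair l m)
    have "(1 + sph_eig l) powr (\<rho> / 2) * (1 + sph_eig l) powr (- \<rho> / 2) = 1"
      using pos[of l] by (simp add: powr_add[symmetric])
    then have "((1 + sph_eig l) powr (\<rho> / 2) * (1 + sph_eig l) powr (- \<rho> / 2)) * (d l m * c l m) = d l m * c l m"
      by simp
    then show ?thesis using Pair by (simp add: mult_ac)
  qed
  have sq: "((1 + sph_eig l) powr (r / 2))\<^sup>2 = (1 + sph_eig l) powr r" for l r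
    using pos[of l] by (simp add: power2_eq_square powr_add[symmetric])
  have "\<bar>\<Sum>x\<in>?S. ?a x * ?b x\<bar> = sqrt ((\<Sum>x\<in>?S. ?a x * ?b x)\<^sup>2)" by simp
  also have "\<dots> \<le> sqrt ((\<Sum>x\<in>?S. (?a x)\<^sup>2) * (\<Sum>x\<in>?S. (?b x)\<^sup>2))"
    by (intro real_sqrt_le_mono Cauchy_Schwarz_ineq_sum)
  also have "\<dots> = sqrt (\<Sum>x\<in>?S. (?a x)\<^sup>2) * sqrt (\<Sum>x\<in>?S. (?b x)\<^sup>2)"
    by (rule real_sqrt_mult)
  finally show ?thesis
    by (simp only: ab) (simp add: sum.Sigma case_prod_beta power_mult_distrib sq sq[of _ "- \<rho>", simplified])
qed

text \<open>
Pairing \<open>G\<close> with the difference of the two approximations gives a bound by a product of two random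
variables, and the Cauchy--Schwarz inequality for expectations separates them. For measurability, both
approximations are images of their families of coefficients, elements of a countable product of real
lines, under a continuous map; this replaces sums of random elements of \<open>l2_sphere\<close>, a space that would
have to be second countable for such sums to be treated directly.
\<close>

lemma (in prob_space) weak_error_le:
  fixes ca cb :: "'a \<Rightarrow> nat \<Rightarrow> int \<Rightarrow> real" and A B :: "'a \<Rightarrow> l2_sphere"
  assumes \<phi>: "\<And>f. GDERIV \<phi> f :> \<phi>' f"
    and A: "A = (\<lambda>\<omega>. \<Sum>l\<le>\<kappa>. \<Sum>m\<in>{- int l..int l}. ca \<omega> l m *\<^sub>R Ylm l m)"
    and B: "B = (\<lambda>\<omega>. \<Sum>l\<le>\<kappa>. \<Sum>m\<in>{- int l..int l}. cb \<omega> l m *\<^sub>R Ylm l m)"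
    and ca: "\<And>l m. m \<in> {- int l..int l} \<Longrightarrow> (\<lambda>\<omega>. ca \<omega> l m) \<in> borel_measurable M"
    and cb: "\<And>l m. m \<in> {- int l..int l} \<Longrightarrow> (\<lambda>\<omega>. cb \<omega> l m) \<in> borel_measurable M"
    and G: "G = (\<lambda>\<omega> y. \<phi>' (y *\<^sub>R B \<omega> + (1 - y) *\<^sub>R A \<omega>))"
      "AE \<omega> in M. G \<omega> integrable_on {0..1}"
      "(\<lambda>\<omega>. integral {0..1} (G \<omega>)) \<in> borel_measurable M"
      "L2_H_norm M \<rho> (\<lambda>\<omega>. sph_coeff (integral {0..1} (G \<omega>))) \<le> ennreal K"
    and R: "0 \<le> R" "(\<integral>\<^sup>+\<omega>. ennreal (\<Sum>l\<le>\<kappa>. \<Sum>m\<in>{- int l..int l}.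
        (1 + sph_eig l) powr (- \<rho>) * (ca \<omega> l m - cb \<omega> l m)\<^sup>2) \<partial>M) \<le> ennreal (R\<^sup>2)"
  shows "integrable M (\<lambda>\<omega>. \<phi> (A \<omega>) - \<phi> (B \<omega>)) \<and>
    \<bar>expectation (\<lambda>\<omega>. \<phi> (A \<omega>) - \<phi> (B \<omega>))\<bar> \<le> max 0 K * R"
proof -
  define g where "g = (\<lambda>\<omega>. integral {0..1} (G \<omega>))"
  have g_meas: "g \<in> borel_measurable M" using G(3) by (simp add: g_def)
  have coeff: "(\<lambda>\<omega>. sph_coeff (g \<omega>) l m) \<in> borel_measurable M" for l m
    using g_meas by (rule measurable_sph_coeff)
  have \<phi>_meas: "\<phi> \<in> borel_measurable borel"
  proof (intro borel_measurable_continuous_onI continuous_at_imp_continuous_on ballI)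
    fix f show "isCont \<phi> f" using \<phi>[of f] unfolding gderiv_def by (rule has_derivative_continuous)
  qed
  have meas: "(\<lambda>\<omega>. \<phi> (\<Sum>l\<le>\<kappa>. \<Sum>m\<in>{- int l..int l}. c \<omega> l m *\<^sub>R Ylm l m)) \<in> borel_measurable M"
    if c: "\<And>l m. m \<in> {- int l..int l} \<Longrightarrow> (\<lambda>\<omega>. c \<omega> l m) \<in> borel_measurable M" for c :: "'a \<Rightarrow> nat \<Rightarrow> int \<Rightarrow> real"
  proof -
    let ?S = "\<lambda>c :: nat \<Rightarrow> int \<Rightarrow> real. \<Sum>l\<le>\<kappa>. \<Sum>m\<in>{- int l..int l}. c l m *\<^sub>R Ylm l m"
    \<comment> \<open>The coefficients with \<open>\<bar>m\<bar> > l\<close> may fail to be measurable and are reset.\<close>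
    define c' where "c' = (\<lambda>\<omega> l m. if m \<in> {- int l..int l} then c \<omega> l m else 0)"
    have "continuous_on UNIV (\<lambda>c :: nat \<Rightarrow> int \<Rightarrow> real. c l m)" for l m
      by (rule continuous_on_compose2[OF continuous_on_product_coordinates[of m] continuous_on_product_coordinates[of l]]) simp
    then have "continuous_on UNIV ?S" by (intro continuous_intros)
    then have S: "?S \<in> borel_measurable borel" by (rule borel_measurable_continuous_onI)
    have "(\<lambda>\<omega>. c' \<omega> l m) \<in> borel_measurable M" for l m
    proof (cases "m \<in> {- int l..int l}")
      case True
      then have "(\<lambda>\<omega>. c' \<omega> l m) = (\<lambda>\<omega>. c \<omega> l m)" by (simp add: c'_def)
      then show ?thesis using c[OF True] by (simp only:)
    next
      case False
      then have "(\<lambda>\<omega>. c' \<omega> l m) = (\<lambda>\<omega>. 0)" unfolding c'_def by (simp only: if_False)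
      then show ?thesis by (simp only: borel_measurable_const)
    qed
    then have "(\<lambda>\<omega>. c' \<omega> l) \<in> borel_measurable M" for l
      by (rule measurable_coordinatewise_then_product)
    then have "c' \<in> borel_measurable M" by (rule measurable_coordinatewise_then_product)
    then have "(\<lambda>\<omega>. ?S (c' \<omega>)) \<in> borel_measurable M"
      by (rule measurable_compose[where f = c' and g = ?S]) (rule S)
    then have "(\<lambda>\<omega>. \<phi> (?S (c' \<omega>))) \<in> borel_measurable M"
      by (rule measurable_compose[where f = "\<lambda>\<omega>. ?S (c' \<omega>)" and g = \<phi>]) (rule \<phi>_meas)
    moreover have "?S (c' \<omega>) = (\<Sum>l\<le>\<kappa>. \<Sum>m\<in>{- int l..int l}. c \<omega> l m *\<^sub>R Ylm l m)" for \<omega>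
      unfolding c'_def by (intro sum.cong refl) (simp only: if_True)
    ultimately show ?thesis by (simp only:)
  qed
  have [measurable]: "(\<lambda>\<omega>. \<phi> (A \<omega>)) \<in> borel_measurable M" "(\<lambda>\<omega>. \<phi> (B \<omega>)) \<in> borel_measurable M"
    unfolding A B by (rule meas[of ca, OF ca], assumption, rule meas[of cb, OF cb], assumption)
  define p where "p = (\<lambda>\<omega>. \<Sum>l\<le>\<kappa>. \<Sum>m\<in>{- int l..int l}. (1 + sph_eig l) powr \<rho> * (sph_coeff (g \<omega>) l m)\<^sup>2)"
  define e where "e = (\<lambda>\<omega>. \<Sum>l\<le>\<kappa>. \<Sum>m\<in>{- int l..int l}. (1 + sph_eig l) powr (- \<rho>) * (ca \<omega> l m - cb \<omega> l m)\<^sup>2)"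
  have p_nonneg: "0 \<le> p \<omega>" and e_nonneg: "0 \<le> e \<omega>" for \<omega>
    unfolding p_def e_def by (intro sum_nonneg mult_nonneg_nonneg; simp)+
  have [measurable]: "p \<in> borel_measurable M"
    unfolding p_def by (intro borel_measurable_sum borel_measurable_times borel_measurable_power borel_measurable_const coeff)
  have [measurable]: "e \<in> borel_measurable M"
    unfolding e_def
    by (intro borel_measurable_sum borel_measurable_times borel_measurable_power borel_measurable_const borel_measurable_diff ca cb; assumption)
  have pw: "AE \<omega> in M. \<bar>\<phi> (A \<omega>) - \<phi> (B \<omega>)\<bar> \<le> sqrt (p \<omega>) * sqrt (e \<omega>)"
    using G(2)
  proof eventually_elim
    case (elim \<omega>)
    then have "\<phi> (A \<omega>) - \<phi> (B \<omega>) = g \<omega> \<bullet> (A \<omega> - B \<omega>)"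
      using fundamental_theorem_line[OF \<phi>, of "B \<omega>" "A \<omega>"] by (simp add: G(1) g_def)
    also have "A \<omega> - B \<omega> = (\<Sum>l\<le>\<kappa>. \<Sum>m\<in>{- int l..int l}. (ca \<omega> l m - cb \<omega> l m) *\<^sub>R Ylm l m)"
      by (simp add: A B sum_subtractf scaleR_diff_left)
    also have "g \<omega> \<bullet> \<dots> = (\<Sum>l\<le>\<kappa>. \<Sum>m\<in>{- int l..int l}. (ca \<omega> l m - cb \<omega> l m) * sph_coeff (g \<omega>) l m)"
      by (simp add: inner_sum_right sph_coeff_def)
    finally show ?case unfolding p_def e_def by (simp only: Cauchy_Schwarz_Sobolev_duality)
  qed
  have "(\<integral>\<^sup>+\<omega>. ennreal \<bar>\<phi> (A \<omega>) - \<phi> (B \<omega>)\<bar> \<partial>M) \<le> (\<integral>\<^sup>+\<omega>. ennreal (sqrt (p \<omega>)) * ennreal (sqrt (e \<omega>)) \<partial>M)"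
  proof (rule nn_integral_mono_AE)
    show "AE \<omega> in M. ennreal \<bar>\<phi> (A \<omega>) - \<phi> (B \<omega>)\<bar> \<le> ennreal (sqrt (p \<omega>)) * ennreal (sqrt (e \<omega>))"
      using pw
    proof eventually_elim
      case (elim \<omega>)
      have "ennreal \<bar>\<phi> (A \<omega>) - \<phi> (B \<omega>)\<bar> \<le> ennreal (sqrt (p \<omega>) * sqrt (e \<omega>))"
        by (rule ennreal_leI) (rule elim)
      also have "\<dots> = ennreal (sqrt (p \<omega>)) * ennreal (sqrt (e \<omega>))"
        using p_nonneg[of \<omega>] e_nonneg[of \<omega>] by (intro ennreal_mult real_sqrt_ge_zero)
      finally show ?case .
    qed
  qed
  then have "(\<integral>\<^sup>+\<omega>. ennreal \<bar>\<phi> (A \<omega>) - \<phi> (B \<omega>)\<bar> \<partial>M)\<^sup>2 \<le> (\<integral>\<^sup>+\<omega>. ennreal (sqrt (p \<omega>)) * ennreal (sqrt (e \<omega>)) \<partial>M)\<^sup>2"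
    by (rule power_mono) simp
  also have "\<dots> \<le> (\<integral>\<^sup>+\<omega>. (ennreal (sqrt (p \<omega>)))\<^sup>2 \<partial>M) * (\<integral>\<^sup>+\<omega>. (ennreal (sqrt (e \<omega>)))\<^sup>2 \<partial>M)"
    by (rule Cauchy_Schwarz_nn_integral) measurable
  also have "(\<integral>\<^sup>+\<omega>. (ennreal (sqrt (p \<omega>)))\<^sup>2 \<partial>M) = (\<integral>\<^sup>+\<omega>. ennreal (p \<omega>) \<partial>M)"
    using p_nonneg by (intro nn_integral_cong) (simp add: ennreal_power)
  also have "(\<integral>\<^sup>+\<omega>. (ennreal (sqrt (e \<omega>)))\<^sup>2 \<partial>M) = (\<integral>\<^sup>+\<omega>. ennreal (e \<omega>) \<partial>M)"
    using e_nonneg by (intro nn_integral_cong) (simp add: ennreal_power)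
  also have "(\<integral>\<^sup>+\<omega>. ennreal (p \<omega>) \<partial>M) * (\<integral>\<^sup>+\<omega>. ennreal (e \<omega>) \<partial>M) \<le> (ennreal K)\<^sup>2 * ennreal (R\<^sup>2)"
  proof (rule mult_mono)
    show "(\<integral>\<^sup>+\<omega>. ennreal (e \<omega>) \<partial>M) \<le> ennreal (R\<^sup>2)" unfolding e_def by (rule R(2))
    have "(\<integral>\<^sup>+\<omega>. ennreal (p \<omega>) \<partial>M) \<le> (L2_H_norm M \<rho> (\<lambda>\<omega>. sph_coeff (g \<omega>)))\<^sup>2"
      unfolding L2_H_norm_power2 p_def by (intro nn_integral_mono H_norm_partial_sum_le)
    also have "\<dots> \<le> (ennreal K)\<^sup>2" using G(4) by (intro power_mono) (simp_all add: g_def)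
    finally show "(\<integral>\<^sup>+\<omega>. ennreal (p \<omega>) \<partial>M) \<le> (ennreal K)\<^sup>2" .
  qed simp_all
  also have "\<dots> = (ennreal (max 0 K * R))\<^sup>2"
  proof -
    have K: "ennreal K = ennreal (max 0 K)"
      by (cases "0 \<le> K") (simp_all add: max_absorb2 max_absorb1 ennreal_neg)
    have "(ennreal (max 0 K * R))\<^sup>2 = ennreal ((max 0 K * R)\<^sup>2)"
      using R(1) by (intro ennreal_power) simp
    also have "\<dots> = ennreal ((max 0 K)\<^sup>2) * ennreal (R\<^sup>2)"
      unfolding power_mult_distrib by (intro ennreal_mult) simp_all
    also have "ennreal ((max 0 K)\<^sup>2) = (ennreal K)\<^sup>2"
      unfolding K by (intro ennreal_power[symmetric]) simp
    finally show ?thesis by (rule sym)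
  qed
  finally have bound: "(\<integral>\<^sup>+\<omega>. ennreal (norm (\<phi> (A \<omega>) - \<phi> (B \<omega>))) \<partial>M) \<le> ennreal (max 0 K * R)"
    unfolding real_norm_def by (rule ennreal_power2_le_imp_le)
  have int: "integrable M (\<lambda>\<omega>. \<phi> (A \<omega>) - \<phi> (B \<omega>))"
  proof (rule integrableI_bounded)
    show "(\<integral>\<^sup>+\<omega>. ennreal (norm (\<phi> (A \<omega>) - \<phi> (B \<omega>))) \<partial>M) < \<infinity>"
      using bound by (rule le_less_trans) simp
  qed measurable
  have "ennreal (norm (expectation (\<lambda>\<omega>. \<phi> (A \<omega>) - \<phi> (B \<omega>)))) \<le> ennreal (max 0 K * R)"
    using integral_norm_bound_ennreal[OF int] bound by (rule order_trans)
  moreover have "0 \<le> max 0 K * R" using R(1) by simp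
  ultimately have "norm (expectation (\<lambda>\<omega>. \<phi> (A \<omega>) - \<phi> (B \<omega>))) \<le> max 0 K * R"
    by (simp only: ennreal_le_iff)
  then show ?thesis using int by (simp only: real_norm_def simp_thms)
qed

theorem theorem4p4:
  fixes M :: "'w measure"
    and F :: "real \<Rightarrow> 'w measure"
    and T \<gamma> \<rho> \<eta> \<beta> \<mu> Cc K :: real
    and L :: "real \<Rightarrow> 'w \<Rightarrow> nat \<Rightarrow> int \<Rightarrow> real"
    and X0 :: "'w \<Rightarrow> l2_sphere"
    and I :: "nat \<Rightarrow> int \<Rightarrow> real \<Rightarrow> 'w \<Rightarrow> real"
    and sch :: em_scheme
    and \<phi> :: "l2_sphere \<Rightarrow> real"
    and \<phi>' :: "l2_sphere \<Rightarrow> l2_sphere"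
  assumes T: "T > 0"
    and filtered_space: "complete_filtered_prob_space M F T"
    and levy: "\<eta> > -1" "sq_int_H_levy_process M \<eta> L"
    and X0_L2: "integrable M (\<lambda>\<omega>. (norm (X0 \<omega>))\<^sup>2)"
    and X0_adapted: "X0 \<in> borel_measurable (F 0)"
    and X0_indep: "indep_rv M borel X0
        (Pi\<^sub>M {0..} (\<lambda>_. borel)) (\<lambda>\<omega>. \<lambda>t\<in>{0..}. L t \<omega>)"
    and X0_regular: "\<gamma> \<ge> 0" "L2_H_norm M \<gamma> (\<lambda>\<omega>. sph_coeff (X0 \<omega>)) < \<infinity>"
    and stoch_convolution: "stoch_convolution M L T I"
    and coupling_constant: "sch = Forward \<Longrightarrow> Cc \<le> 1"
    and differentiable: "\<And>f. GDERIV \<phi> f :> \<phi>' f"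
    and rho: "\<rho> \<ge> 0"
    and derivative_bound:
      "\<And>\<kappa> n k h G. \<kappa> \<ge> 1 \<Longrightarrow> n \<ge> 1 \<Longrightarrow> h = T / real n \<Longrightarrow> sph_eig \<kappa> * h \<le> Cc \<Longrightarrow> k \<le> n \<Longrightarrow>
        G = (\<lambda>\<omega> y. \<phi>' (y *\<^sub>R em_approx sch X0 L \<kappa> h k \<omega>
                     + (1 - y) *\<^sub>R spectral_approx X0 I \<kappa> (real k * h) \<omega>)) \<Longrightarrow>
        (AE \<omega> in M. G \<omega> integrable_on {0..1}) \<and>
        (\<lambda>\<omega>. integral {0..1} (G \<omega>)) \<in> borel_measurable M \<and>
        L2_H_norm M \<rho> (\<lambda>\<omega>. sph_coeff (integral {0..1} (G \<omega>))) \<le> ennreal K"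
    and mu: "0 < \<mu>" "\<mu> \<le> 1"
    and noise: "(noise_expansion_converges M L \<eta> \<and> \<beta> = \<eta> + 1) \<or>
      (\<exists>\<alpha>>0. noise_scaled_identical M L \<alpha> \<and> \<beta> < \<alpha> / 2)"
  shows "\<exists>C. \<forall>\<kappa>\<ge>1. \<forall>n\<ge>1. \<forall>k\<in>{1..n}. \<forall>h t D.
      h = T / real n \<longrightarrow> sph_eig \<kappa> * h \<le> Cc \<longrightarrow> t = real k * h \<longrightarrow>
      D = (\<lambda>\<omega>. \<phi> (spectral_approx X0 I \<kappa> t \<omega>) - \<phi> (em_approx sch X0 L \<kappa> h k \<omega>)) \<longrightarrow>
      integrable M D \<and>
      \<bar>\<integral>\<omega>. D \<omega> \<partial>M\<bar> \<le>
        C * h powr \<mu> * t powr (min 1 ((\<gamma> + \<rho>) / 2) - \<mu>)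
          * enn2real (L2_H_norm M (min (2 - \<rho>) \<gamma>) (\<lambda>\<omega>. sph_coeff (X0 \<omega>)))
        + C * h powr min ((\<beta> + \<rho>) / 2) 1"
proof -
  interpret prob_space M using filtered_space by (simp add: complete_filtered_prob_space_def)
  have M: "prob_space M" by unfold_locales
  have cc: "sch = Forward \<longrightarrow> Cc \<le> 1" using coupling_constant by simp
  have X0: "X0 \<in> borel_measurable M"
  proof -
    have "subalgebra M (F 0)" using filtered_space T by (simp add: complete_filtered_prob_space_def)
    then show ?thesis using X0_adapted by (rule measurable_from_subalg)
  qed
  have conv: "noise_expansion_converges M L (\<beta> - 1)"
    using noise noise_expansion_of_scaled_identical[OF M levy(2)] by auto
  let ?N = "enn2real (L2_H_norm M (min (2 - \<rho>) \<gamma>) (\<lambda>\<omega>. sph_coeff (X0 \<omega>)))"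
  obtain C where C: "0 \<le> C" and strong: "\<And>\<kappa> n k h. n \<ge> 1 \<Longrightarrow> k \<in> {1..n} \<Longrightarrow> h = T / real n \<Longrightarrow> sph_eig \<kappa> * h \<le> Cc \<Longrightarrow>
    (\<integral>\<^sup>+\<omega>. ennreal (\<Sum>l\<le>\<kappa>. \<Sum>m\<in>{- int l..int l}.
        (1 + sph_eig l) powr (- \<rho>) * (mode_error sch X0 L I h k \<omega> l m)\<^sup>2) \<partial>M)
    \<le> ennreal ((C * (h powr \<mu> * (real k * h) powr (min 1 ((\<gamma> + \<rho>) / 2) - \<mu>) * ?N
        + h powr min ((\<beta> + \<rho>) / 2) 1))\<^sup>2)"
    using strong_error_negative_norm[OF M T levy(2) X0 X0_regular(2) stoch_convolution cc X0_regular(1) rho mu conv] by blast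
  show ?thesis
  proof (intro exI[of _ "max 0 K * C"] allI impI ballI)
    fix \<kappa> n k :: nat and h t D
    assume \<kappa>: "\<kappa> \<ge> 1" and n: "n \<ge> 1" and k: "k \<in> {1..n}" and h: "h = T / real n"
      and c: "sph_eig \<kappa> * h \<le> Cc" and t: "t = real k * h"
      and D: "D = (\<lambda>\<omega>. \<phi> (spectral_approx X0 I \<kappa> t \<omega>) - \<phi> (em_approx sch X0 L \<kappa> h k \<omega>))"
    have h0: "0 < h" using n T by (simp add: h)
    have "real k * h \<le> real n * h" using k h0 by (intro mult_right_mono) auto
    moreover have "real n * h = T" using n h by simp
    ultimately have t0: "0 \<le> t" "t \<le> T" using h0 by (auto simp: t)
    define R where "R = C * (h powr \<mu> * t powr (min 1 ((\<gamma> + \<rho>) / 2) - \<mu>) * ?N + h powr min ((\<beta> + \<rho>) / 2) 1)"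
    have R: "0 \<le> R" unfolding R_def using C by (intro mult_nonneg_nonneg add_nonneg_nonneg) auto
    let ?ca = "\<lambda>\<omega> l m. exp (- sph_eig l * t) * sph_coeff (X0 \<omega>) l m + I l m t \<omega>"
    let ?cb = "\<lambda>\<omega> l m. em_xi sch h l ^ k * sph_coeff (X0 \<omega>) l m +
         (\<Sum>j=1..k. em_xi sch h l ^ (k - j + em_delta sch) *
            (L (real j * h) \<omega> l m - L (real (j - 1) * h) \<omega> l m))"
    have x_meas: "(\<lambda>\<omega>. sph_coeff (X0 \<omega>) l m) \<in> borel_measurable M" for l m
      using X0 by (rule measurable_sph_coeff)
    have I_meas: "I l m t \<in> borel_measurable M" if "m \<in> {- int l..int l}" for l m
      using stoch_convolution that t0 by (auto simp: stoch_convolution_def has_stoch_integral_def)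
    have L_meas: "(\<lambda>\<omega>. L u \<omega> l m) \<in> borel_measurable M" if "m \<in> {- int l..int l}" "0 \<le> u" for l m u
      using linear_moments.X_measurable[OF levy_coefficient_moments[OF M levy(2) that(1)] that(2)] .
    define G where "G = (\<lambda>\<omega> y. \<phi>' (y *\<^sub>R em_approx sch X0 L \<kappa> h k \<omega> + (1 - y) *\<^sub>R spectral_approx X0 I \<kappa> t \<omega>))"
    have Gb: "(AE \<omega> in M. G \<omega> integrable_on {0..1}) \<and>
        (\<lambda>\<omega>. integral {0..1} (G \<omega>)) \<in> borel_measurable M \<and>
        L2_H_norm M \<rho> (\<lambda>\<omega>. sph_coeff (integral {0..1} (G \<omega>))) \<le> ennreal K"
      using \<kappa> n k h c by (intro derivative_bound[of \<kappa> n h k]) (auto simp: G_def t)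
    have "integrable M (\<lambda>\<omega>. \<phi> (spectral_approx X0 I \<kappa> t \<omega>) - \<phi> (em_approx sch X0 L \<kappa> h k \<omega>)) \<and>
      \<bar>expectation (\<lambda>\<omega>. \<phi> (spectral_approx X0 I \<kappa> t \<omega>) - \<phi> (em_approx sch X0 L \<kappa> h k \<omega>))\<bar> \<le> max 0 K * R"
    proof (rule weak_error_le[where ca = ?ca and cb = ?cb and G = G, OF differentiable])
      show "(\<lambda>\<omega>. ?ca \<omega> l m) \<in> borel_measurable M" if "m \<in> {- int l..int l}" for l m
        using that by (intro borel_measurable_add borel_measurable_times borel_measurable_const x_meas I_meas)
      show "(\<lambda>\<omega>. ?cb \<omega> l m) \<in> borel_measurable M" if "m \<in> {- int l..int l}" for l m
        using that h0 by (intro borel_measurable_add borel_measurable_sum borel_measurable_times borel_measurable_diff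
            borel_measurable_const x_meas L_meas) auto
      show "(\<integral>\<^sup>+\<omega>. ennreal (\<Sum>l\<le>\<kappa>. \<Sum>m\<in>{- int l..int l}. (1 + sph_eig l) powr (- \<rho>) * (?ca \<omega> l m - ?cb \<omega> l m)\<^sup>2) \<partial>M) \<le> ennreal (R\<^sup>2)"
        using strong[OF n k h c] by (simp only: mode_error_def R_def t)
      show "(\<lambda>\<omega>. spectral_approx X0 I \<kappa> t \<omega>) = (\<lambda>\<omega>. \<Sum>l\<le>\<kappa>. \<Sum>m\<in>{- int l..int l}. ?ca \<omega> l m *\<^sub>R Ylm l m)"
        by (simp only: spectral_approx_def)
      show "(\<lambda>\<omega>. em_approx sch X0 L \<kappa> h k \<omega>) = (\<lambda>\<omega>. \<Sum>l\<le>\<kappa>. \<Sum>m\<in>{- int l..int l}. ?cb \<omega> l m *\<^sub>R Ylm l m)"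
        by (simp only: em_approx_def)
    qed (use Gb R in \<open>simp_all only: G_def\<close>)
    moreover have "max 0 K * R = max 0 K * C * h powr \<mu> * t powr (min 1 ((\<gamma> + \<rho>) / 2) - \<mu>) * ?N
        + max 0 K * C * h powr min ((\<beta> + \<rho>) / 2) 1"
      by (simp add: R_def algebra_simps)
    ultimately show "integrable M D \<and> \<bar>\<integral>\<omega>. D \<omega> \<partial>M\<bar> \<le> max 0 K * C * h powr \<mu> * t powr (min 1 ((\<gamma> + \<rho>) / 2) - \<mu>) * ?N
        + max 0 K * C * h powr min ((\<beta> + \<rho>) / 2) 1"
      by (simp only: D)
  qed
qed

end
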